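(* Let $N\ge 2$ and $\Omega=\mathbb{R}\times\omega\subset\mathbb{R}^N$, where $\omega\subset\mathbb{R}^{N-1}$ is a bounded connected open set of class $C^1$, with outward unit normal $n$ on $\partial\Omega$. Let $\psi\in C^2(\Omega,\mathbb{R})\cap C^1(\overline{\Omega},\mathbb{R})$ be harmonic in $\Omega$ ($\Delta\psi=0$), with $\nabla\psi\cdot n=0$ on $\partial\Omega$ and $\inf_{\overline{\Omega}}|\nabla\psi|>0$. Then there exist $a\in\mathbb{R}\setminus\{0\}$ and $b\in\mathbb{R}$ such that $\psi(x)=a\,x_1+b$ for all $x=(x_1,\dots,x_N)\in\overline{\Omega}$.
   Context: $|\cdot|$ denotes the Euclidean norm on $\mathbb{R}^N$. *)

theory Defs
  imports "HOL-Analysis.Analysis"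
begin

definition local_C1_defining_fun ::
  "'a::euclidean_space set \<Rightarrow> 'a \<Rightarrow> real \<Rightarrow> ('a \<Rightarrow> real) \<Rightarrow> ('a \<Rightarrow> 'a) \<Rightarrow> bool" where
  "local_C1_defining_fun U p r phi Dphi \<longleftrightarrow>
     r > 0 \<and>
     (\<forall>y\<in>ball p r. (phi has_derivative (\<lambda>h. Dphi y \<bullet> h)) (at y)) \<and>
     continuous_on (ball p r) Dphi \<and>
     (\<forall>y\<in>ball p r. Dphi y \<noteq> 0) \<and>
     U \<inter> ball p r = {y \<in> ball p r. phi y < 0}"

definition C1_domain :: "'a::euclidean_space set \<Rightarrow> bool" where
  "C1_domain U \<longleftrightarrow> open U \<and>
     (\<forall>p\<in>frontier U. \<exists>r phi Dphi. local_C1_defining_fun U p r phi Dphi)"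

definition outward_unit_normal :: "'a::euclidean_space set \<Rightarrow> 'a \<Rightarrow> 'a \<Rightarrow> bool" where
  "outward_unit_normal U p nu \<longleftrightarrow> p \<in> frontier U \<and>
     (\<exists>r phi Dphi. local_C1_defining_fun U p r phi Dphi \<and> nu = Dphi p /\<^sub>R norm (Dphi p))"

end

theory Submission
  imports Defs
begin

text \<open>
  Write points of the cylinder as $(s,y)$ and integrate over cross-sections only.

  Since $|\nabla\psi| \ge c > 0$ and $\nabla\psi$ is tangential on the boundary, a continuous
  perturbation of $x \mapsto x + \tau(x) \nabla\psi(x)$ maps the closed cylinder to itself and raises
  $\psi$ by at least $c/2$ times the distance moved. Orbits of this map leave every compact set with
  $\psi \to \infty$; by connectedness they all leave through the same end. Together with the
  same statement for $-\psi$ this bounds $\psi$ from above on one half of the cylinder and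
  from below on the other. The flux $\int \partial_s\psi \, dy$ is constant, so $\int \psi \, dy$ is affine in $s$
  and $\int |\psi| \, dy = O(1 + |s|)$.

  Spectral theory on the cross-section is replaced by the function $P(s,t) = \int \psi(s,y) \psi(t,y) \, dy$.
  It solves the wave equation, so $P(s+r,t+r) - P(s,t)$ depends on $s+t$ and $r$ only. Hence the energy
  $E(s) = P(s,s)$ satisfies $E(s+q) - E(s) = P(q,2s+q) - P(0,2s) = O(1 + |s|)$. For the difference
  $w(s,y) = \psi(s+2q,y) - \psi(s,y)$ the energy is $E(s+2q) - 2E(s+q) + E(s)$ up to a constant;
  it is convex with second derivative $2 \int |\nabla w|^2$, and a nonconstant convex function would
  make $E(s+q) - E(s)$ grow quadratically. So $\nabla w = 0$, the gradient of $\psi$ is independent of $s$,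
  and one more application of Green's identity shows that $\psi$ is affine.
\<close>

section \<open>Smooth steps and integrals of directional derivatives\<close>

text \<open>The function \<open>\<psi>\<close> is only C1 up to the boundary and the cross-section
  is only C1. Its gradient need not be Lipschitz near the boundary, so the gradient flow gives way
  to a discrete map, and Green's identity has to be reached through cut-offs that vanish near the
  boundary. A growth bound is indispensable: products exp(sqrt(lambda) s) e(y) with a Neumann
  eigenfunction e are harmonic with zero Neumann data, and only the absence of critical points rules
  them out. One-sided bounds suffice because they turn the integral of |\<open>\<psi>\<close>| into
  plus or minus that of \<open>\<psi>\<close>, up to a constant. The function P comes from expansion
  in modes: if u is the sum of f_k(s) e_k(y) with orthonormal e_k and f_k'' = lambda_k f_k, then
  P(s,t) is the sum of f_k(s) f_k(t), and each term solves the wave equation whatever lambda_k is.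
  Second differences of the energy are taken because E is quadratic already for affine u, whereas w
  is then constant.\<close>

definition smoothstep :: "real \<Rightarrow> real" where
  "smoothstep s = 1 - (max 0 (1 - (max 0 (s - 1))\<^sup>2))\<^sup>2"

definition smoothstep' :: "real \<Rightarrow> real" where
  "smoothstep' s = 4 * max 0 (1 - (max 0 (s - 1))\<^sup>2) * max 0 (s - 1)"

text \<open>Squares of positive parts are C1 with an explicit derivative. Nesting two of them yields
  the step \<open>smoothstep\<close>, whose transition takes place on [1, 2]; first-order smoothness
  is all that the cut-offs below require.\<close>

lemma has_real_derivative_max0_square:
  "((\<lambda>s. (max 0 s)\<^sup>2) has_real_derivative 2 * max 0 s) (at (s::real))"
proof -
  consider "s < 0" | "s = 0" | "s > 0" by linarith
  then show ?thesis
  proof cases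
    case 1
    have "((\<lambda>s. 0) has_real_derivative 2 * max 0 s) (at s)" using 1 by simp
    then show ?thesis
      by (rule has_field_derivative_transform_within_open[where S="{..<0}"]) (use 1 in auto)
  next
    case 3
    have "((\<lambda>s. s\<^sup>2) has_real_derivative 2 * max 0 s) (at s)" using 3 by (auto intro!: derivative_eq_intros)
    then show ?thesis
      by (rule has_field_derivative_transform_within_open[where S="{0<..}"]) (use 3 in auto)
  next
    case 2
    have "((\<lambda>h. (max 0 h)\<^sup>2 / h) \<longlongrightarrow> 0) (at (0::real))"
    proof (rule Lim_null_comparison[where g="\<lambda>h. \<bar>h\<bar>"])
      show "\<forall>\<^sub>F h in at (0::real). norm ((max 0 h)\<^sup>2 / h) \<le> \<bar>h\<bar>"
        by (intro always_eventually allI) (auto simp: max_def power2_eq_square)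
      show "((\<lambda>h. \<bar>h::real\<bar>) \<longlongrightarrow> 0) (at 0)" by (rule tendsto_rabs_zero) (rule tendsto_ident_at)
    qed
    then show ?thesis using 2 by (simp add: DERIV_def)
  qed
qed

lemma smoothstep_derivative: "(smoothstep has_real_derivative smoothstep' s) (at s)"
proof -
  let ?q = "\<lambda>s::real. (max 0 s)\<^sup>2"
  have "((\<lambda>s. ?q (s - 1)) has_real_derivative 2 * max 0 (s - 1) * 1) (at s)"
    by (rule DERIV_chain2[OF has_real_derivative_max0_square]) (auto intro!: derivative_eq_intros)
  then have "((\<lambda>s. 1 - ?q (s - 1)) has_real_derivative - (2 * max 0 (s - 1))) (at s)"
    using DERIV_diff[OF DERIV_const[of 1]] by fastforce
  then have "((\<lambda>s. ?q (1 - ?q (s - 1))) has_real_derivative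
      2 * max 0 (1 - ?q (s - 1)) * - (2 * max 0 (s - 1))) (at s)"
    by (rule DERIV_chain2[OF has_real_derivative_max0_square])
  from DERIV_diff[OF DERIV_const[of 1] this] show ?thesis
    by (simp add: smoothstep_def[abs_def] smoothstep'_def algebra_simps)
qed

lemma smoothstep'_nonneg: "0 \<le> smoothstep' s"
  by (simp add: smoothstep'_def)

lemma continuous_smoothstep': "continuous_on S smoothstep'"
  unfolding smoothstep'_def[abs_def] by (intro continuous_intros)

lemma smoothstep_bounds: "0 \<le> smoothstep s" "smoothstep s \<le> 1"
proof -
  have "(max 0 (1 - (max 0 (s - 1))\<^sup>2))\<^sup>2 \<le> 1"
    by (rule power_le_one) auto
  then show "0 \<le> smoothstep s" by (simp add: smoothstep_def)
qed (simp add: smoothstep_def)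

lemma smoothstep_eq_0: "s \<le> 1 \<Longrightarrow> smoothstep s = 0"
  by (simp add: smoothstep_def)

lemma one_le_max_sq: "s \<ge> 2 \<Longrightarrow> 1 \<le> (max 0 (s - 1))\<^sup>2" for s :: real
  by (rule one_le_power) simp

lemma smoothstep_eq_1: "s \<ge> 2 \<Longrightarrow> smoothstep s = 1"
  using one_le_max_sq[of s] by (simp add: smoothstep_def)

lemma smoothstep'_eq_0: "s \<le> 1 \<or> s \<ge> 2 \<Longrightarrow> smoothstep' s = 0"
  using one_le_max_sq[of s] by (auto simp: smoothstep'_def)

section \<open>Vanishing integrals of directional derivatives\<close>

lemma integrable_indicator_cball:
  "integrable lborel (\<lambda>x::'a::euclidean_space. indicator (cball a R) x *\<^sub>R (c::real))"
proof -
  have "emeasure lborel (cball a R) < \<infinity>" by (rule emeasure_bounded_finite) simp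
  then show ?thesis by (intro integrable_scaleR_left) (simp add: integrable_indicator_iff)
qed

lemma compact_continuous_bound:
  assumes "compact K" "continuous_on K f"
  obtains C where "0 \<le> C" "\<And>x. x \<in> K \<Longrightarrow> norm (f x :: 'b::real_normed_vector) \<le> C"
proof -
  obtain C where "\<forall>y\<in>f ` K. norm y \<le> C"
    using compact_imp_bounded[OF compact_continuous_image[OF assms(2,1)]] by (auto simp: bounded_iff)
  then show ?thesis using that[of "max C 0"] by (force simp: le_max_iff_disj)
qed

lemma has_real_derivative_along_line:
  assumes "(f has_derivative f') (at (x + t *\<^sub>R v))"
  shows "((\<lambda>t. f (x + t *\<^sub>R v)) has_real_derivative f' v) (at t)"
proof -
  have "((\<lambda>t. f (x + t *\<^sub>R v)) has_derivative (\<lambda>h. f' (h *\<^sub>R v))) (at t)"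
    by (rule has_derivative_compose[where f="\<lambda>t. x + t *\<^sub>R v" and g=f, OF _ assms]) (auto intro!: derivative_eq_intros)
  moreover have "f' (h *\<^sub>R v) = h * f' v" for h
    using linear_cmul[OF has_derivative_linear[OF assms]] by simp
  ultimately show ?thesis
    by (simp add: has_field_derivative_def mult_commute_abs)
qed

text \<open>Translation invariance of Lebesgue measure makes the integral of each difference
  quotient along \<open>v\<close> zero. The mean value theorem bounds the quotients uniformly, and
  dominated convergence passes to the derivative. Every integration by parts below rests on this,
  without Fubini or coordinates.\<close>

lemma integral_directional_derivative_eq_0:
  fixes f :: "'a::euclidean_space \<Rightarrow> real"
  assumes der: "\<And>x. (f has_derivative f' x) (at x)"
    and cont: "continuous_on UNIV (\<lambda>x. f' x v)"
    and bdd: "bounded B" and supp: "\<And>x. x \<notin> B \<Longrightarrow> f x = 0"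
  shows "integrable lborel (\<lambda>x. f' x v)" "integral\<^sup>L lborel (\<lambda>x. f' x v) = 0"
proof -
  have fcont: "continuous_on UNIV f"
    by (rule has_derivative_continuous_on) (use der in \<open>auto intro: has_derivative_at_withinI\<close>)
  obtain R where R: "\<And>x. x \<in> B \<Longrightarrow> norm x \<le> R" using bdd by (auto simp: bounded_iff)
  \<comment> \<open>Enlarging the radius by \<open>norm v\<close> makes \<open>K\<close> contain the
    supports of all difference quotients, whose steps are at most \<open>norm v\<close>
    long.\<close>
  define K where "K = cball (0::'a) (R + norm v)"
  have cK: "compact K" by (simp add: K_def)
  have f0: "f x = 0" if "x \<notin> cball 0 R" for x using supp[of x] R[of x] that by auto
  have f'0: "f' x v = 0" if "x \<notin> K" for x
  proof -
    have x: "x \<in> - cball 0 R" using that norm_ge_zero[of v] by (auto simp: K_def dist_norm simp del: norm_ge_zero)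
    have "(f has_derivative (\<lambda>h. 0)) (at x)"
      by (rule has_derivative_transform_within_open[of "\<lambda>_. 0" _ _ _ "- cball 0 R"]) (use x f0 in auto)
    then show ?thesis using has_derivative_unique[OF der[of x]] by metis
  qed
  obtain M where M: "\<And>x. x \<in> K \<Longrightarrow> norm (f' x v) \<le> M"
    using compact_continuous_bound[OF cK continuous_on_subset[OF cont]] by blast
  have Mall: "norm (f' x v) \<le> max M 0" for x
    using M[of x] f'0[of x] by (cases "x \<in> K") auto
  have ind_int: "integrable lborel (\<lambda>x. indicator K x *\<^sub>R (max M 0))"
    unfolding K_def by (rule integrable_indicator_cball)
  define g where "g = (\<lambda>n x. real (Suc n) * (f (x + v /\<^sub>R real (Suc n)) - f x))"
  have fm: "f \<in> borel_measurable lborel" using fcont borel_measurable_continuous_onI by auto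
  have f'm: "(\<lambda>x. f' x v) \<in> borel_measurable lborel" using cont borel_measurable_continuous_onI by auto
  have fint: "integrable lborel f"
  proof -
    obtain C where C: "\<And>x. x \<in> cball 0 R \<Longrightarrow> norm (f x) \<le> C"
      using compact_continuous_bound[OF compact_cball continuous_on_subset[OF fcont]] by blast
    show ?thesis
    proof (rule Bochner_Integration.integrable_bound)
      show "integrable lborel (\<lambda>x::'a. indicator (cball 0 R) x *\<^sub>R (max C 0))"
        by (rule integrable_indicator_cball)
      show "AE x in lborel. norm (f x) \<le> norm (indicator (cball 0 R) x *\<^sub>R (max C 0))"
      proof (rule AE_I2)
        fix x show "norm (f x) \<le> norm (indicator (cball 0 R) x *\<^sub>R (max C 0))"
          using C[of x] f0[of x] by (cases "x \<in> cball 0 R") (auto simp: indicator_def)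
      qed
    qed (use fm in auto)
  qed
  have shift: "integrable lborel (\<lambda>x. f (x + a))" "integral\<^sup>L lborel (\<lambda>x. f (x + a)) = integral\<^sup>L lborel f" for a
  proof -
    have e: "lborel = distr lborel borel ((+) a)" by (simp add: lborel_distr_plus)
    have "integrable lborel (\<lambda>x. f (a + x))"
      using fint fm by (subst (asm) e) (simp add: integrable_distr_eq)
    then show "integrable lborel (\<lambda>x. f (x + a))" by (simp add: add.commute)
    have "integral\<^sup>L lborel f = integral\<^sup>L (distr lborel borel ((+) a)) f" by (simp only: lborel_distr_plus)
    also have "\<dots> = integral\<^sup>L lborel (\<lambda>x. f (a + x))" using fm by (subst integral_distr) auto
    finally show "integral\<^sup>L lborel (\<lambda>x. f (x + a)) = integral\<^sup>L lborel f" by (simp add: add.commute)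
  qed
  have g0: "integral\<^sup>L lborel (g n) = 0" for n
    unfolding g_def using shift fint by simp
  have lipg: "norm (g n x) \<le> max M 0" for n x
  proof -
    let ?t = "1 / real (Suc n)"
    have "\<exists>z. z > 0 \<and> z < ?t \<and> f (x + ?t *\<^sub>R v) - f (x + 0 *\<^sub>R v) = (?t - 0) * f' (x + z *\<^sub>R v) v"
    proof (rule MVT2)
      fix t :: real
      show "((\<lambda>t. f (x + t *\<^sub>R v)) has_real_derivative f' (x + t *\<^sub>R v) v) (at t)"
        by (rule has_real_derivative_along_line[OF der])
    qed simp
    then obtain z where "f (x + ?t *\<^sub>R v) - f x = ?t * f' (x + z *\<^sub>R v) v" by auto
    then have "g n x = f' (x + z *\<^sub>R v) v"
      unfolding g_def by (simp add: inverse_eq_divide)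
    then show ?thesis using Mall by simp
  qed
  have suppg: "g n x = 0" if "x \<notin> K" for n x
  proof -
    have "norm x > R + norm v" using that by (simp add: K_def)
    moreover have "norm (v /\<^sub>R real (Suc n)) \<le> norm v" 
      by (simp add: inverse_eq_divide divide_le_eq mult_le_cancel_left1)
    moreover have "norm x \<le> norm (x + v /\<^sub>R real (Suc n)) + norm (v /\<^sub>R real (Suc n))"
      using norm_triangle_ineq4[of "x + v /\<^sub>R real (Suc n)" "v /\<^sub>R real (Suc n)"] by simp
    ultimately have "norm (x + v /\<^sub>R real (Suc n)) > R" "norm x > R" using norm_ge_zero[of v] by linarith+
    then show ?thesis unfolding g_def using f0 by simp
  qed
  have limg: "(\<lambda>n. g n x) \<longlonglongrightarrow> f' x v" for x
  proof -
    have "((\<lambda>t. f (x + t *\<^sub>R v)) has_real_derivative f' x v) (at 0)"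
      using has_real_derivative_along_line[of f "f' x" x 0 v] der[of x] by simp
    then have "((\<lambda>h. (f (x + h *\<^sub>R v) - f x) / h) \<longlongrightarrow> f' x v) (at 0)" by (simp add: DERIV_def)
    moreover have "filterlim (\<lambda>n. 1 / real (Suc n)) (at 0) sequentially"
      using LIMSEQ_Suc[OF lim_1_over_n] by (auto simp: filterlim_at)
    ultimately have "(\<lambda>n. (f (x + (1 / real (Suc n)) *\<^sub>R v) - f x) / (1 / real (Suc n))) \<longlonglongrightarrow> f' x v"
      by (rule filterlim_compose)
    then show ?thesis by (simp add: g_def inverse_eq_divide mult.commute)
  qed
  have gm: "g n \<in> borel_measurable lborel" for n
    unfolding g_def using fm fint shift(1) by (intro borel_measurable_times borel_measurable_diff borel_measurable_integrable) auto
  have bd: "AE x in lborel. norm (g n x) \<le> indicator K x *\<^sub>R (max M 0)" for n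
  proof (rule AE_I2)
    fix x show "norm (g n x) \<le> indicator K x *\<^sub>R (max M 0)"
      using lipg[of n x] suppg[of x n] by (cases "x \<in> K") auto
  qed
  have lim: "AE x in lborel. (\<lambda>n. g n x) \<longlonglongrightarrow> f' x v"
    using limg by (intro AE_I2)
  show "integrable lborel (\<lambda>x. f' x v)"
    by (rule integrable_dominated_convergence[OF f'm gm ind_int lim bd])
  have "(\<lambda>n. integral\<^sup>L lborel (g n)) \<longlonglongrightarrow> integral\<^sup>L lborel (\<lambda>x. f' x v)"
    by (rule integral_dominated_convergence[OF f'm gm ind_int lim bd])
  then show "integral\<^sup>L lborel (\<lambda>x. f' x v) = 0"
    using g0 by (simp add: LIMSEQ_const_iff)
qed

section \<open>Continuous selections and ascending orbits\<close>

text \<open>Values that are admissible on a whole neighbourhood are averaged with a partition of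
  unity; convexity of the admissible set keeps the average admissible. It is applied to directions
  and then to step lengths.\<close>

lemma continuous_selection:
  fixes S :: "'a::{metric_space,second_countable_topology} set"
    and R :: "'a \<Rightarrow> 'b::real_normed_vector \<Rightarrow> bool"
  assumes conv: "\<And>x. x \<in> S \<Longrightarrow> convex {z. R x z}"
    and loc: "\<And>p. p \<in> S \<Longrightarrow> \<exists>z U. open U \<and> p \<in> U \<and> (\<forall>x\<in>U \<inter> S. R x z)"
  obtains f where "continuous_on S f" "\<And>x. x \<in> S \<Longrightarrow> R x (f x)"
proof -
  define C where "C = {U. open U \<and> (\<exists>z. \<forall>x\<in>U \<inter> S. R x z)}"
  have "S \<subseteq> \<Union>C" using loc by (fastforce simp: C_def)
  then obtain C' where C': "S \<subseteq> \<Union>C'"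
    and oC: "\<And>U. U \<in> C' \<Longrightarrow> open U \<and> (\<exists>T. T \<in> C \<and> U \<subseteq> T)"
    and fin: "\<And>x. x \<in> S \<Longrightarrow> \<exists>V. open V \<and> x \<in> V \<and> finite {U. U \<in> C' \<and> U \<inter> V \<noteq> {}}"
    by (rule paracompact) (auto simp: C_def)
  have "\<exists>z. \<forall>x\<in>U \<inter> S. R x z" if "U \<in> C'" for U
    using oC[OF that] by (fastforce simp: C_def)
  then obtain z where z: "\<And>U x. U \<in> C' \<Longrightarrow> x \<in> U \<Longrightarrow> x \<in> S \<Longrightarrow> R x (z U)" by (metis IntI)
  obtain F :: "'a set \<Rightarrow> 'a \<Rightarrow> real" where
    F1: "\<And>U. U \<in> C' \<Longrightarrow> continuous_on S (F U) \<and> (\<forall>x\<in>S. 0 \<le> F U x)"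
    and F2: "\<And>x U. \<lbrakk>U \<in> C'; x \<in> S; x \<notin> U\<rbrakk> \<Longrightarrow> F U x = 0"
    and F3: "\<And>x. x \<in> S \<Longrightarrow> supp_sum (\<lambda>W. F W x) C' = 1"
    and F4: "\<And>x. x \<in> S \<Longrightarrow> \<exists>V. open V \<and> x \<in> V \<and> finite {U \<in> C'. \<exists>x\<in>V. F U x \<noteq> 0}"
    by (rule subordinate_partition_of_unity[OF C' _ fin]) (use oC in auto)
  define f where "f x = (\<Sum>U\<in>{U\<in>C'. F U x \<noteq> 0}. F U x *\<^sub>R z U)" for x
  show ?thesis
  proof
    fix x assume x: "x \<in> S"
    from F4[OF x] obtain V where V: "open V" "x \<in> V" "finite {U \<in> C'. \<exists>x\<in>V. F U x \<noteq> 0}" by blast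
    have fin': "finite {U\<in>C'. F U x \<noteq> 0}" by (rule finite_subset[OF _ V(3)]) (use V in auto)
    have "f x \<in> {z. R x z}" unfolding f_def
    proof (rule convex_sum[OF fin' conv[OF x]])
      show "(\<Sum>U\<in>{U\<in>C'. F U x \<noteq> 0}. F U x) = 1"
        using F3[OF x] by (simp add: supp_sum_def support_on_def)
      fix U assume U: "U \<in> {U\<in>C'. F U x \<noteq> 0}"
      show "0 \<le> F U x" using F1 U x by auto
      show "z U \<in> {z. R x z}" using z[of U x] F2[of U x] U x by auto
    qed
    then show "R x (f x)" by simp
  next
    show "continuous_on S f" unfolding continuous_on_eq_continuous_within
    proof
      fix x assume x: "x \<in> S"
      from F4[OF x] obtain V where V: "open V" "x \<in> V" "finite {U \<in> C'. \<exists>x\<in>V. F U x \<noteq> 0}" by blast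
      let ?J = "{U \<in> C'. \<exists>x\<in>V. F U x \<noteq> 0}"
      have eq: "f y = (\<Sum>U\<in>?J. F U y *\<^sub>R z U)" if "y \<in> S \<inter> V" for y
        unfolding f_def using V that by (intro sum.mono_neutral_left) auto
      have "continuous_on S (\<lambda>y. \<Sum>U\<in>?J. F U y *\<^sub>R z U)"
        using F1 by (intro continuous_on_sum continuous_on_scaleR) auto
      then have "continuous_on (S \<inter> V) (\<lambda>y. \<Sum>U\<in>?J. F U y *\<^sub>R z U)"
        by (rule continuous_on_subset) auto
      then have "continuous_on (S \<inter> V) f"
        by (subst continuous_on_cong[OF refl eq]) auto
      then have "continuous (at x within (S \<inter> V)) f"
        using x V by (simp add: continuous_on_eq_continuous_within)
      moreover have "at x within (S \<inter> V) = at x within S"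
        by (rule at_within_nhd[OF V(2,1)]) auto
      ultimately show "continuous (at x within S) f" by simp
    qed
  qed
qed

text \<open>Every orbit climbs above the maximum \<open>M\<close> of \<open>\<psi>\<close> on the
  slab |s| <= 1, and from then on stays on one side of the slab. The side is locally constant in the
  starting point, hence the same for all. If all orbits end on the right, one that starts on the
  left has to cross the slab, where \<open>\<psi>\<close> is at most \<open>M\<close>, after gaining
  \<open>c\<close> times the distance travelled; this bounds its initial value.\<close>

lemma ascending_orbits_one_sided_bound:
  fixes \<psi> :: "real \<times> 'a::euclidean_space \<Rightarrow> real"
  assumes K: "compact K" "connected K" and S: "S = UNIV \<times> K"
    and \<Phi>: "\<And>x. x \<in> S \<Longrightarrow> \<Phi> x \<in> S" "continuous_on S \<Phi>"
    and \<psi>: "continuous_on S \<psi>" and c: "c > 0"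
    and gain: "\<And>x. x \<in> S \<Longrightarrow> \<psi> x + c * dist x (\<Phi> x) \<le> \<psi> (\<Phi> x)"
    and step: "\<And>x. x \<in> S \<Longrightarrow> 0 < dist x (\<Phi> x)" "\<And>x. x \<in> S \<Longrightarrow> dist x (\<Phi> x) \<le> 1"
  shows "\<exists>M. (\<forall>x\<in>S. fst x \<le> 0 \<longrightarrow> \<psi> x \<le> M + c * fst x) \<or>
             (\<forall>x\<in>S. 0 \<le> fst x \<longrightarrow> \<psi> x \<le> M - c * fst x)"
proof -
  define a where "a x n = (\<Phi> ^^ n) x" for x n
  have a0: "a x 0 = x" and aS: "a x (Suc n) = \<Phi> (a x n)" for x n by (simp_all add: a_def)
  have aS_in: "a x n \<in> S" if "x \<in> S" for x n by (induction n) (simp_all add: a0 aS that \<Phi>)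
  have acont: "continuous_on S (\<lambda>x. a x n)" for n
  proof (induction n)
    case (Suc n)
    then show ?case unfolding aS
      by (rule continuous_on_compose2[OF \<Phi>(2)]) (use aS_in in auto)
  qed (simp add: a0)
  have again: "\<psi> x + c * dist x (a x n) \<le> \<psi> (a x n)" if "x \<in> S" for x n
  proof (induction n)
    case (Suc n)
    have "c * dist x (a x (Suc n)) \<le> c * dist x (a x n) + c * dist (a x n) (a x (Suc n))"
      using c dist_triangle[of x "a x (Suc n)" "a x n"] by (simp flip: distrib_left)
    moreover have "\<psi> (a x n) + c * dist (a x n) (a x (Suc n)) \<le> \<psi> (a x (Suc n))"
      using gain[OF aS_in[OF that]] by (simp add: aS)
    ultimately show ?case using Suc by linarith
  qed (simp add: a0)
  have afst: "\<bar>fst (a x (Suc n)) - fst (a x n)\<bar> \<le> 1" if "x \<in> S" for x n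
    using step(2)[OF aS_in[OF that, of n]] dist_fst_le[of "a x n" "a x (Suc n)"]
    by (simp add: aS dist_real_def abs_minus_commute)
  have unb: "\<exists>n. \<psi> (a x n) > B" if x: "x \<in> S" for x B
  proof (rule ccontr)
    assume "\<not> ?thesis"
    then have B: "\<psi> (a x n) \<le> B" for n by (simp add: not_less)
    \<comment> \<open>As long as \<open>\<psi>\<close> stays below \<open>B\<close>, the gain
      inequality keeps the orbit within distance \<open>r\<close> of its start. On that compact
      piece of the cylinder the step length has a positive minimum, so the gain after n steps grows
      linearly in n, a contradiction.\<close>
    define r where "r = (B - \<psi> x) / c"
    have inr: "a x n \<in> cball (fst x) r \<times> K" for n
    proof -
      have "c * dist x (a x n) \<le> B - \<psi> x" using again[OF x, of n] B[of n] by linarith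
      then have "dist x (a x n) \<le> r" using c by (simp add: r_def field_simps)
      then have "dist (fst x) (fst (a x n)) \<le> r" using dist_fst_le[of x "a x n"] by linarith
      then show ?thesis using aS_in[OF x, of n] by (auto simp: S mem_Times_iff)
    qed
    have cQ: "compact (cball (fst x) r \<times> K)" using K by (intro compact_Times) auto
    have QS: "cball (fst x) r \<times> K \<subseteq> S" by (auto simp: S)
    have "continuous_on (cball (fst x) r \<times> K) (\<lambda>x. dist x (\<Phi> x))"
      by (intro continuous_intros continuous_on_subset[OF \<Phi>(2) QS])
    then obtain q where q: "q \<in> cball (fst x) r \<times> K" "\<And>y. y \<in> cball (fst x) r \<times> K \<Longrightarrow> dist q (\<Phi> q) \<le> dist y (\<Phi> y)"
      using continuous_attains_inf[OF cQ] inr[of 0] by blast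
    define d where "d = dist q (\<Phi> q)"
    have d: "d > 0" using step(1) q QS by (auto simp: d_def)
    have "\<psi> x + c * (real n * d) \<le> \<psi> (a x n)" for n
    proof (induction n)
      case (Suc n)
      have "c * d \<le> c * dist (a x n) (\<Phi> (a x n))" using q(2)[OF inr[of n]] c by (simp add: d_def)
      then show ?case using Suc gain[OF aS_in[OF x, of n]] by (simp add: aS algebra_simps)
    qed (simp add: a0)
    then have le: "real n * (c * d) \<le> B - \<psi> x" for n using B[of n] by (smt (verit) mult.left_commute)
    obtain n where "B - \<psi> x < real n * (c * d)"
      using reals_Archimedean3[of "c * d"] c d by auto
    then show False using le[of n] by linarith
  qed
  have "compact ({-1..1::real} \<times> K)" using K by (intro compact_Times) auto
  moreover have "{-1..1::real} \<times> K \<subseteq> S" by (auto simp: S)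
  ultimately have "bounded (\<psi> ` ({-1..1} \<times> K))"
    using compact_imp_bounded[OF compact_continuous_image[OF continuous_on_subset[OF \<psi>]]] by blast
  then obtain M where "\<And>x. x \<in> {-1..1} \<times> K \<Longrightarrow> norm (\<psi> x) \<le> M" by (auto simp: bounded_iff)
  then have M: "\<psi> x \<le> M" if "x \<in> S" "\<bar>fst x\<bar> \<le> 1" for x
  proof -
    have "x \<in> {-1..1} \<times> K" using that by (auto simp: S mem_Times_iff)
    then show ?thesis using \<open>\<And>x. x \<in> {-1..1} \<times> K \<Longrightarrow> norm (\<psi> x) \<le> M\<close>[of x] by simp
  qed
  have bound: "\<psi> x \<le> M + c + c * (\<sigma> * fst x)"
    if x: "x \<in> S" and \<sigma>: "\<sigma> = 1 \<or> \<sigma> = -1" and ex: "\<exists>n. \<sigma> * fst (a x n) > 1" and neg: "\<sigma> * fst x \<le> 0" for x \<sigma>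
  proof -
    \<comment> \<open>The first arrival at the slab, where \<open>\<sigma>\<close> is 1 for orbits
      ending on the right and -1 for those ending on the left. Steps have length at most 1, so the
      orbit lands in the slab and cannot jump over it.\<close>
    define n where "n = (LEAST n. \<sigma> * fst (a x n) \<ge> -1)"
    have ex': "\<exists>n. \<sigma> * fst (a x n) \<ge> -1" proof -
      obtain n where "\<sigma> * fst (a x n) > 1" using ex by blast
      then have "\<sigma> * fst (a x n) \<ge> -1" by linarith
      then show ?thesis by blast
    qed
    have n: "\<sigma> * fst (a x n) \<ge> -1" unfolding n_def using ex' by (rule LeastI_ex)
    have "\<sigma> * fst (a x n) \<le> 0"
    proof (cases n)
      case (Suc m)
      then have "\<not> \<sigma> * fst (a x m) \<ge> -1" unfolding n_def using not_less_Least by (metis lessI)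
      then show ?thesis using afst[OF x, of m] \<sigma> Suc by auto
    qed (use neg a0 in simp)
    then have "\<bar>fst (a x n)\<bar> \<le> 1" using n \<sigma> by auto
    then have "\<psi> (a x n) \<le> M" using M aS_in[OF x] by blast
    moreover have "- 1 - \<sigma> * fst x \<le> dist x (a x n)"
    proof -
      have "\<sigma> * fst (a x n) - \<sigma> * fst x \<le> dist (fst x) (fst (a x n))" using \<sigma> by (auto simp: dist_real_def)
      also have "\<dots> \<le> dist x (a x n)" by (rule dist_fst_le)
      finally show ?thesis using n by linarith
    qed
    then have "c * (- 1 - \<sigma> * fst x) \<le> c * dist x (a x n)" using c by simp
    ultimately show ?thesis using again[OF x, of n] by (simp add: algebra_simps)
  qed
  \<comment> \<open>Asking for one time n with strict inequalities makes these sets open; the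
    condition that \<open>\<psi>\<close> exceeds \<open>M\<close> makes the exit final.\<close>
  define U where "U \<sigma> = {x\<in>S. \<exists>n. \<psi> (a x n) > M \<and> \<sigma> * fst (a x n) > 1}" for \<sigma> :: real
  have Ucov: "S \<subseteq> U 1 \<union> U (-1)"
  proof
    fix x assume x: "x \<in> S"
    obtain n where n: "\<psi> (a x n) > M" using unb[OF x] by blast
    then have "\<not> \<bar>fst (a x n)\<bar> \<le> 1" using M[OF aS_in[OF x]] by fastforce
    then show "x \<in> U 1 \<union> U (-1)" using x n by (auto simp: U_def abs_if split: if_splits)
  qed
  \<comment> \<open>Above the level \<open>M\<close> the orbit cannot be in the slab, and a step of
    length at most 1 cannot cross its width 2, so the side never changes.\<close>
  have Uinv: "\<psi> (a x m) > M \<and> \<sigma> * fst (a x m) > 1"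
    if x: "x \<in> S" and \<sigma>: "\<sigma> = 1 \<or> \<sigma> = -1" and n: "\<psi> (a x n) > M" "\<sigma> * fst (a x n) > 1" and "n \<le> m" for x \<sigma> n m
    using \<open>n \<le> m\<close>
  proof (induction m rule: dec_induct)
    case (step m)
    have "\<psi> (a x m) \<le> \<psi> (a x (Suc m))"
      using gain[OF aS_in[OF x, of m]] c zero_le_dist[of "a x m" "\<Phi> (a x m)"] unfolding aS
      by (smt (verit) mult_nonneg_nonneg)
    then have 1: "\<psi> (a x (Suc m)) > M" using step by linarith
    then have "\<not> \<bar>fst (a x (Suc m))\<bar> \<le> 1" using M[OF aS_in[OF x]] by fastforce
    then show ?case using 1 step afst[OF x, of m] \<sigma> by auto
  qed (use n in auto)
  have Udisj: "U 1 \<inter> U (-1) = {}"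
  proof (rule ccontr)
    assume "\<not> ?thesis"
    then obtain x n m where x: "x \<in> S" and "\<psi> (a x n) > M" "1 * fst (a x n) > 1" "\<psi> (a x m) > M" "-1 * fst (a x m) > 1"
      by (auto simp: U_def)
    then have "1 * fst (a x (max n m)) > 1" "-1 * fst (a x (max n m)) > 1"
      using Uinv[OF x _ _ _ max.cobounded1[of n m], of 1] Uinv[OF x _ _ _ max.cobounded2[of m n], of "-1"]
      by blast+
    then show False by simp
  qed
  have Uopen: "openin (top_of_set S) (U \<sigma>)" for \<sigma>
  proof -
    have "U \<sigma> = (\<Union>n. {x\<in>S. \<psi> (a x n) > M} \<inter> {x\<in>S. \<sigma> * fst (a x n) > 1})" by (auto simp: U_def)
    moreover have "openin (top_of_set S) {x\<in>S. \<psi> (a x n) > M}" for n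
    proof -
      have "continuous_on S (\<lambda>x. \<psi> (a x n))"
        by (rule continuous_on_compose2[OF \<psi> acont]) (use aS_in in auto)
      from continuous_openin_preimage_gen[OF this, of "{M<..}"] show ?thesis
        by (simp add: vimage_def Int_def)
    qed
    moreover have "openin (top_of_set S) {x\<in>S. \<sigma> * fst (a x n) > 1}" for n
    proof -
      have "continuous_on S (\<lambda>x. \<sigma> * fst (a x n))" by (intro continuous_intros acont)
      from continuous_openin_preimage_gen[OF this, of "{1<..}"] show ?thesis
        by (simp add: vimage_def Int_def)
    qed
    ultimately show ?thesis by (auto intro!: openin_Union openin_Int)
  qed
  have "connected S" unfolding S by (intro connected_Times K) simp
  then have "U 1 = {} \<or> U (-1) = {}"
    using Ucov Udisj Uopen[of 1] Uopen[of "-1"] unfolding connected_openin by blast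
  then show ?thesis
  proof
    assume "U (-1) = {}"
    have "\<psi> x \<le> M + c + c * (1 * fst x)" if "x \<in> S" "fst x \<le> 0" for x
    proof (rule bound[OF that(1)])
      have "x \<in> U (1)" using Ucov that \<open>U (-1) = {}\<close> by blast
      then show "\<exists>n. 1 * fst (a x n) > 1" unfolding U_def by blast
    qed (use that in auto)
    then show ?thesis by (intro exI[of _ "M + c"]) auto
  next
    assume "U 1 = {}"
    have "\<psi> x \<le> M + c + c * (-1 * fst x)" if "x \<in> S" "fst x \<ge> 0" for x
    proof (rule bound[OF that(1)])
      have "x \<in> U (-1)" using Ucov that \<open>U 1 = {}\<close> by blast
      then show "\<exists>n. -1 * fst (a x n) > 1" unfolding U_def by blast
    qed (use that in auto)
    then show ?thesis by (intro exI[of _ "M + c"]) auto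
  qed
qed

section \<open>Ascending step maps on C1 domains\<close>

lemma defining_fun_nonpos:
  assumes "local_C1_defining_fun U p r phi Dphi" "y \<in> closure U" "y \<in> ball p r"
  shows "phi y \<le> 0"
proof (rule ccontr)
  assume "\<not> ?thesis"
  have "continuous_on (ball p r) phi"
    by (rule has_derivative_continuous_on) (use assms(1) in \<open>auto simp: local_C1_defining_fun_def intro: has_derivative_at_withinI\<close>)
  then have "open {z\<in>ball p r. phi z > 0}"
    using continuous_open_preimage[of "ball p r" phi "{0<..}"] by (simp add: vimage_def Int_def)
  moreover have "y \<in> {z\<in>ball p r. phi z > 0}" using assms \<open>\<not> _\<close> by auto
  ultimately have "{z\<in>ball p r. phi z > 0} \<inter> U \<noteq> {}"
    using assms(2) open_Int_closure_eq_empty by blast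
  then obtain z where "z \<in> U \<inter> ball p r" "phi z > 0" by blast
  then show False using assms(1) unfolding local_C1_defining_fun_def by auto
qed

text \<open>A defining function at \<open>p\<close> is also one at nearby frontier points, on a
  smaller ball. The Neumann condition thereby becomes orthogonality to \<open>Dphi\<close> along a
  whole piece of the boundary.\<close>

lemma defining_fun_normal:
  assumes "local_C1_defining_fun U p r phi Dphi" "y \<in> frontier U" "y \<in> ball p r"
  shows "outward_unit_normal U y (Dphi y /\<^sub>R norm (Dphi y))"
proof -
  define \<rho> where "\<rho> = r - dist p y"
  have sub: "ball y \<rho> \<subseteq> ball p r"
  proof
    fix z assume "z \<in> ball y \<rho>"
    then show "z \<in> ball p r" using dist_triangle[of p z y] by (simp add: \<rho>_def)
  qed
  have "\<rho> > 0" using assms(3) by (simp add: \<rho>_def)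
  moreover have "U \<inter> ball y \<rho> = {z \<in> ball y \<rho>. phi z < 0}"
    using assms(1) sub unfolding local_C1_defining_fun_def by blast
  ultimately have "local_C1_defining_fun U y \<rho> phi Dphi"
    using assms(1) sub unfolding local_C1_defining_fun_def
    by (blast intro: continuous_on_subset)
  then show ?thesis unfolding outward_unit_normal_def using assms(2) by blast
qed

lemma local_C1_defining_fun_Times:
  fixes U :: "'a::euclidean_space set" and s :: real
  assumes "local_C1_defining_fun U p r phi Dphi"
  shows "local_C1_defining_fun (UNIV \<times> U) (s, p) r (\<lambda>x. phi (snd x)) (\<lambda>x. (0, Dphi (snd x)))"
proof -
  have sub: "snd x \<in> ball p r" if "x \<in> ball (s, p) r" for x
    using that dist_snd_le[of "(s, p)" x] by simp
  have "((\<lambda>x. phi (snd x)) has_derivative (\<lambda>h. (0, Dphi (snd x)) \<bullet> h)) (at x)"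
    if "x \<in> ball (s, p) r" for x
  proof -
    have "((\<lambda>x. phi (snd x)) has_derivative (\<lambda>h. Dphi (snd x) \<bullet> snd h)) (at x)"
      by (rule has_derivative_compose[where f=snd and g=phi])
         (use assms sub[OF that] in \<open>auto simp: local_C1_defining_fun_def intro!: derivative_eq_intros\<close>)
    then show ?thesis by (simp add: inner_prod_def)
  qed
  moreover have "continuous_on (ball (s, p) r) (\<lambda>x. (0::real, Dphi (snd x)))"
  proof (rule continuous_on_Pair[OF continuous_on_const])
    have "continuous_on (ball p r) Dphi" using assms by (simp add: local_C1_defining_fun_def)
    then show "continuous_on (ball (s, p) r) (\<lambda>x. Dphi (snd x))"
      by (rule continuous_on_compose2[OF _ continuous_on_snd[OF continuous_on_id]]) (use sub in blast)
  qed
  moreover have "(0, Dphi (snd x)) \<noteq> (0 :: real \<times> 'a)" if "x \<in> ball (s, p) r" for x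
    using assms sub[OF that] by (simp add: local_C1_defining_fun_def zero_prod_def)
  moreover have "(UNIV \<times> U) \<inter> ball (s, p) r = {x \<in> ball (s, p) r. phi (snd x) < 0}"
  proof -
    have "snd x \<in> U \<longleftrightarrow> phi (snd x) < 0" if "x \<in> ball (s, p) r" for x
      using assms sub[OF that] unfolding local_C1_defining_fun_def by blast
    then show ?thesis by (auto simp del: mem_ball)
  qed
  moreover have "r > 0" using assms by (simp add: local_C1_defining_fun_def)
  ultimately show ?thesis unfolding local_C1_defining_fun_def by blast
qed

lemma frontier_UNIV_Times: "frontier (UNIV \<times> U) = (UNIV :: 'b::topological_space set) \<times> frontier (U :: 'a::topological_space set)"
  by (auto simp: frontier_def closure_Times interior_Times)

lemma C1_domain_UNIV_Times:
  fixes U :: "'a::euclidean_space set"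
  assumes "C1_domain U"
  shows "C1_domain ((UNIV :: real set) \<times> U)"
  unfolding C1_domain_def frontier_UNIV_Times
proof (intro conjI ballI)
  show "open ((UNIV :: real set) \<times> U)" using assms by (simp add: C1_domain_def open_Times)
  fix x :: "real \<times> 'a" assume "x \<in> UNIV \<times> frontier U"
  then obtain s p where "x = (s, p)" "p \<in> frontier U" by auto
  then show "\<exists>r phi Dphi. local_C1_defining_fun (UNIV \<times> U) x r phi Dphi"
    using assms local_C1_defining_fun_Times[of U p] unfolding C1_domain_def by meson
qed

lemma outward_unit_normal_UNIV_Times:
  fixes U :: "'a::euclidean_space set"
  assumes "outward_unit_normal U p nu"
  shows "outward_unit_normal ((UNIV :: real set) \<times> U) (s, p) (0, nu)"
proof -
  obtain r phi Dphi where "local_C1_defining_fun U p r phi Dphi" "nu = Dphi p /\<^sub>R norm (Dphi p)"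
    using assms unfolding outward_unit_normal_def by blast
  moreover have "(0, nu) = (0 :: real, Dphi p) /\<^sub>R norm (0 :: real, Dphi p)" 
    using calculation by (simp add: norm_Pair)
  moreover have "(s, p) \<in> frontier ((UNIV :: real set) \<times> U)"
    using assms by (simp add: frontier_UNIV_Times outward_unit_normal_def)
  ultimately show ?thesis
    using local_C1_defining_fun_Times[of U p r phi Dphi s]
    unfolding outward_unit_normal_def by fastforce
qed

section \<open>Uniformly inward directions\<close>

lemma norm_scaleR_le_half:
  assumes "r \<le> e / (2 * B)" "0 < B" "norm w \<le> B" "0 \<le> t" "t \<le> r"
  shows "norm (t *\<^sub>R w) \<le> e / 2"
proof -
  have "t * norm w \<le> e / (2 * B) * B" using assms by (intro mult_mono) auto
  then show ?thesis using assms by simp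
qed

text \<open>The condition is required for all nearby base points and directions, which makes it open in both
  and, unlike a pointwise tangent cone, convex in the direction.\<close>

definition inward :: "'a::euclidean_space set \<Rightarrow> 'a \<Rightarrow> 'a \<Rightarrow> bool" where
  "inward U p v \<longleftrightarrow> (\<exists>r>0. \<forall>x\<in>closure U \<inter> ball p r. \<forall>t v'.
     0 < t \<and> t < r \<and> dist v v' < r \<longrightarrow> x + t *\<^sub>R v' \<in> U)"

lemma inward_interior:
  assumes "open U" "p \<in> U"
  shows "inward U p v"
proof -
  obtain e where e: "e > 0" "ball p e \<subseteq> U" using assms open_contains_ball by blast
  define B where "B = norm v + e + 1"
  have B: "B > 0" "B > e" using e norm_ge_zero[of v] by (simp_all add: B_def add_pos_pos add_nonneg_pos)
  \<comment> \<open>\<open>B\<close> exceeds the norm of every direction within \<open>r\<close> of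
    \<open>v\<close>, so a step of parameter below e / (2 * B) moves a point by at most e/2. The
    same pattern fixes the radii in the lemmas that follow.\<close>
  define r where "r = min (e/2) (e / (2 * B))"
  have r: "r > 0" "r \<le> e/2" "r \<le> e / (2 * B)" using e B by (auto simp: r_def)
  show ?thesis unfolding inward_def
  proof (intro exI[of _ r] conjI ballI allI impI)
    fix x t v' assume x: "x \<in> closure U \<inter> ball p r" and t: "0 < t \<and> t < r \<and> dist v v' < r"
    have "norm v' \<le> norm v + dist v v'" using norm_triangle_ineq3[of v' v] by (simp add: dist_norm norm_minus_commute)
    then have "norm v' < B" using t r e by (simp add: B_def)
    then have "norm (t *\<^sub>R v') \<le> e/2" using t by (intro norm_scaleR_le_half[OF r(3) B(1)]) auto
    moreover have "dist p (x + t *\<^sub>R v') \<le> dist p x + norm (t *\<^sub>R v')"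
      using dist_triangle[of p "x + t *\<^sub>R v'" x] by (simp add: dist_norm)
    ultimately show "x + t *\<^sub>R v' \<in> U" using x r e by auto
  qed (use r in auto)
qed

lemma inward_nearby:
  assumes "inward U p v"
  shows "\<exists>e>0. \<forall>q\<in>ball p e. inward U q v"
proof -
  obtain r where r: "r > 0" "\<And>x t v'. x \<in> closure U \<inter> ball p r \<Longrightarrow> 0 < t \<and> t < r \<and> dist v v' < r \<Longrightarrow> x + t *\<^sub>R v' \<in> U"
    using assms unfolding inward_def by blast
  show ?thesis
  proof (intro exI[of _ "r/2"] conjI ballI)
    fix q assume q: "q \<in> ball p (r/2)"
    have "dist p x < r" if "dist q x < r/2" for x
      using q that dist_triangle[of p x q] by simp
    then show "inward U q v" unfolding inward_def
      using r by (intro exI[of _ "r/2"]) (auto intro!: r(2))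
  qed (use r in auto)
qed

text \<open>A step along a convex combination is made as two successive steps, first along
  \<open>u\<close>, then along \<open>v\<close>. The second starts from a displaced point of
  \<open>U\<close>, which is why \<open>inward\<close> allows every base point near
  \<open>p\<close>.\<close>

lemma inward_convex: "convex {v. inward U p v}"
proof (rule convexI)
  fix u v :: 'a and a b :: real
  assume uv: "u \<in> {v. inward U p v}" "v \<in> {v. inward U p v}" and ab: "0 \<le> a" "0 \<le> b" "a + b = 1"
  obtain r1 where r1: "r1 > 0" "\<And>x t v'. x \<in> closure U \<inter> ball p r1 \<Longrightarrow> 0 < t \<and> t < r1 \<and> dist u v' < r1 \<Longrightarrow> x + t *\<^sub>R v' \<in> U"
    using uv unfolding inward_def by blast
  obtain r2 where r2: "r2 > 0" "\<And>x t v'. x \<in> closure U \<inter> ball p r2 \<Longrightarrow> 0 < t \<and> t < r2 \<and> dist v v' < r2 \<Longrightarrow> x + t *\<^sub>R v' \<in> U"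
    using uv unfolding inward_def by blast
  show "a *\<^sub>R u + b *\<^sub>R v \<in> {v. inward U p v}"
  proof (cases "a = 0 \<or> b = 0")
    case True then show ?thesis using uv ab by auto
  next
    case False
    then have ab': "a > 0" "b > 0" "a \<le> 1" "b \<le> 1" using ab by auto
    define B where "B = norm u + r1 + 1"
    have B: "B > 0" using r1 norm_ge_zero[of u] by (simp add: B_def add_pos_pos add_nonneg_pos)
    define r where "r = min (min r1 (r2/2)) (r2 / (2 * B))"
    have r: "r > 0" "r \<le> r1" "r \<le> r2/2" "r \<le> r2 / (2 * B)" using r1 r2 B by (auto simp: r_def)
    have "x + t *\<^sub>R w \<in> U" if x: "x \<in> closure U \<inter> ball p r" and t: "0 < t" "t < r" and w: "dist (a *\<^sub>R u + b *\<^sub>R v) w < r" for x t w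
    proof -
      \<comment> \<open>The deviation of \<open>w\<close> is added to both directions. Since a + b =
        1, the two steps along \<open>u + d\<close> and \<open>v + d\<close> add up to exactly one
        step along \<open>w\<close>.\<close>
      define d where "d = w - (a *\<^sub>R u + b *\<^sub>R v)"
      have d: "norm d < r" using w by (simp add: d_def dist_norm norm_minus_commute)
      have "t * a \<le> t" "t * b \<le> t" "0 < t * a" "0 < t * b" using ab' t by (simp_all add: mult_left_le)
      then have ta: "0 < t * a" "t * a < r1" "t * a < r" "0 < t * b" "t * b < r2"
        using t r(2,3) r2(1) by linarith+
      define y where "y = x + (t * a) *\<^sub>R (u + d)"
      have yU: "y \<in> U" unfolding y_def using x d r ta by (intro r1(2)) (auto simp: dist_norm)
      have "norm (u + d) \<le> B" using norm_triangle_ineq[of u d] d r by (simp add: B_def)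
      then have "norm ((t * a) *\<^sub>R (u + d)) \<le> r2 / 2"
        using ta by (intro norm_scaleR_le_half[OF r(4) B]) auto
      moreover have "dist p y \<le> dist p x + norm ((t * a) *\<^sub>R (u + d))"
        using dist_triangle[of p y x] by (simp add: dist_norm y_def)
      ultimately have "dist p y < r2" using x r by auto
      then have "y + (t * b) *\<^sub>R (v + d) \<in> U"
        using yU closure_subset d r ta by (intro r2(2)) (auto simp: dist_norm)
      moreover have "y + (t * b) *\<^sub>R (v + d) = x + t *\<^sub>R w"
      proof -
        have "y + (t * b) *\<^sub>R (v + d) = x + t *\<^sub>R (a *\<^sub>R u + b *\<^sub>R v + (a + b) *\<^sub>R d)"
          by (simp add: y_def algebra_simps)
        then show ?thesis using ab by (simp add: d_def)
      qed
      ultimately show ?thesis by simp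
    qed
    then show ?thesis unfolding inward_def using r by blast
  qed
qed

text \<open>The negative sign persists for nearby points and directions by joint continuity. Along
  such a direction phi decreases strictly from a value that is at most 0 on the closure, so the
  segment enters \<open>U\<close> at once.\<close>

lemma inward_defining_fun:
  assumes lc: "local_C1_defining_fun U p r phi Dphi" and neg: "Dphi p \<bullet> v < 0"
  shows "inward U p v"
proof -
  have r: "r > 0" and der: "\<And>y. y \<in> ball p r \<Longrightarrow> (phi has_derivative (\<lambda>h. Dphi y \<bullet> h)) (at y)"
    and cont: "continuous_on (ball p r) Dphi" and U: "U \<inter> ball p r = {y \<in> ball p r. phi y < 0}"
    using lc unfolding local_C1_defining_fun_def by auto
  have "continuous_on (ball p r \<times> UNIV) (\<lambda>z. Dphi (fst z) \<bullet> snd z)"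
    by (intro continuous_intros continuous_on_compose2[OF cont]) auto
  then have "open {z \<in> ball p r \<times> UNIV. Dphi (fst z) \<bullet> snd z < 0}"
    using continuous_open_preimage[of "ball p r \<times> UNIV" "\<lambda>z. Dphi (fst z) \<bullet> snd z" "{..<0}"]
    by (simp add: vimage_def Int_def open_Times)
  moreover have "(p, v) \<in> {z \<in> ball p r \<times> UNIV. Dphi (fst z) \<bullet> snd z < 0}" using r neg by auto
  ultimately obtain A B where AB: "open A" "open B" "p \<in> A" "v \<in> B"
    "A \<times> B \<subseteq> {z \<in> ball p r \<times> UNIV. Dphi (fst z) \<bullet> snd z < 0}"
    by (auto elim!: open_prod_elim)
  obtain e1 where e1: "e1 > 0" "ball p e1 \<subseteq> A" using AB open_contains_ball by blast
  obtain e2 where e2: "e2 > 0" "ball v e2 \<subseteq> B" using AB open_contains_ball by blast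
  have neg': "Dphi y \<bullet> v' < 0" and inr: "y \<in> ball p r" if "y \<in> ball p e1" "dist v v' < e2" for y v'
    using AB(5) e1 e2 that by (force)+
  define C where "C = norm v + e2 + 1"
  have C: "C > 0" using e2 norm_ge_zero[of v] by (simp add: C_def add_pos_pos add_nonneg_pos)
  define \<rho> where "\<rho> = min (min (e1/2) e2) (e1 / (2 * C))"
  have \<rho>: "\<rho> > 0" "\<rho> \<le> e1/2" "\<rho> \<le> e2" "\<rho> \<le> e1 / (2 * C)" using e1 e2 C by (auto simp: \<rho>_def)
  have "x + t *\<^sub>R w \<in> U" if x: "x \<in> closure U \<inter> ball p \<rho>" and t: "0 < t" "t < \<rho>" and w: "dist v w < \<rho>" for x t w
  proof -
    have "norm w \<le> norm v + dist v w" using norm_triangle_ineq3[of w v] by (simp add: dist_norm norm_minus_commute)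
    then have nw: "norm w \<le> C" using w \<rho> by (simp add: C_def)
    have near: "x + t' *\<^sub>R w \<in> ball p e1" if t': "0 \<le> t'" "t' \<le> t" for t'
    proof -
      have "norm (t' *\<^sub>R w) \<le> e1/2" using nw t' t by (intro norm_scaleR_le_half[OF \<rho>(4) C]) auto
      moreover have "dist p (x + t' *\<^sub>R w) \<le> dist p x + norm (t' *\<^sub>R w)"
        using dist_triangle[of p "x + t' *\<^sub>R w" x] by (simp add: dist_norm)
      ultimately show ?thesis using x \<rho> by auto
    qed
    have "\<exists>z. z > 0 \<and> z < t \<and> phi (x + t *\<^sub>R w) - phi (x + 0 *\<^sub>R w) = (t - 0) * (Dphi (x + z *\<^sub>R w) \<bullet> w)"
    proof (rule MVT2[OF t(1)])
      fix t' assume "0 \<le> t'" "t' \<le> t"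
      then have "x + t' *\<^sub>R w \<in> ball p r" using inr[OF near, of t' v] e2 by auto
      then show "((\<lambda>t. phi (x + t *\<^sub>R w)) has_real_derivative Dphi (x + t' *\<^sub>R w) \<bullet> w) (at t')"
        by (intro has_real_derivative_along_line der)
    qed
    then obtain z where z: "z > 0" "z < t" "phi (x + t *\<^sub>R w) - phi x = t * (Dphi (x + z *\<^sub>R w) \<bullet> w)" by auto
    have "Dphi (x + z *\<^sub>R w) \<bullet> w < 0" using z w \<rho> by (intro neg' near) auto
    then have "phi (x + t *\<^sub>R w) < phi x" using z t by (smt (verit) mult_pos_neg)
    moreover have "x \<in> ball p r" using inr[OF near, of 0 v] e2 t by auto
    then have "phi x \<le> 0" using defining_fun_nonpos[OF lc] x by blast
    moreover have "x + t *\<^sub>R w \<in> ball p r" using inr[OF near, of t v] e2 t by auto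
    ultimately show ?thesis using U by (smt (verit) IntD1 mem_Collect_eq)
  qed
  then show ?thesis unfolding inward_def using \<rho> by blast
qed

text \<open>In the interior the gradient itself is a good direction; at the boundary it is
  tangential and can be tilted inward. Being inward and climbing at slope above c/2 are both stable
  in the base point and convex in the direction, so a continuous choice of direction exists, and
  then a continuous choice of step length.\<close>

lemma ascending_step_map:
  fixes U :: "'a::euclidean_space set"
  assumes C1: "C1_domain U"
    and psi_cont: "continuous_on (closure U) \<psi>"
    and grad: "\<And>x. x \<in> U \<Longrightarrow> (\<psi> has_derivative (\<lambda>h. G x \<bullet> h)) (at x)"
    and G_cont: "continuous_on (closure U) G"
    and neumann: "\<And>x nu. outward_unit_normal U x nu \<Longrightarrow> G x \<bullet> nu = 0"
    and c: "c > 0" "\<And>x. x \<in> closure U \<Longrightarrow> c \<le> norm (G x)"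
  obtains \<Phi> where "\<And>x. x \<in> closure U \<Longrightarrow> \<Phi> x \<in> closure U" "continuous_on (closure U) \<Phi>"
    "\<And>x. x \<in> closure U \<Longrightarrow> \<psi> x + c / 2 * dist x (\<Phi> x) \<le> \<psi> (\<Phi> x)"
    "\<And>x. x \<in> closure U \<Longrightarrow> 0 < dist x (\<Phi> x)" "\<And>x. x \<in> closure U \<Longrightarrow> dist x (\<Phi> x) \<le> 1"
proof -
  let ?S = "closure U"
  have oU: "open U" using C1 by (simp add: C1_domain_def)
  have US: "U \<subseteq> ?S" by (rule closure_subset)
  define R where "R x v \<longleftrightarrow> inward U x v \<and> c / 2 * norm v < G x \<bullet> v" for x v
  have ex: "\<exists>v. R p v" if p: "p \<in> ?S" for p
  proof (cases "p \<in> U")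
    case True
    have "c / 2 * norm (G p) < norm (G p) * norm (G p)"
      using c(1) c(2)[OF p] by (intro mult_strict_right_mono) auto
    then show ?thesis using inward_interior[OF oU True, of "G p"]
      unfolding R_def by (auto simp: dot_square_norm power2_eq_square)
  next
    case False
    then have pf: "p \<in> frontier U" using p oU by (simp add: frontier_def interior_open)
    then obtain r phi Dphi where lc: "local_C1_defining_fun U p r phi Dphi"
      using C1 by (auto simp: C1_domain_def)
    define n where "n = Dphi p /\<^sub>R norm (Dphi p)"
    have r: "r > 0" using lc by (simp add: local_C1_defining_fun_def)
    then have D0: "Dphi p \<noteq> 0" using lc by (simp add: local_C1_defining_fun_def)
    have "outward_unit_normal U p n" unfolding n_def using defining_fun_normal[OF lc pf] r by simp
    then have Gn: "G p \<bullet> n = 0" by (rule neumann)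
    have nn: "norm n = 1" using D0 by (simp add: n_def)
    have Dn: "Dphi p = norm (Dphi p) *\<^sub>R n" using D0 by (simp add: n_def)
    have gp: "norm (G p) > 0" using c p by (smt (verit))
    \<comment> \<open>As \<open>G p\<close> is orthogonal to \<open>n\<close>, the tilt leaves the
      product with \<open>G p\<close> at |G p|^2, which is at least c |G p|. The length grows to at
      most 3/2 |G p|, and c/2 times that is 3/4 c |G p|: the factor 1/2 in the required slope pays
      for the tilt.\<close>
    define v where "v = G p - (norm (G p) / 2) *\<^sub>R n"
    have "Dphi p \<bullet> v = norm (Dphi p) * (n \<bullet> v)" by (subst Dn) simp
    also have "n \<bullet> v = - (norm (G p) / 2)"
      using Gn nn by (simp add: v_def inner_diff_right inner_commute dot_square_norm)
    finally have "Dphi p \<bullet> v < 0" using D0 gp by (simp add: mult_pos_pos)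
    then have 1: "inward U p v" by (rule inward_defining_fun[OF lc])
    have "norm v \<le> norm (G p) + norm (G p) / 2"
      unfolding v_def using norm_triangle_ineq4[of "G p" "(norm (G p) / 2) *\<^sub>R n"] nn by simp
    then have "c / 2 * norm v \<le> c / 2 * (norm (G p) + norm (G p) / 2)" using c by (intro mult_left_mono) auto
    also have "\<dots> < c * norm (G p)" using c gp by simp
    also have "\<dots> \<le> norm (G p) * norm (G p)" using c p by (intro mult_right_mono) auto
    also have "\<dots> = G p \<bullet> v" using Gn by (simp add: v_def inner_diff_right dot_square_norm power2_eq_square)
    finally show ?thesis using 1 unfolding R_def by blast
  qed
  obtain V where Vc: "continuous_on ?S V" and V: "\<And>x. x \<in> ?S \<Longrightarrow> R x (V x)"
  proof (rule continuous_selection[of ?S R])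
    fix x
    have "convex {v. c / 2 * norm v < G x \<bullet> v}"
    proof (rule convexI)
      fix u v :: 'a and a b :: real
      assume *: "u \<in> {v. c / 2 * norm v < G x \<bullet> v}" "v \<in> {v. c / 2 * norm v < G x \<bullet> v}" "0 \<le> a" "0 \<le> b" "a + b = 1"
      have "c / 2 * norm (a *\<^sub>R u + b *\<^sub>R v) \<le> c / 2 * (a * norm u + b * norm v)"
        using c norm_triangle_ineq[of "a *\<^sub>R u" "b *\<^sub>R v"] * by (intro mult_left_mono) auto
      also have "\<dots> = a * (c / 2 * norm u) + b * (c / 2 * norm v)" by (simp add: algebra_simps)
      also have "\<dots> < a * (G x \<bullet> u) + b * (G x \<bullet> v)"
      proof (cases "a = 0")
        case False
        then have "a * (c / 2 * norm u) < a * (G x \<bullet> u)" using * by (intro mult_strict_left_mono) auto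
        moreover have "b * (c / 2 * norm v) \<le> b * (G x \<bullet> v)" using * by (intro mult_left_mono) auto
        ultimately show ?thesis by linarith
      qed (use * in auto)
      finally show "a *\<^sub>R u + b *\<^sub>R v \<in> {v. c / 2 * norm v < G x \<bullet> v}" by (simp add: inner_add_right)
    qed
    then show "convex {v. R x v}" unfolding R_def Collect_conj_eq by (intro convex_Int inward_convex)
  next
    fix p assume p: "p \<in> ?S"
    then obtain v where v: "R p v" using ex by blast
    then obtain e where e: "e > 0" "\<And>q. q \<in> ball p e \<Longrightarrow> inward U q v"
      using inward_nearby unfolding R_def by blast
    have "continuous_on ?S (\<lambda>x. G x \<bullet> v)" by (intro continuous_intros G_cont)
    then have "openin (top_of_set ?S) {x\<in>?S. c / 2 * norm v < G x \<bullet> v}"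
      using continuous_openin_preimage_gen[of ?S "\<lambda>x. G x \<bullet> v" "{c / 2 * norm v<..}"]
      by (simp add: vimage_def Int_def)
    then obtain T where T: "open T" "{x\<in>?S. c / 2 * norm v < G x \<bullet> v} = ?S \<inter> T"
      by (auto simp: openin_open)
    show "\<exists>z W. open W \<and> p \<in> W \<and> (\<forall>x\<in>W \<inter> ?S. R x z)"
    proof (intro exI[of _ v] exI[of _ "T \<inter> ball p e"] conjI ballI)
      show "p \<in> T \<inter> ball p e" using v p T e unfolding R_def by auto
      show "R x v" if "x \<in> T \<inter> ball p e \<inter> ?S" for x
        using that T e unfolding R_def by blast
    qed (use T in auto)
  qed blast
  have V0: "V x \<noteq> 0" if "x \<in> ?S" for x using V[OF that] by (auto simp: R_def)
  \<comment> \<open>Demanding the property for all smaller parameters too makes the admissible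
    lengths at \<open>x\<close> an interval, hence convex, so that the selection lemma applies a
    second time.\<close>
  define Q where "Q x t \<longleftrightarrow> 0 < t \<and> (\<forall>t'. 0 < t' \<and> t' \<le> t \<longrightarrow>
     x + t' *\<^sub>R V x \<in> U \<and> \<psi> x + c / 2 * (t' * norm (V x)) \<le> \<psi> (x + t' *\<^sub>R V x))" for x and t :: real
  obtain \<tau> where \<tau>c: "continuous_on ?S \<tau>" and \<tau>: "\<And>x. x \<in> ?S \<Longrightarrow> Q x (\<tau> x)"
  proof (rule continuous_selection[of ?S Q])
    fix x
    have "is_interval {t. Q x t}" unfolding is_interval_1
    proof (intro ballI allI impI, elim conjE)
      fix a b t assume "a \<in> {t. Q x t}" "b \<in> {t. Q x t}" "a \<le> t" "t \<le> b"
      then show "t \<in> {t. Q x t}" unfolding Q_def mem_Collect_eq by (meson less_le_trans order_trans)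
    qed
    then show "convex {t. Q x t}" by (simp add: is_interval_convex_1)
  next
    fix p assume p: "p \<in> ?S"
    have "inward U p (V p)" using V[OF p] by (simp add: R_def)
    then obtain r where r: "r > 0" "\<And>x t v'. x \<in> ?S \<inter> ball p r \<Longrightarrow> 0 < t \<and> t < r \<and> dist (V p) v' < r \<Longrightarrow> x + t *\<^sub>R v' \<in> U"
      unfolding inward_def by blast
    obtain r1 where r1: "r1 > 0" "\<And>x. x \<in> ?S \<Longrightarrow> dist x p < r1 \<Longrightarrow> dist (V x) (V p) < r"
      using Vc p r unfolding continuous_on_iff by meson
    \<comment> \<open>The gradient will be evaluated along the segment while the direction stays the
      one at its starting point; therefore the two base points vary independently.\<close>
    have "continuous_on (?S \<times> ?S) (\<lambda>z. G (fst z) \<bullet> V (snd z) - c / 2 * norm (V (snd z)))"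
      by (intro continuous_intros continuous_on_compose2[OF G_cont] continuous_on_compose2[OF Vc]) auto
    from continuous_openin_preimage_gen[OF this, of "{0<..}"]
    have "openin (top_of_set (?S \<times> ?S)) {z\<in>?S \<times> ?S. 0 < G (fst z) \<bullet> V (snd z) - c / 2 * norm (V (snd z))}"
      by (simp add: vimage_def Int_def)
    then obtain T where T: "open T" "{z\<in>?S \<times> ?S. 0 < G (fst z) \<bullet> V (snd z) - c / 2 * norm (V (snd z))} = ?S \<times> ?S \<inter> T"
      by (auto simp: openin_open)
    have "(p, p) \<in> {z\<in>?S \<times> ?S. 0 < G (fst z) \<bullet> V (snd z) - c / 2 * norm (V (snd z))}" using p V[OF p] by (simp add: R_def)
    then have "(p, p) \<in> T" using T by blast
    then obtain A B where AB: "open A" "open B" "p \<in> A" "p \<in> B" "A \<times> B \<subseteq> T"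
      using open_prod_elim[OF T(1)] by (metis mem_Sigma_iff)
    obtain e where e: "e > 0" "ball p e \<subseteq> A" using AB open_contains_ball by blast
    define C where "C = norm (V p) + r + 1"
    have C: "C > 0" using r norm_ge_zero[of "V p"] by (simp add: C_def add_pos_pos add_nonneg_pos)
    define t0 where "t0 = min (r / 2) (e / (2 * C))"
    have t0: "t0 > 0" "t0 < r" "t0 \<le> e / (2 * C)" using r e C by (auto simp: t0_def)
    show "\<exists>z W. open W \<and> p \<in> W \<and> (\<forall>x\<in>W \<inter> ?S. Q x z)"
    proof (intro exI[of _ t0] exI[of _ "B \<inter> ball p (min (min r r1) (e/2))"] conjI ballI)
      show "p \<in> B \<inter> ball p (min (min r r1) (e/2))" using AB r r1 e by auto
      fix x assume x: "x \<in> B \<inter> ball p (min (min r r1) (e/2)) \<inter> ?S"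
      have dV: "dist (V p) (V x) < r" using r1(2)[of x] x by (simp add: dist_commute)
      have inU: "x + t *\<^sub>R V x \<in> U" if "0 < t" "t \<le> t0" for t
        using that x dV t0 by (intro r(2)) auto
      have "norm (V x) \<le> norm (V p) + dist (V p) (V x)"
        using norm_triangle_ineq3[of "V x" "V p"] by (simp add: dist_norm norm_minus_commute)
      then have nV: "norm (V x) \<le> C" using dV by (simp add: C_def)
      have near: "x + t *\<^sub>R V x \<in> A" if t: "0 \<le> t" "t \<le> t0" for t
      proof -
        have "norm (t *\<^sub>R V x) \<le> e/2" using nV t by (intro norm_scaleR_le_half[OF t0(3) C]) auto
        moreover have "dist p (x + t *\<^sub>R V x) \<le> dist p x + norm (t *\<^sub>R V x)"
          using dist_triangle[of p "x + t *\<^sub>R V x" x] by (simp add: dist_norm)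
        ultimately show ?thesis using x e by auto
      qed
      have "\<psi> x + c / 2 * (t * norm (V x)) \<le> \<psi> (x + t *\<^sub>R V x)" if t: "0 < t" "t \<le> t0" for t
      proof -
        have inS: "x + s *\<^sub>R V x \<in> ?S" if "0 \<le> s" "s \<le> t" for s
          using that t inU[of s] US x by (cases "s = 0") auto
        \<comment> \<open>The start \<open>x\<close> may lie on the boundary, where
          \<open>\<psi>\<close> is merely continuous. The mean value theorem asks for derivatives
          only at 0 < s < t, where the segment lies in \<open>U\<close>.\<close>
        have "\<exists>s\<in>{0<..<t}. \<psi> (x + t *\<^sub>R V x) - \<psi> (x + 0 *\<^sub>R V x) = (\<lambda>h. (G (x + s *\<^sub>R V x) \<bullet> V x) * h) (t - 0)"
        proof (rule mvt[OF t(1)])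
          show "continuous_on {0..t} (\<lambda>s. \<psi> (x + s *\<^sub>R V x))"
            by (intro continuous_on_compose2[OF psi_cont] continuous_intros) (use inS in auto)
          fix s assume s: "0 < s" "s < t"
          have "((\<lambda>s. \<psi> (x + s *\<^sub>R V x)) has_real_derivative G (x + s *\<^sub>R V x) \<bullet> V x) (at s)"
            using s t by (intro has_real_derivative_along_line grad inU) auto
          then show "((\<lambda>s. \<psi> (x + s *\<^sub>R V x)) has_derivative (\<lambda>h. (G (x + s *\<^sub>R V x) \<bullet> V x) * h)) (at s)"
            by (simp add: has_field_derivative_def)
        qed auto
        then obtain s where s: "0 < s" "s < t" and eq: "\<psi> (x + t *\<^sub>R V x) - \<psi> x = (G (x + s *\<^sub>R V x) \<bullet> V x) * t"
          by auto
        have "(x + s *\<^sub>R V x, x) \<in> ?S \<times> ?S \<inter> T" using inS[of s] near[of s] s t x AB by auto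
        then have "0 < G (x + s *\<^sub>R V x) \<bullet> V x - c / 2 * norm (V x)" unfolding T(2)[symmetric] by simp
        then have "c / 2 * norm (V x) * t \<le> (G (x + s *\<^sub>R V x) \<bullet> V x) * t" using t by (intro mult_right_mono) auto
        then show ?thesis using eq by (simp add: algebra_simps)
      qed
      then show "Q x t0" unfolding Q_def using inU t0 by auto
    qed (use AB in auto)
  qed blast
  define \<sigma> where "\<sigma> x = min (\<tau> x) (1 / norm (V x))" for x
  define \<Phi> where "\<Phi> x = x + \<sigma> x *\<^sub>R V x" for x
  have \<sigma>: "0 < \<sigma> x" "\<sigma> x \<le> \<tau> x" "\<sigma> x * norm (V x) \<le> 1" if "x \<in> ?S" for x
  proof -
    show "0 < \<sigma> x" "\<sigma> x \<le> \<tau> x" using \<tau>[OF that] V0[OF that] by (auto simp: \<sigma>_def Q_def)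
    have "\<sigma> x \<le> 1 / norm (V x)" by (simp add: \<sigma>_def)
    then show "\<sigma> x * norm (V x) \<le> 1" using V0[OF that] by (simp add: field_simps)
  qed
  have d: "dist x (\<Phi> x) = \<sigma> x * norm (V x)" if "x \<in> ?S" for x
    using \<sigma>[OF that] by (simp add: \<Phi>_def dist_norm)
  show ?thesis
  proof (rule that[of \<Phi>])
    show "continuous_on ?S \<Phi>" unfolding \<Phi>_def \<sigma>_def
      using V0 by (intro continuous_intros \<tau>c Vc) auto
    fix x assume x: "x \<in> ?S"
    have "\<Phi> x \<in> U \<and> \<psi> x + c / 2 * (\<sigma> x * norm (V x)) \<le> \<psi> (\<Phi> x)"
      using \<tau>[OF x] \<sigma>[OF x] unfolding Q_def \<Phi>_def by blast
    then show "\<Phi> x \<in> ?S" "\<psi> x + c / 2 * dist x (\<Phi> x) \<le> \<psi> (\<Phi> x)" using US d[OF x] by auto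
    show "0 < dist x (\<Phi> x)" "dist x (\<Phi> x) \<le> 1" using d[OF x] \<sigma>[OF x] V0[OF x] by auto
  qed
qed

section \<open>Cut-offs with negligible flux through the boundary layer\<close>

abbreviation borel_on :: "'a::euclidean_space set \<Rightarrow> 'a measure" where
  "borel_on W \<equiv> restrict_space lborel W"

locale bounded_open =
  fixes W :: "'a::euclidean_space set"
  assumes opn: "open W" and bdd: "bounded W"
begin

lemma W_sets: "W \<inter> space lborel \<in> sets lborel"
  using opn by simp

lemma space_W: "space (borel_on W) = W"
  by (simp add: space_restrict_space)

lemma compact_closure_W: "compact (closure W)"
  using bdd by simp

lemma finite_measure_W: "finite_measure (borel_on W)"
proof
  have "emeasure lborel W < \<infinity>" by (rule emeasure_bounded_finite[OF bdd])
  then show "emeasure (borel_on W) (space (borel_on W)) \<noteq> \<infinity>"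
    by (simp add: space_W emeasure_restrict_space W_sets opn)
qed

lemma measurable_W:
  fixes f :: "'a \<Rightarrow> 'b::real_normed_vector"
  assumes "continuous_on W f"
  shows "f \<in> borel_measurable (borel_on W)"
proof -
  have "sets (borel_on W) = sets (restrict_space borel W)" by (simp add: sets_restrict_space)
  then show ?thesis using borel_measurable_continuous_on_restrict[OF assms] measurable_cong_sets by blast
qed

lemma integrable_W:
  fixes f :: "'a \<Rightarrow> 'b::euclidean_space"
  assumes "continuous_on W f" "\<And>y. y \<in> W \<Longrightarrow> norm (f y) \<le> C"
  shows "integrable (borel_on W) f"
  using assms
  by (intro finite_measure.integrable_const_bound[OF finite_measure_W, where B=C] measurable_W AE_I2)
     (auto simp: space_W)

lemma integrable_closure_W:
  fixes f :: "'a \<Rightarrow> 'b::euclidean_space"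
  assumes "continuous_on (closure W) f"
  shows "integrable (borel_on W) f"
proof -
  obtain C where "\<And>x. x \<in> closure W \<Longrightarrow> norm (f x) \<le> C"
    using compact_continuous_bound[OF compact_closure_W assms] by blast
  then show ?thesis
    using continuous_on_subset[OF assms closure_subset] closure_subset by (intro integrable_W) auto
qed

lemma integral_mono_W:
  fixes f g :: "'a \<Rightarrow> real"
  assumes "integrable (borel_on W) f" "integrable (borel_on W) g" "\<And>y. y \<in> W \<Longrightarrow> f y \<le> g y"
  shows "integral\<^sup>L (borel_on W) f \<le> integral\<^sup>L (borel_on W) g"
  using assms by (intro integral_mono) (auto simp: space_W)

lemma dominated_convergence_W:
  fixes f :: "nat \<Rightarrow> 'a \<Rightarrow> real"
  assumes "\<And>k. continuous_on W (f k)" "continuous_on W g"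
    and "\<And>k y. y \<in> W \<Longrightarrow> \<bar>f k y\<bar> \<le> C" "\<And>y. y \<in> W \<Longrightarrow> (\<lambda>k. f k y) \<longlonglongrightarrow> g y"
  shows "(\<lambda>k. integral\<^sup>L (borel_on W) (f k)) \<longlonglongrightarrow> integral\<^sup>L (borel_on W) g"
proof (rule integral_dominated_convergence)
  show "integrable (borel_on W) (\<lambda>_. C)" using finite_measure_W by (simp add: finite_measure.integrable_const)
qed (use assms in \<open>auto intro!: measurable_W AE_I2 simp: space_W\<close>)

end

lemma continuous_on_extend_zero:
  fixes f :: "'a::topological_space \<Rightarrow> 'b::real_normed_vector"
  assumes "open B" "closed K" "K \<subseteq> B" "continuous_on B f" "\<And>y. y \<in> B - K \<Longrightarrow> f y = 0"
  shows "continuous_on UNIV (\<lambda>y. if y \<in> B then f y else 0)"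
proof -
  have "continuous_on B (\<lambda>y. if y \<in> B then f y else 0)"
    using assms(4) by (rule continuous_on_eq) simp
  moreover have "continuous_on (- K) (\<lambda>y. if y \<in> B then f y else 0)"
    by (rule continuous_on_eq[of _ "\<lambda>_. 0"]) (use assms in auto)
  ultimately have "continuous_on (B \<union> - K) (\<lambda>y. if y \<in> B then f y else 0)"
    using assms by (intro continuous_on_open_Un) auto
  moreover have "B \<union> - K = UNIV" using assms by auto
  ultimately show ?thesis by simp
qed

lemma has_derivative_extend_zero:
  fixes f :: "'a::real_normed_vector \<Rightarrow> real"
  assumes B: "open B" "closed K" "K \<subseteq> B" and der: "\<And>y. y \<in> B \<Longrightarrow> (f has_derivative f' y) (at y)"
    and f0: "\<And>y. y \<in> B - K \<Longrightarrow> f y = 0"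
  shows "((\<lambda>y. if y \<in> B then f y else 0) has_derivative (\<lambda>h. if y \<in> B then f' y h else 0)) (at y)"
proof (cases "y \<in> B")
  case True
  have "((\<lambda>y. if y \<in> B then f y else 0) has_derivative f' y) (at y)"
    by (rule has_derivative_transform_within_open[OF der[OF True] B(1) True]) simp
  then show ?thesis using True by simp
next
  case False
  have "((\<lambda>y. if y \<in> B then f y else 0) has_derivative (\<lambda>h. 0)) (at y)"
    by (rule has_derivative_transform_within_open[of "\<lambda>_. 0" _ _ _ "- K"]) (use False B f0 in auto)
  then show ?thesis using False by simp
qed

section \<open>Boundary cut-offs\<close>

definition tangential :: "'a::euclidean_space set \<Rightarrow> 'a \<Rightarrow> 'a \<Rightarrow> bool" where
  "tangential W y v \<longleftrightarrow> (\<forall>nu. outward_unit_normal W y nu \<longrightarrow> v \<bullet> nu = 0)"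

text \<open>V is the part of the boundary already treated. Products of cut-offs enlarge V, so the local ones
  combine without a smooth partition of unity.\<close>

definition boundary_cutoff ::
  "'a::euclidean_space set \<Rightarrow> 'a set \<Rightarrow> (nat \<Rightarrow> 'a \<Rightarrow> real) \<Rightarrow> (nat \<Rightarrow> 'a \<Rightarrow> 'a) \<Rightarrow> bool" where
  "boundary_cutoff W V \<theta> D \<longleftrightarrow>
     (\<forall>k y. (\<theta> k has_derivative (\<lambda>h. D k y \<bullet> h)) (at y)) \<and>
     (\<forall>k. continuous_on UNIV (D k)) \<and>
     (\<forall>k y. 0 \<le> \<theta> k y \<and> \<theta> k y \<le> 1) \<and>
     (\<forall>y\<in>W. (\<lambda>k. \<theta> k y) \<longlonglongrightarrow> 1) \<and>
     (\<forall>k. \<forall>y\<in>V - W. \<forall>\<^sub>F z in nhds y. \<theta> k z = 0) \<and>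
     (\<forall>T F. compact (T :: real set) \<longrightarrow> continuous_on (T \<times> closure W) F \<longrightarrow>
        (\<forall>s\<in>T. \<forall>y\<in>frontier W. tangential W y (F (s, y))) \<longrightarrow>
        (\<forall>e>0. \<forall>\<^sub>F k in sequentially. \<forall>s\<in>T. (\<integral>y. \<bar>D k y \<bullet> F (s, y)\<bar> \<partial>borel_on W) \<le> e))"

lemma boundary_cutoffD:
  assumes "boundary_cutoff W V \<theta> D"
  shows "(\<theta> k has_derivative (\<lambda>h. D k y \<bullet> h)) (at y)"
    and "continuous_on A (D k)"
    and "continuous_on A (\<theta> k)"
    and "0 \<le> \<theta> k y" "\<theta> k y \<le> 1"
    and "y \<in> W \<Longrightarrow> (\<lambda>k. \<theta> k y) \<longlonglongrightarrow> 1"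
    and "y \<in> V \<Longrightarrow> y \<notin> W \<Longrightarrow> \<forall>\<^sub>F z in nhds y. \<theta> k z = 0"
    and "compact (T :: real set) \<Longrightarrow> continuous_on (T \<times> closure W) F \<Longrightarrow>
        (\<And>s y. s \<in> T \<Longrightarrow> y \<in> frontier W \<Longrightarrow> tangential W y (F (s, y))) \<Longrightarrow> 0 < e \<Longrightarrow>
        \<forall>\<^sub>F k in sequentially. \<forall>s\<in>T. (\<integral>y. \<bar>D k y \<bullet> F (s, y)\<bar> \<partial>borel_on W) \<le> e"
proof -
  show der: "(\<theta> k has_derivative (\<lambda>h. D k y \<bullet> h)) (at y)" for y
    by (rule assms[unfolded boundary_cutoff_def, THEN conjunct1, rule_format])
  show "continuous_on A (\<theta> k)"
    by (rule has_derivative_continuous_on) (rule has_derivative_at_withinI[OF der])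
  have "continuous_on UNIV (D k)" by (rule assms[unfolded boundary_cutoff_def, THEN conjunct2, THEN conjunct1, rule_format])
  then show "continuous_on A (D k)" by (rule continuous_on_subset) simp
  have "0 \<le> \<theta> k y \<and> \<theta> k y \<le> 1"
    by (rule assms[unfolded boundary_cutoff_def, THEN conjunct2, THEN conjunct2, THEN conjunct1, THEN spec, THEN spec])
  then show "0 \<le> \<theta> k y" "\<theta> k y \<le> 1" by auto
  show "y \<in> W \<Longrightarrow> (\<lambda>k. \<theta> k y) \<longlonglongrightarrow> 1"
    by (rule assms[unfolded boundary_cutoff_def, THEN conjunct2, THEN conjunct2, THEN conjunct2, THEN conjunct1, rule_format])
  show "y \<in> V \<Longrightarrow> y \<notin> W \<Longrightarrow> \<forall>\<^sub>F z in nhds y. \<theta> k z = 0"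
    by (rule assms[unfolded boundary_cutoff_def, THEN conjunct2, THEN conjunct2, THEN conjunct2, THEN conjunct2, THEN conjunct1, rule_format]) simp
  assume *: "compact T" "continuous_on (T \<times> closure W) F"
    "\<And>s y. s \<in> T \<Longrightarrow> y \<in> frontier W \<Longrightarrow> tangential W y (F (s, y))" "0 < e"
  show "\<forall>\<^sub>F k in sequentially. \<forall>s\<in>T. (\<integral>y. \<bar>D k y \<bullet> F (s, y)\<bar> \<partial>borel_on W) \<le> e"
    by (rule assms[unfolded boundary_cutoff_def, THEN conjunct2, THEN conjunct2, THEN conjunct2, THEN conjunct2, THEN conjunct2, THEN spec, THEN spec, THEN mp, THEN mp, THEN mp, THEN spec, THEN mp])
       (use * in auto)
qed

context bounded_open begin

lemma boundary_cutoff_empty: "boundary_cutoff W {} (\<lambda>k y. 1) (\<lambda>k y. 0)"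
  by (auto simp: boundary_cutoff_def)

text \<open>In the product rule each gradient is multiplied by the other cut-off, which lies in
  [0, 1], so the two flux errors merely add; each is asked to be at most e/2.\<close>

lemma boundary_cutoff_mult:
  assumes 1: "boundary_cutoff W V1 \<theta>1 D1" and 2: "boundary_cutoff W V2 \<theta>2 D2"
  shows "boundary_cutoff W (V1 \<union> V2) (\<lambda>k y. \<theta>1 k y * \<theta>2 k y) (\<lambda>k y. \<theta>1 k y *\<^sub>R D2 k y + \<theta>2 k y *\<^sub>R D1 k y)"
  unfolding boundary_cutoff_def
proof (intro conjI allI impI ballI)
  note der = boundary_cutoffD(1)[OF 1] boundary_cutoffD(1)[OF 2]
  note Dc = boundary_cutoffD(2)[OF 1] boundary_cutoffD(2)[OF 2]
  note cc = boundary_cutoffD(3)[OF 1] boundary_cutoffD(3)[OF 2]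
  note b = boundary_cutoffD(4,5)[OF 1] boundary_cutoffD(4,5)[OF 2]
  fix k y
  show "((\<lambda>y. \<theta>1 k y * \<theta>2 k y) has_derivative (\<lambda>h. (\<theta>1 k y *\<^sub>R D2 k y + \<theta>2 k y *\<^sub>R D1 k y) \<bullet> h)) (at y)"
    by (rule has_derivative_eq_rhs[OF has_derivative_mult[OF der]]) (simp add: fun_eq_iff inner_add_left algebra_simps)
  show "continuous_on UNIV (\<lambda>y. \<theta>1 k y *\<^sub>R D2 k y + \<theta>2 k y *\<^sub>R D1 k y)"
    by (intro continuous_intros Dc cc)
  show "0 \<le> \<theta>1 k y * \<theta>2 k y" using b by simp
  show "\<theta>1 k y * \<theta>2 k y \<le> 1" using b by (simp add: mult_le_one)
  {
    fix y assume "y \<in> W"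
    then show "(\<lambda>k. \<theta>1 k y * \<theta>2 k y) \<longlonglongrightarrow> 1"
      using tendsto_mult[OF boundary_cutoffD(6)[OF 1] boundary_cutoffD(6)[OF 2], of y y] by simp
  next
    fix k y assume "y \<in> V1 \<union> V2 - W"
    then have "(\<forall>\<^sub>F z in nhds y. \<theta>1 k z = 0) \<or> (\<forall>\<^sub>F z in nhds y. \<theta>2 k z = 0)"
      using boundary_cutoffD(7)[OF 1] boundary_cutoffD(7)[OF 2] by blast
    then show "\<forall>\<^sub>F z in nhds y. \<theta>1 k z * \<theta>2 k z = 0" by (auto elim: eventually_mono)
  next
    fix T :: "real set" and F :: "real \<times> 'a \<Rightarrow> 'a" and e :: real
    assume T: "compact T" and F: "continuous_on (T \<times> closure W) F"
      "\<forall>s\<in>T. \<forall>y\<in>frontier W. tangential W y (F (s, y))" and e: "e > 0"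
    have e2: "e/2 > 0" using e by simp
    have "\<forall>\<^sub>F k in sequentially. \<forall>s\<in>T. (\<integral>y. \<bar>D1 k y \<bullet> F (s, y)\<bar> \<partial>borel_on W) \<le> e/2"
      using boundary_cutoffD(8)[OF 1 T F(1) _ e2] F(2) by blast
    moreover have "\<forall>\<^sub>F k in sequentially. \<forall>s\<in>T. (\<integral>y. \<bar>D2 k y \<bullet> F (s, y)\<bar> \<partial>borel_on W) \<le> e/2"
      using boundary_cutoffD(8)[OF 2 T F(1) _ e2] F(2) by blast
    ultimately show "\<forall>\<^sub>F k in sequentially. \<forall>s\<in>T.
        (\<integral>y. \<bar>(\<theta>1 k y *\<^sub>R D2 k y + \<theta>2 k y *\<^sub>R D1 k y) \<bullet> F (s, y)\<bar> \<partial>borel_on W) \<le> e"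
    proof eventually_elim
      case (elim k)
      show ?case
      proof
        fix s assume s: "s \<in> T"
        have Fs: "continuous_on (closure W) (\<lambda>y. F (s, y))"
          by (rule continuous_on_compose2[OF F(1)]) (use s in \<open>auto intro!: continuous_intros\<close>)
        have i: "integrable (borel_on W) (\<lambda>y. \<bar>D1 k y \<bullet> F (s, y)\<bar>)" "integrable (borel_on W) (\<lambda>y. \<bar>D2 k y \<bullet> F (s, y)\<bar>)"
          "integrable (borel_on W) (\<lambda>y. \<bar>(\<theta>1 k y *\<^sub>R D2 k y + \<theta>2 k y *\<^sub>R D1 k y) \<bullet> F (s, y)\<bar>)"
          by (intro integrable_closure_W continuous_intros Dc cc Fs)+
        have "(\<integral>y. \<bar>(\<theta>1 k y *\<^sub>R D2 k y + \<theta>2 k y *\<^sub>R D1 k y) \<bullet> F (s, y)\<bar> \<partial>borel_on W)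
           \<le> (\<integral>y. \<bar>D1 k y \<bullet> F (s, y)\<bar> + \<bar>D2 k y \<bullet> F (s, y)\<bar> \<partial>borel_on W)"
        proof (rule integral_mono_W)
          fix y
          have "\<bar>\<theta>1 k y * (D2 k y \<bullet> F (s, y)) + \<theta>2 k y * (D1 k y \<bullet> F (s, y))\<bar> \<le> 
             \<theta>1 k y * \<bar>D2 k y \<bullet> F (s, y)\<bar> + \<theta>2 k y * \<bar>D1 k y \<bullet> F (s, y)\<bar>"
            using b[of k y] by (simp add: abs_mult order_trans[OF abs_triangle_ineq])
          also have "\<dots> \<le> 1 * \<bar>D2 k y \<bullet> F (s, y)\<bar> + 1 * \<bar>D1 k y \<bullet> F (s, y)\<bar>"
            using b[of k y] by (intro add_mono mult_right_mono) auto
          finally show "\<bar>(\<theta>1 k y *\<^sub>R D2 k y + \<theta>2 k y *\<^sub>R D1 k y) \<bullet> F (s, y)\<bar> \<le> \<bar>D1 k y \<bullet> F (s, y)\<bar> + \<bar>D2 k y \<bullet> F (s, y)\<bar>"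
            by (simp add: inner_add_left)
        qed (use i in auto)
        also have "\<dots> \<le> e" using elim s i by fastforce
        finally show "(\<integral>y. \<bar>(\<theta>1 k y *\<^sub>R D2 k y + \<theta>2 k y *\<^sub>R D1 k y) \<bullet> F (s, y)\<bar> \<partial>borel_on W) \<le> e" .
      qed
    qed
  }
qed

text \<open>The cut-off removes the layer where -phi is below about 1/k inside a ball. Its gradient
  is of size k there, but points along \<open>Dphi\<close>, on which a tangential field is small
  near the boundary. The layer mass, k times the thickness, stays bounded, so the flux tends to
  0.\<close>

lemma boundary_cutoff_local:
  assumes lc: "local_C1_defining_fun W p r phi Dphi" and pf: "p \<in> frontier W"
  shows "\<exists>\<rho>>0. \<exists>\<theta> D. boundary_cutoff W (ball p \<rho>) \<theta> D"
proof -
  have r: "r > 0" and pder: "\<And>y. y \<in> ball p r \<Longrightarrow> (phi has_derivative (\<lambda>h. Dphi y \<bullet> h)) (at y)"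
    and Dpc: "continuous_on (ball p r) Dphi" and Dp0: "\<And>y. y \<in> ball p r \<Longrightarrow> Dphi y \<noteq> 0"
    and Wphi: "W \<inter> ball p r = {y \<in> ball p r. phi y < 0}"
    using lc unfolding local_C1_defining_fun_def by auto
  define v where "v = Dphi p"
  \<comment> \<open>Half the value of \<open>Dphi y \<bullet> v\<close> at \<open>p\<close>, so that
    \<open>v\<close> remains uniformly transversal to the level sets of phi on a small ball.\<close>
  define \<kappa> where "\<kappa> = (norm v)\<^sup>2 / 2"
  have v0: "v \<noteq> 0" using Dp0[of p] r by (simp add: v_def)
  then have \<kappa>: "\<kappa> > 0" by (simp add: \<kappa>_def)
  have "continuous_on (ball p r) (\<lambda>y. Dphi y \<bullet> v)" by (intro continuous_intros Dpc)
  then have "open {y \<in> ball p r. \<kappa> < Dphi y \<bullet> v}"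
    using continuous_open_preimage[of "ball p r" "\<lambda>y. Dphi y \<bullet> v" "{\<kappa><..}"]
    by (simp add: vimage_def Int_def)
  moreover have "p \<in> {y \<in> ball p r. \<kappa> < Dphi y \<bullet> v}"
    using r v0 by (simp add: v_def \<kappa>_def dot_square_norm)
  ultimately obtain r1 where r1: "r1 > 0" "ball p r1 \<subseteq> {y \<in> ball p r. \<kappa> < Dphi y \<bullet> v}"
    using open_contains_ball by blast
  have sub: "ball p r1 \<subseteq> ball p r" and Dv: "\<And>y. y \<in> ball p r1 \<Longrightarrow> \<kappa> \<le> Dphi y \<bullet> v"
    using r1 by auto
  define \<rho> where "\<rho> = r1 / 2"
  have \<rho>: "\<rho> > 0" using r1 by (simp add: \<rho>_def)
  define K where "K = cball p (3 * \<rho> / 2)"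
  let ?B = "ball p r1"
  have KB: "K \<subseteq> ?B" using \<rho> by (auto simp: K_def \<rho>_def)
  have cK: "closed K" "compact K" by (simp_all add: K_def)
  \<comment> \<open>With z = |y - p| / \<open>\<rho>\<close> this is 3 - z^2: at least 2 on the ball
    of radius \<open>\<rho>\<close>, where the bump is 1, and at most 1 for z >= 3/2, since 9/4 >=
    2, where the bump vanishes.\<close>
  define arg where "arg y = 3 - 1 / \<rho>\<^sup>2 * ((y - p) \<bullet> (y - p))" for y
  define \<beta> where "\<beta> y = smoothstep (arg y)" for y
  define D\<beta> where "D\<beta> y = (- smoothstep' (arg y) * (2 / \<rho>\<^sup>2)) *\<^sub>R (y - p)" for y
  have argK: "arg y \<le> 1" if "y \<notin> K" for y
  proof -
    have "3 * \<rho> / 2 \<le> norm (y - p)" using that by (simp add: K_def dist_norm norm_minus_commute)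
    then have "(3 * \<rho> / 2)\<^sup>2 \<le> (norm (y - p))\<^sup>2" using \<rho> by (intro power_mono) auto
    then have "9 * \<rho>\<^sup>2 \<le> 4 * (norm (y - p))\<^sup>2" by (simp add: power_divide power_mult_distrib)
    then have "2 * \<rho>\<^sup>2 \<le> (norm (y - p))\<^sup>2" using zero_le_power2[of \<rho>] by linarith
    then have "2 * \<rho>\<^sup>2 \<le> (y - p) \<bullet> (y - p)" by (simp add: dot_square_norm)
    then show ?thesis using \<rho> by (simp add: arg_def field_simps)
  qed
  have \<beta>K: "\<beta> y = 0" "D\<beta> y = 0" if "y \<notin> K" for y
    using argK[OF that] by (simp_all add: \<beta>_def D\<beta>_def smoothstep_eq_0 smoothstep'_eq_0)
  have \<beta>1: "\<beta> y = 1" if "y \<in> ball p \<rho>" for y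
  proof -
    have "norm (y - p) \<le> \<rho>" using that by (simp add: dist_norm norm_minus_commute)
    then have "(norm (y - p))\<^sup>2 \<le> \<rho>\<^sup>2" by (intro power_mono) auto
    then have "2 \<le> arg y" using \<rho> by (simp add: arg_def dot_square_norm field_simps)
    then show ?thesis by (simp add: \<beta>_def smoothstep_eq_1)
  qed
  have \<beta>b: "0 \<le> \<beta> y" "\<beta> y \<le> 1" for y by (simp_all add: \<beta>_def smoothstep_bounds)
  have \<beta>der: "(\<beta> has_derivative (\<lambda>h. D\<beta> y \<bullet> h)) (at y)" for y
  proof -
    have "((\<lambda>y. (y - p) \<bullet> (y - p)) has_derivative (\<lambda>h. (y - p) \<bullet> h + h \<bullet> (y - p))) (at y)"
      by (auto intro!: derivative_eq_intros)
    from has_derivative_diff[OF has_derivative_const[of 3] has_derivative_mult_right[OF this, of "1 / \<rho>\<^sup>2"]]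
    have "(arg has_derivative (\<lambda>h. - (1 / \<rho>\<^sup>2 * ((y - p) \<bullet> h + h \<bullet> (y - p))))) (at y)"
      by (simp add: arg_def[abs_def])
    from has_derivative_compose[OF this smoothstep_derivative[THEN has_field_derivative_imp_has_derivative]]
    show ?thesis unfolding \<beta>_def
      by (rule has_derivative_eq_rhs) (auto simp: fun_eq_iff D\<beta>_def inner_commute)
  qed
  have argc: "continuous_on A arg" for A unfolding arg_def using \<rho> by (intro continuous_intros) auto
  have D\<beta>c: "continuous_on A D\<beta>" for A unfolding D\<beta>_def
    by (intro continuous_intros continuous_on_compose2[OF continuous_smoothstep'[of UNIV] argc]) auto
  have \<beta>c: "continuous_on A \<beta>" for A
    by (rule has_derivative_continuous_on) (rule has_derivative_at_withinI[OF \<beta>der])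
  define m where "m k y = smoothstep (- real (Suc k) * phi y)" for k y
  define q where "q k y = real (Suc k) * smoothstep' (- real (Suc k) * phi y)" for k y
  have mder: "(m k has_derivative (\<lambda>h. (- q k y *\<^sub>R Dphi y) \<bullet> h)) (at y)" if "y \<in> ?B" for k y
  proof -
    have "((\<lambda>y. - real (Suc k) * phi y) has_derivative (\<lambda>h. - real (Suc k) * (Dphi y \<bullet> h))) (at y)"
      using pder[of y] that sub by (intro has_derivative_mult_right) auto
    from has_derivative_compose[OF this smoothstep_derivative[THEN has_field_derivative_imp_has_derivative]]
    show ?thesis unfolding m_def
      by (rule has_derivative_eq_rhs) (auto simp: fun_eq_iff q_def algebra_simps)
  qed
  have phic: "continuous_on ?B phi"
    by (rule has_derivative_continuous_on, rule has_derivative_at_withinI[OF pder]) (use sub in blast)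
  have mc: "continuous_on ?B (m k)" for k
    by (rule has_derivative_continuous_on) (rule has_derivative_at_withinI[OF mder])
  have qc: "continuous_on ?B (q k)" for k unfolding q_def
    by (intro continuous_intros continuous_on_compose2[OF continuous_smoothstep'[of UNIV]] phic) auto
  have Dpc1: "continuous_on ?B Dphi" using Dpc sub by (rule continuous_on_subset)
  have mb: "0 \<le> m k y" "m k y \<le> 1" for k y by (simp_all add: m_def smoothstep_bounds)
  have q0: "0 \<le> q k y" for k y by (simp add: q_def smoothstep'_nonneg)
  have mlim: "\<forall>\<^sub>F k in sequentially. m k y = 1" if "y \<in> W" "y \<in> ?B" for y
  proof -
    have neg: "phi y < 0" using that Wphi sub by blast
    obtain n where n: "2 / (- phi y) < real n" using reals_Archimedean2 by blast
    have "m k y = 1" if "k \<ge> n" for k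
    proof -
      have "2 / (- phi y) \<le> real (Suc k)" using n that by linarith
      then have "2 \<le> - real (Suc k) * phi y" using neg by (simp add: field_simps)
      then show ?thesis by (simp add: m_def smoothstep_eq_1)
    qed
    then show ?thesis by (auto simp: eventually_sequentially)
  qed
  \<comment> \<open>The gradient of the cut-off is -E - L. Here \<open>L\<close> is the singular
    part, of density \<open>Q\<close> along \<open>Dphi\<close>, while \<open>E\<close> comes from
    the bump, is bounded, and vanishes eventually at each point of W. \<open>A\<close> replaces
    \<open>E\<close> when the complementary function \<open>\<beta> * m\<close> is
    differentiated.\<close>
  define Q where "Q k y = (if y \<in> ?B then \<beta> y * q k y else 0)" for k y
  define L where "L k y = (if y \<in> ?B then (\<beta> y * q k y) *\<^sub>R Dphi y else 0)" for k y
  define E where "E k y = (if y \<in> ?B then (1 - m k y) *\<^sub>R D\<beta> y else 0)" for k y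
  define A where "A k y = (if y \<in> ?B then m k y *\<^sub>R D\<beta> y else 0)" for k y
  define \<theta> where "\<theta> k y = 1 - (if y \<in> ?B then \<beta> y * (1 - m k y) else 0)" for k y
  define D where "D k y = - E k y - L k y" for k y
  have Qc: "continuous_on S (Q k)" for k S
    by (rule continuous_on_subset[OF _ subset_UNIV], unfold Q_def[abs_def],
        rule continuous_on_extend_zero[OF _ cK(1) KB]) (auto intro!: continuous_intros qc \<beta>c simp: \<beta>K)
  have Lc: "continuous_on S (L k)" for k S
    by (rule continuous_on_subset[OF _ subset_UNIV], unfold L_def[abs_def],
        rule continuous_on_extend_zero[OF _ cK(1) KB]) (auto intro!: continuous_intros qc \<beta>c Dpc1 simp: \<beta>K)
  have Ec: "continuous_on S (E k)" for k S
    by (rule continuous_on_subset[OF _ subset_UNIV], unfold E_def[abs_def],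
        rule continuous_on_extend_zero[OF _ cK(1) KB]) (auto intro!: continuous_intros mc D\<beta>c simp: \<beta>K)
  have Ac: "continuous_on S (A k)" for k S
    by (rule continuous_on_subset[OF _ subset_UNIV], unfold A_def[abs_def],
        rule continuous_on_extend_zero[OF _ cK(1) KB]) (auto intro!: continuous_intros mc D\<beta>c simp: \<beta>K)
  have \<theta>der: "(\<theta> k has_derivative (\<lambda>h. D k y \<bullet> h)) (at y)" for k y
  proof -
    have "((\<lambda>y. if y \<in> ?B then \<beta> y * (1 - m k y) else 0) has_derivative
       (\<lambda>h. if y \<in> ?B then \<beta> y * - ((- q k y *\<^sub>R Dphi y) \<bullet> h) + (D\<beta> y \<bullet> h) * (1 - m k y) else 0)) (at y)"
    proof (rule has_derivative_extend_zero[OF _ cK(1) KB])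
      fix y assume "y \<in> ?B"
      then show "((\<lambda>y. \<beta> y * (1 - m k y)) has_derivative
         (\<lambda>h. \<beta> y * - ((- q k y *\<^sub>R Dphi y) \<bullet> h) + (D\<beta> y \<bullet> h) * (1 - m k y))) (at y)"
        by (intro has_derivative_mult[OF \<beta>der] has_derivative_eq_rhs[OF has_derivative_diff[OF has_derivative_const mder]])
           (auto simp: fun_eq_iff)
    qed (auto simp: \<beta>K)
    from has_derivative_diff[OF has_derivative_const[of 1] this]
    show ?thesis unfolding \<theta>_def
      by (rule has_derivative_eq_rhs) (auto simp: fun_eq_iff D_def E_def L_def inner_diff_left algebra_simps)
  qed
  \<comment> \<open>The mass of the layer is bounded by integrating the derivative along the transversal v, instead of estimating its volume.\<close>
  have layer_mass: "(\<integral>y. Q k y \<partial>borel_on W) \<le> (\<integral>y. norm (D\<beta> y) * norm v \<partial>lborel) / \<kappa>" for k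
  proof -
    define f where "f y = (if y \<in> ?B then \<beta> y * m k y else 0)" for y
    have fder: "(f has_derivative (\<lambda>h. (A k y - L k y) \<bullet> h)) (at y)" for y
    proof -
      have "(f has_derivative (\<lambda>h. if y \<in> ?B then \<beta> y * ((- q k y *\<^sub>R Dphi y) \<bullet> h) + (D\<beta> y \<bullet> h) * m k y else 0)) (at y)"
        unfolding f_def
        by (rule has_derivative_extend_zero[OF open_ball cK(1) KB], erule has_derivative_mult[OF \<beta>der mder])
           (simp add: \<beta>K)
      then show ?thesis
        by (rule has_derivative_eq_rhs) (auto simp: fun_eq_iff A_def L_def inner_diff_left algebra_simps)
    qed
    have f0: "f y = 0" if "y \<notin> K" for y using \<beta>K[OF that] by (simp add: f_def)
    have cont: "continuous_on UNIV (\<lambda>y. (A k y - L k y) \<bullet> v)" by (intro continuous_intros Ac Lc)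
    note Z = integral_directional_derivative_eq_0[OF fder cont compact_imp_bounded[OF cK(2)] f0]
    have intK: "integrable lborel g" if "continuous_on UNIV g" "\<And>y. y \<notin> K \<Longrightarrow> g y = 0" for g :: "'a \<Rightarrow> real"
    proof -
      have "integrable lborel (\<lambda>x. indicator K x *\<^sub>R g x)"
        by (rule borel_integrable_compact[OF cK(2)]) (rule continuous_on_subset[OF that(1)], simp)
      moreover have "(\<lambda>x. indicator K x *\<^sub>R g x) = g" using that(2) by (auto simp: indicator_def fun_eq_iff)
      ultimately show ?thesis by simp
    qed
    have iA: "integrable lborel (\<lambda>y. A k y \<bullet> v)"
      by (rule intK) (intro continuous_intros Ac, simp add: A_def \<beta>K)
    have iL: "integrable lborel (\<lambda>y. L k y \<bullet> v)"
      by (rule intK) (intro continuous_intros Lc, simp add: L_def \<beta>K)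
    have iQ: "integrable lborel (\<lambda>y. Q k y)"
      by (rule intK) (rule Qc, simp add: Q_def \<beta>K)
    have iD: "integrable lborel (\<lambda>y. norm (D\<beta> y) * norm v)"
      by (rule intK) (intro continuous_intros D\<beta>c, simp add: \<beta>K)
    have Q0: "0 \<le> Q k y" for y using \<beta>b q0 by (simp add: Q_def)
    have "(\<integral>y. Q k y \<partial>borel_on W) \<le> (\<integral>y. Q k y \<partial>lborel)"
      unfolding integral_restrict_space[OF W_sets]
      by (intro integral_mono iQ integrable_mult_indicator) (use opn Q0 in \<open>auto simp: indicator_def\<close>)
    also have "\<dots> \<le> (\<integral>y. L k y \<bullet> v / \<kappa> \<partial>lborel)"
    proof (intro integral_mono iQ)
      fix y
      show "Q k y \<le> L k y \<bullet> v / \<kappa>"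
        using Dv[of y] \<kappa> \<beta>b(1)[of y] q0[of k y] 
        by (auto simp: Q_def L_def pos_le_divide_eq intro!: mult_left_mono)
    qed (use iL in auto)
    also have "\<dots> = (\<integral>y. A k y \<bullet> v \<partial>lborel) / \<kappa>"
      using Z(2) iA iL by (simp add: inner_diff_left)
    also have "\<dots> \<le> (\<integral>y. norm (D\<beta> y) * norm v \<partial>lborel) / \<kappa>"
    proof (intro divide_right_mono integral_mono iA iD)
      fix y
      have "A k y \<bullet> v \<le> norm (A k y) * norm v" by (rule norm_cauchy_schwarz)
      also have "\<dots> \<le> norm (D\<beta> y) * norm v"
        using mb[of k y] by (intro mult_right_mono) (auto simp: A_def mult_left_le_one_le)
      finally show "A k y \<bullet> v \<le> norm (D\<beta> y) * norm v" .
    qed (use \<kappa> in auto)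
    finally show ?thesis .
  qed
  define C2 where "C2 = (\<integral>y. norm (D\<beta> y) * norm v \<partial>lborel) / \<kappa>"
  have C2: "0 \<le> C2" using \<kappa> by (auto simp: C2_def)
  obtain CD where CD: "0 \<le> CD" "\<And>y. y \<in> closure W \<Longrightarrow> norm (D\<beta> y) \<le> CD"
    using compact_continuous_bound[OF compact_closure_W D\<beta>c] by blast
  have Elim: "(\<lambda>k. \<integral>y. norm (E k y) \<partial>borel_on W) \<longlonglongrightarrow> 0"
  proof -
    have "(\<lambda>k. \<integral>y. norm (E k y) \<partial>borel_on W) \<longlonglongrightarrow> (\<integral>y. 0 \<partial>borel_on W)"
    proof (rule dominated_convergence_W[where C=CD])
      fix y assume y: "y \<in> W"
      show "\<bar>norm (E k y)\<bar> \<le> CD" for k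
      proof -
        have "norm (E k y) \<le> norm (D\<beta> y)" using mb[of k y] by (auto simp: E_def intro!: mult_left_le_one_le)
        then show ?thesis using CD(2)[of y] y closure_subset by fastforce
      qed
      have "\<forall>\<^sub>F k in sequentially. norm (E k y) = 0"
      proof (cases "y \<in> ?B")
        case True
        show ?thesis using mlim[OF y True] by eventually_elim (simp add: E_def)
      qed (simp add: E_def)
      then show "(\<lambda>k. norm (E k y)) \<longlonglongrightarrow> 0" by (rule tendsto_eventually)
    qed (intro continuous_intros Ec)+
    then show ?thesis by simp
  qed
  have "boundary_cutoff W (ball p \<rho>) \<theta> D"
    unfolding boundary_cutoff_def
  proof (intro conjI allI impI ballI \<theta>der)
    fix k y
    show "continuous_on UNIV (D k)" unfolding D_def by (intro continuous_intros Ec Lc)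
    have "0 \<le> \<beta> y * (1 - m k y)" "\<beta> y * (1 - m k y) \<le> 1" using \<beta>b[of y] mb[of k y] by (auto intro: mult_le_one)
    then show "0 \<le> \<theta> k y" "\<theta> k y \<le> 1" by (auto simp: \<theta>_def)
    {
      fix y assume y: "y \<in> W"
      have "\<forall>\<^sub>F k in sequentially. \<theta> k y = 1"
      proof (cases "y \<in> ?B")
        case True
        show ?thesis using mlim[OF y True] by eventually_elim (simp add: \<theta>_def)
      qed (simp add: \<theta>_def)
      then show "(\<lambda>k. \<theta> k y) \<longlonglongrightarrow> 1" by (rule tendsto_eventually)
    next
      fix k y assume y: "y \<in> ball p \<rho> - W"
      have yB: "y \<in> ?B" using y \<rho> by (auto simp: \<rho>_def)
      have "\<not> phi y < 0" using y yB sub Wphi by blast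
      \<comment> \<open>At a point outside W phi is nonnegative, so nearby the argument -(k+1) phi
        stays below 1, where the step is still 0. Starting the transition at 1 and not at 0 gives a
        whole neighbourhood on which the cut-off vanishes.\<close>
      have "open {z \<in> ball p \<rho>. - 1 / real (Suc k) < phi z}"
        using continuous_open_preimage[of "ball p \<rho>" phi "{- 1 / real (Suc k)<..}"]
          continuous_on_subset[OF phic, of "ball p \<rho>"] \<rho>
        by (simp add: vimage_def Int_def \<rho>_def subset_ball)
      moreover have "- 1 / real (Suc k) < phi y"
        using \<open>\<not> phi y < 0\<close> by (smt (verit) divide_neg_pos of_nat_0_less_iff zero_less_Suc)
      ultimately have "\<forall>\<^sub>F z in nhds y. z \<in> {z \<in> ball p \<rho>. - 1 / real (Suc k) < phi z}"
        using y by (intro eventually_nhds_in_open) auto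
      then show "\<forall>\<^sub>F z in nhds y. \<theta> k z = 0"
      proof eventually_elim
        case (elim z)
        then have "- real (Suc k) * phi z \<le> 1" by (simp add: field_simps)
        then have "m k z = 0" by (simp add: m_def smoothstep_eq_0)
        moreover have "z \<in> ?B" using elim \<rho> by (auto simp: \<rho>_def)
        ultimately show ?case using \<beta>1 elim by (simp add: \<theta>_def)
      qed
    next
      fix T :: "real set" and F :: "real \<times> 'a \<Rightarrow> 'a" and e :: real
      assume T: "compact T" and Fc: "continuous_on (T \<times> closure W) F"
        and Ft: "\<forall>s\<in>T. \<forall>y\<in>frontier W. tangential W y (F (s, y))" and e: "e > 0"
      have cTW: "compact (T \<times> closure W)" by (intro compact_Times T compact_closure_W)
      obtain CF where CF: "0 \<le> CF" "\<And>x. x \<in> T \<times> closure W \<Longrightarrow> norm (F x) \<le> CF"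
        using compact_continuous_bound[OF cTW Fc] by blast
      \<comment> \<open>\<open>C2\<close> bounds the layer mass for every k, so a flux of at most
        \<open>\<eta>\<close> inside the layer costs at most e/2; the other half is left for
        \<open>E\<close>. Adding 1 keeps the denominators positive.\<close>
      define \<eta> where "\<eta> = e / (2 * (C2 + 1))"
      have \<eta>: "\<eta> > 0" using e C2 by (simp add: \<eta>_def)
      let ?C = "T \<times> (closure W \<inter> K)"
      have cC: "compact ?C" by (intro compact_Times T compact_Int_closed compact_closure_W cK)
      have fc: "continuous_on ?C (\<lambda>x. \<bar>Dphi (snd x) \<bullet> F x\<bar>)"
        using KB by (intro continuous_intros continuous_on_compose2[OF Dpc1] continuous_on_subset[OF Fc]) auto
      \<comment> \<open>Where the flux exceeds \<eta>, phi is bounded away from 0, so the thin layer misses M.\<close>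
      define M where "M = {x \<in> ?C. \<eta> \<le> \<bar>Dphi (snd x) \<bullet> F x\<bar>}"
      have cM: "compact M"
      proof -
        have "closedin (top_of_set ?C) M"
          using continuous_closedin_preimage[OF fc, of "{\<eta>..}"] by (simp add: M_def vimage_def Int_def)
        then show ?thesis using cC by (rule closedin_compact[rotated])
      qed
      have Mneg: "phi (snd x) < 0" if "x \<in> M" for x
      proof (rule ccontr)
        assume "\<not> phi (snd x) < 0"
        moreover have xB: "snd x \<in> ?B" "snd x \<in> closure W" "fst x \<in> T" using that KB by (auto simp: M_def)
        ultimately have "snd x \<notin> W" using Wphi sub by blast
        then have xf: "snd x \<in> frontier W" using xB opn by (simp add: frontier_def interior_open)
        have xr: "snd x \<in> ball p r" using xB sub by blast
        have "F x \<bullet> (Dphi (snd x) /\<^sub>R norm (Dphi (snd x))) = 0"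
          using Ft xB(3) xf defining_fun_normal[OF lc xf xr] unfolding tangential_def
          by (metis prod.collapse)
        then have "Dphi (snd x) \<bullet> F x = 0" using Dp0[OF xr] by (simp add: inner_commute)
        then show False using that \<eta> by (simp add: M_def)
      qed
      have "\<exists>\<delta>>0. \<forall>x\<in>M. phi (snd x) \<le> - \<delta>"
      proof (cases "M = {}")
        case False
        have "continuous_on M (\<lambda>x. phi (snd x))"
          using KB by (intro continuous_on_compose2[OF phic] continuous_intros) (auto simp: M_def)
        then obtain x0 where "x0 \<in> M" "\<And>x. x \<in> M \<Longrightarrow> phi (snd x) \<le> phi (snd x0)"
          using continuous_attains_sup[OF cM False] by blast
        then show ?thesis using Mneg by (intro exI[of _ "- phi (snd x0)"]) auto
      qed (auto intro: exI[of _ 1])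
      then obtain \<delta> where \<delta>: "\<delta> > 0" "\<And>x. x \<in> M \<Longrightarrow> phi (snd x) \<le> - \<delta>" by blast
      \<comment> \<open>On \<open>M\<close> the argument of the step exceeds 2 for such k, so the
        transition is over and \<open>Q\<close> vanishes. Off \<open>M\<close>, either the flux is
        below \<open>\<eta>\<close> or the bump is 0.\<close>
      have small: "Q k y * \<bar>Dphi y \<bullet> F (s, y)\<bar> \<le> Q k y * \<eta>"
        if k: "real (Suc k) * \<delta> \<ge> 2" and s: "s \<in> T" and y: "y \<in> W" for k s y
      proof (cases "(s, y) \<in> M")
        case True
        have "phi y \<le> - \<delta>" using \<delta>(2)[OF True] by simp
        then have "real (Suc k) * \<delta> \<le> real (Suc k) * (- phi y)" by (intro mult_left_mono) auto
        then have "2 \<le> - real (Suc k) * phi y" using k unfolding mult_minus_left mult_minus_right by linarith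
        then have "q k y = 0" by (simp add: q_def smoothstep'_eq_0)
        then show ?thesis by (simp add: Q_def)
      next
        case False
        show ?thesis
        proof (cases "y \<in> K")
          case True
          then have "\<bar>Dphi y \<bullet> F (s, y)\<bar> \<le> \<eta>" using False s y closure_subset by (force simp: M_def)
          then show ?thesis using \<beta>b q0 by (intro mult_left_mono) (auto simp: Q_def)
        qed (simp add: Q_def \<beta>K)
      qed
      have "\<forall>\<^sub>F k in sequentially. (\<integral>y. norm (E k y) \<partial>borel_on W) < e / (2 * (CF + 1))"
        using order_tendstoD(2)[OF Elim] e CF(1) by simp
      moreover have "\<forall>\<^sub>F k in sequentially. real (Suc k) * \<delta> \<ge> 2"
      proof -
        obtain n where n: "2 / \<delta> < real n" using reals_Archimedean2 by blast
        have "real (Suc k) * \<delta> \<ge> 2" if "k \<ge> n" for k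
        proof -
          have "2 / \<delta> \<le> real (Suc k)" using n that by linarith
          then show ?thesis using \<delta> by (simp add: field_simps)
        qed
        then show ?thesis by (auto simp: eventually_sequentially)
      qed
      ultimately show "\<forall>\<^sub>F k in sequentially. \<forall>s\<in>T. (\<integral>y. \<bar>D k y \<bullet> F (s, y)\<bar> \<partial>borel_on W) \<le> e"
      proof eventually_elim
        case (elim k)
        show ?case
        proof
          fix s assume s: "s \<in> T"
          have Fs: "continuous_on (closure W) (\<lambda>y. F (s, y))"
            by (rule continuous_on_compose2[OF Fc]) (use s in \<open>auto intro!: continuous_intros\<close>)
          have iE: "integrable (borel_on W) (\<lambda>y. norm (E k y))" and iQ: "integrable (borel_on W) (Q k)"
            and iDF: "integrable (borel_on W) (\<lambda>y. \<bar>D k y \<bullet> F (s, y)\<bar>)"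
            unfolding D_def by (intro integrable_closure_W continuous_intros Ec Lc Qc Fs)+
          have "(\<integral>y. \<bar>D k y \<bullet> F (s, y)\<bar> \<partial>borel_on W) \<le> (\<integral>y. norm (E k y) * CF + Q k y * \<eta> \<partial>borel_on W)"
          proof (rule integral_mono_W[OF iDF])
            fix y assume y: "y \<in> W"
            have "\<bar>E k y \<bullet> F (s, y)\<bar> \<le> norm (E k y) * norm (F (s, y))" by (rule Cauchy_Schwarz_ineq2)
            also have "\<dots> \<le> norm (E k y) * CF" using CF(2)[of "(s, y)"] s y closure_subset by (intro mult_left_mono) auto
            finally have 1: "\<bar>E k y \<bullet> F (s, y)\<bar> \<le> norm (E k y) * CF" .
            have "\<bar>L k y \<bullet> F (s, y)\<bar> = Q k y * \<bar>Dphi y \<bullet> F (s, y)\<bar>"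
              using \<beta>b[of y] q0[of k y] by (simp add: L_def Q_def abs_mult)
            also have "\<dots> \<le> Q k y * \<eta>" using small elim s y by blast
            finally show "\<bar>D k y \<bullet> F (s, y)\<bar> \<le> norm (E k y) * CF + Q k y * \<eta>"
              using 1 by (simp add: D_def inner_diff_left)
          qed (use iE iQ in auto)
          also have "\<dots> = (\<integral>y. norm (E k y) \<partial>borel_on W) * CF + (\<integral>y. Q k y \<partial>borel_on W) * \<eta>"
            using iE iQ by simp
          also have "\<dots> \<le> e / (2 * (CF + 1)) * (CF + 1) + (C2 + 1) * \<eta>"
          proof (intro add_mono mult_mono)
            show "(\<integral>y. Q k y \<partial>borel_on W) \<le> C2 + 1" using layer_mass[of k] by (simp add: C2_def)
          qed (use elim CF \<eta> C2 e in auto)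
          also have "\<dots> = e"
          proof -
            have *: "e / (2 * c) * c = e / 2" if "c > 0" for c :: real using that by simp
            have **: "e / (2 * (CF + 1)) * (CF + 1) = e / 2" "(C2 + 1) * \<eta> = e / 2"
              unfolding \<eta>_def mult.commute[of "C2 + 1"] by (rule *, use CF(1) C2 in linarith)+
            show ?thesis unfolding ** by simp
          qed
          finally show "(\<integral>y. \<bar>D k y \<bullet> F (s, y)\<bar> \<partial>borel_on W) \<le> e" .
        qed
      qed
    }
  qed
  then show ?thesis using \<rho> by blast
qed

lemma boundary_cutoff_finite_Union:
  assumes "finite \<C>" "\<And>V. V \<in> \<C> \<Longrightarrow> \<exists>\<theta> D. boundary_cutoff W V \<theta> D"
  shows "\<exists>\<theta> D. boundary_cutoff W (\<Union>\<C>) \<theta> D"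
  using assms
proof (induction \<C>)
  case empty
  then show ?case using boundary_cutoff_empty by auto
next
  case (insert V \<C>)
  obtain \<theta>1 D1 where 1: "boundary_cutoff W V \<theta>1 D1" using insert.prems by blast
  obtain \<theta>2 D2 where 2: "boundary_cutoff W (\<Union>\<C>) \<theta>2 D2" using insert by blast
  show ?case using boundary_cutoff_mult[OF 1 2] by auto
qed

lemma boundary_cutoff_exists:
  assumes "C1_domain W"
  obtains V \<theta> D where "open V" "frontier W \<subseteq> V" "boundary_cutoff W V \<theta> D"
proof -
  have "\<exists>\<rho>>0. \<exists>\<theta> D. boundary_cutoff W (ball p \<rho>) \<theta> D" if "p \<in> frontier W" for p
    using assms boundary_cutoff_local that unfolding C1_domain_def by blast
  then obtain \<rho> where \<rho>: "\<And>p. p \<in> frontier W \<Longrightarrow> \<rho> p > 0 \<and> (\<exists>\<theta> D. boundary_cutoff W (ball p (\<rho> p)) \<theta> D)"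
    by metis
  have "compact (frontier W)" using bdd by (rule compact_frontier_bounded)
  moreover have "frontier W \<subseteq> \<Union>((\<lambda>p. ball p (\<rho> p)) ` frontier W)" using \<rho> by auto
  ultimately obtain \<C> where \<C>: "\<C> \<subseteq> (\<lambda>p. ball p (\<rho> p)) ` frontier W" "finite \<C>" "frontier W \<subseteq> \<Union>\<C>"
    by (rule compactE) auto
  then have "\<exists>\<theta> D. boundary_cutoff W (\<Union>\<C>) \<theta> D"
    using \<rho> by (intro boundary_cutoff_finite_Union) auto
  moreover have "open (\<Union>\<C>)" using \<C> by (intro open_Union) auto
  ultimately show ?thesis using that \<C> by blast
qed

end

section \<open>Green's identity on cross-sections\<close>

text \<open>The gradient is a separate argument because on the boundary it is only the continuous
  extension from the interior, not a derivative of \<open>w\<close>.\<close>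

definition C1_up_to_boundary ::
  "'a::euclidean_space set \<Rightarrow> (real \<times> 'a \<Rightarrow> real) \<Rightarrow> (real \<times> 'a \<Rightarrow> real \<times> 'a) \<Rightarrow> bool" where
  "C1_up_to_boundary W w gw \<longleftrightarrow>
     (\<forall>x\<in>UNIV \<times> W. (w has_derivative (\<lambda>h. gw x \<bullet> h)) (at x)) \<and>
     continuous_on (UNIV \<times> closure W) w \<and> continuous_on (UNIV \<times> closure W) gw"

text \<open>Green's identity taken as a definition: it is linear and translation invariant in u, so no regularity up to the
  boundary beyond C1 has to be carried along.\<close>

definition weakly_neumann_harmonic ::
  "'a::euclidean_space set \<Rightarrow> (real \<times> 'a \<Rightarrow> real) \<Rightarrow> (real \<times> 'a \<Rightarrow> real \<times> 'a) \<Rightarrow> bool" where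
  "weakly_neumann_harmonic W u gu \<longleftrightarrow> C1_up_to_boundary W u gu \<and>
     (\<forall>w gw s. C1_up_to_boundary W w gw \<longrightarrow>
        ((\<lambda>s. \<integral>y. w (s, y) * fst (gu (s, y)) \<partial>borel_on W) has_real_derivative
           (\<integral>y. gw (s, y) \<bullet> gu (s, y) \<partial>borel_on W)) (at s))"

section \<open>Partial derivatives along the axis and along the cross-section\<close>

lemma sum_Basis_prod:
  fixes f :: "'a::euclidean_space \<times> 'b::euclidean_space \<Rightarrow> real"
  shows "sum f Basis = (\<Sum>b\<in>Basis. f (b, 0)) + (\<Sum>b\<in>Basis. f (0, b))"
proof -
  have "inj_on (\<lambda>u. (u::'a, 0::'b)) Basis" "inj_on (\<lambda>u. (0::'a, u::'b)) Basis"
    by (auto intro!: inj_onI)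
  then show ?thesis unfolding Basis_prod_def
    by (subst sum.union_disjoint) (auto simp: sum.reindex)
qed

lemma continuous_on_section:
  assumes "continuous_on (UNIV \<times> A) f"
  shows "continuous_on A (\<lambda>y. f (s, y))"
  by (rule continuous_on_compose2[OF assms]) (auto intro!: continuous_intros)

lemma partial_derivatives_section:
  fixes f :: "real \<times> 'a::euclidean_space \<Rightarrow> 'b::real_normed_vector"
  assumes "(f has_derivative f') (at (s, y))"
  shows "((\<lambda>r. f (r, y)) has_derivative (\<lambda>h. f' (h, 0))) (at s)"
    and "((\<lambda>z. f (s, z)) has_derivative (\<lambda>h. f' (0, h))) (at y)"
proof -
  show "((\<lambda>r. f (r, y)) has_derivative (\<lambda>h. f' (h, 0))) (at s)"
    by (rule has_derivative_compose[where f="\<lambda>r. (r, y)" and g=f and g'=f'])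
       (use assms in \<open>auto intro!: derivative_eq_intros\<close>)
  show "((\<lambda>z. f (s, z)) has_derivative (\<lambda>h. f' (0, h))) (at y)"
    by (rule has_derivative_compose[where f="\<lambda>z. (s, z)" and g=f and g'=f'])
       (use assms in \<open>auto intro!: derivative_eq_intros\<close>)
qed

lemma has_real_derivative_section:
  fixes f :: "real \<times> 'a::euclidean_space \<Rightarrow> real"
  assumes "(f has_derivative (\<lambda>h. g \<bullet> h)) (at (s, y))"
  shows "((\<lambda>r. f (r, y)) has_real_derivative fst g) (at s)"
  using partial_derivatives_section(1)[OF assms]
  by (simp add: has_field_derivative_def inner_prod_def)

section \<open>Differentiation under the integral and integration by parts\<close>

context bounded_open begin

lemma integrable_compact_support_W:
  fixes f :: "'a \<Rightarrow> real"
  assumes "continuous_on W f" "compact K" "K \<subseteq> W" "\<And>y. y \<in> W - K \<Longrightarrow> f y = 0"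
  shows "integrable (borel_on W) f"
proof -
  obtain C where C: "0 \<le> C" "\<And>x. x \<in> K \<Longrightarrow> norm (f x) \<le> C"
    using compact_continuous_bound[OF assms(2) continuous_on_subset[OF assms(1,3)]] by blast
  show ?thesis
  proof (rule integrable_W[OF assms(1)])
    fix y assume "y \<in> W" then show "norm (f y) \<le> C" using C assms(4)[of y] by (cases "y \<in> K") auto
  qed
qed

text \<open>The bound is required only within distance 1 of \<open>s\<close>, so it can be supplied
  by compactness of a bounded piece of the cylinder.\<close>

lemma has_real_derivative_integral_W:
  fixes f :: "real \<Rightarrow> 'a \<Rightarrow> real"
  assumes der: "\<And>r y. y \<in> W \<Longrightarrow> \<bar>r - s\<bar> < 1 \<Longrightarrow> ((\<lambda>r. f r y) has_real_derivative f' r y) (at r)"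
    and bound: "\<And>r y. y \<in> W \<Longrightarrow> \<bar>r - s\<bar> < 1 \<Longrightarrow> \<bar>f' r y\<bar> \<le> C"
    and int: "\<And>r. integrable (borel_on W) (f r)"
    and cont: "continuous_on W (f' s)"
  shows "((\<lambda>r. \<integral>y. f r y \<partial>borel_on W) has_real_derivative (\<integral>y. f' s y \<partial>borel_on W)) (at s)"
  unfolding DERIV_def tendsto_at_iff_sequentially comp_def
proof (intro allI impI)
  fix X :: "nat \<Rightarrow> real" assume X: "\<forall>i. X i \<in> UNIV - {0}" "X \<longlonglongrightarrow> 0"
  obtain N where N: "\<And>n. n \<ge> N \<Longrightarrow> \<bar>X n\<bar> < 1"
    using LIMSEQ_D[OF X(2), of 1] by auto
  define g where "g n y = (f (s + X (n + N)) y - f s y) / X (n + N)" for n y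
  have "(\<lambda>n. integral\<^sup>L (borel_on W) (g n)) \<longlonglongrightarrow> (\<integral>y. f' s y \<partial>borel_on W)"
  proof (rule integral_dominated_convergence)
    show "integrable (borel_on W) (\<lambda>_. C)" using finite_measure_W by (simp add: finite_measure.integrable_const)
    show "f' s \<in> borel_measurable (borel_on W)" by (rule measurable_W[OF cont])
    show "g n \<in> borel_measurable (borel_on W)" for n unfolding g_def
      by (intro borel_measurable_divide borel_measurable_diff borel_measurable_const borel_measurable_integrable[OF int])
    show "AE y in borel_on W. (\<lambda>n. g n y) \<longlonglongrightarrow> f' s y"
    proof (rule AE_I2)
      fix y assume "y \<in> space (borel_on W)"
      then have "((\<lambda>r. f r y) has_real_derivative f' s y) (at s)" by (intro der) (auto simp: space_W)
      then have "(\<lambda>n. (f (s + X n) y - f s y) / X n) \<longlonglongrightarrow> f' s y"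
        using X unfolding DERIV_def tendsto_at_iff_sequentially comp_def by blast
      then show "(\<lambda>n. g n y) \<longlonglongrightarrow> f' s y" unfolding g_def by (rule LIMSEQ_ignore_initial_segment)
    qed
    show "AE y in borel_on W. norm (g n y) \<le> C" for n
    proof (rule AE_I2)
      fix y assume "y \<in> space (borel_on W)"
      then have y: "y \<in> W" by (simp add: space_W)
      have Xn: "\<bar>X (n + N)\<bar> < 1" "X (n + N) \<noteq> 0" using N X by auto
      have "norm (f (s + X (n + N)) y - f s y) \<le> C * norm ((s + X (n + N)) - s)"
      proof (rule field_differentiable_bound[of "ball s 1"])
        fix r assume "r \<in> ball s 1"
        then have "\<bar>r - s\<bar> < 1" by (simp add: dist_real_def abs_minus_commute)
        then show "((\<lambda>r. f r y) has_field_derivative f' r y) (at r within ball s 1)" "norm (f' r y) \<le> C"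
          using der[OF y] bound[OF y] by (auto intro: has_field_derivative_at_within)
      qed (use Xn in \<open>auto simp: dist_real_def\<close>)
      then show "norm (g n y) \<le> C" using Xn by (simp add: g_def divide_le_eq)
    qed
  qed
  then have "(\<lambda>n. ((\<integral>y. f (s + X (n + N)) y \<partial>borel_on W) - (\<integral>y. f s y \<partial>borel_on W)) / X (n + N))
      \<longlonglongrightarrow> (\<integral>y. f' s y \<partial>borel_on W)"
    unfolding g_def using int by simp
  then show "(\<lambda>n. ((\<integral>y. f (s + X n) y \<partial>borel_on W) - (\<integral>y. f s y \<partial>borel_on W)) / X n)
      \<longlonglongrightarrow> (\<integral>y. f' s y \<partial>borel_on W)"
    by (rule LIMSEQ_offset)
qed

text \<open>The points near which the cut-off vanishes identically form an open set, and it contains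
  the frontier. What remains of the closure is compact and inside \<open>W\<close>. Local vanishing,
  as opposed to vanishing at a point, also kills the gradient.\<close>

lemma cutoff_support:
  assumes "boundary_cutoff W V \<theta> D" "frontier W \<subseteq> V"
  obtains K where "compact K" "K \<subseteq> W" "\<And>y. y \<in> W - K \<Longrightarrow> \<theta> k y = 0" "\<And>y. y \<in> W - K \<Longrightarrow> D k y = 0"
proof -
  define Z where "Z = {y. \<forall>\<^sub>F z in nhds y. \<theta> k z = 0}"
  have "open Z"
  proof (subst open_subopen, intro ballI)
    fix y assume "y \<in> Z"
    then obtain S where "open S" "y \<in> S" "\<And>z. z \<in> S \<Longrightarrow> \<theta> k z = 0"
      unfolding Z_def eventually_nhds by blast
    then show "\<exists>T. open T \<and> y \<in> T \<and> T \<subseteq> Z"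
      unfolding Z_def eventually_nhds by (intro exI[of _ S]) auto
  qed
  have Z0: "\<theta> k y = 0" "D k y = 0" if "y \<in> Z" for y
  proof -
    have ev: "\<forall>\<^sub>F z in nhds y. \<theta> k z = 0" using that by (simp add: Z_def)
    then show "\<theta> k y = 0" by (rule eventually_nhds_x_imp_x)
    obtain S where S: "open S" "y \<in> S" "\<And>z. z \<in> S \<Longrightarrow> \<theta> k z = 0"
      using ev unfolding eventually_nhds by blast
    have "(\<theta> k has_derivative (\<lambda>h. 0)) (at y)"
      by (rule has_derivative_transform_within_open[of "\<lambda>_. 0" _ _ _ S]) (use S in auto)
    then have "(\<lambda>h. D k y \<bullet> h) = (\<lambda>h. 0)"
      using has_derivative_unique[OF boundary_cutoffD(1)[OF assms(1)]] by blast
    then have "D k y \<bullet> D k y = 0" by metis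
    then show "D k y = 0" by simp
  qed
  have "y \<in> W" if "y \<in> closure W - Z" for y
  proof (rule ccontr)
    assume "y \<notin> W"
    then have "y \<in> V" using that assms(2) opn by (auto simp: frontier_def interior_open)
    then show False using boundary_cutoffD(7)[OF assms(1) _ \<open>y \<notin> W\<close>] that by (auto simp: Z_def)
  qed
  moreover have "compact (closure W - Z)" using compact_closure_W \<open>open Z\<close> by (rule compact_diff)
  ultimately show ?thesis using that[of "closure W - Z"] Z0 closure_subset by blast
qed

text \<open>For each coordinate direction b, the product of f with the b-component of Y extends by
  zero to the whole space, and its b-derivative integrates to 0; then sum over b.\<close>

lemma integral_compactly_supported_divergence:
  fixes Y :: "'a \<Rightarrow> 'a" and f :: "'a \<Rightarrow> real"
  assumes K: "compact K" "K \<subseteq> W"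
    and fder: "\<And>y. y \<in> W \<Longrightarrow> (f has_derivative (\<lambda>h. gf y \<bullet> h)) (at y)" and gfc: "continuous_on W gf"
    and f0: "\<And>y. y \<in> W - K \<Longrightarrow> f y = 0" and gf0: "\<And>y. y \<in> W - K \<Longrightarrow> gf y = 0"
    and Yder: "\<And>y. y \<in> W \<Longrightarrow> (Y has_derivative Y' y) (at y)"
    and Yc: "\<And>b. b \<in> Basis \<Longrightarrow> continuous_on W (\<lambda>y. Y' y b)"
  shows "(\<integral>y. f y * (\<Sum>b\<in>Basis. Y' y b \<bullet> b) \<partial>borel_on W) = - (\<integral>y. gf y \<bullet> Y y \<partial>borel_on W)"
proof -
  have fc: "continuous_on W f" and YYc: "continuous_on W Y"
    by (rule has_derivative_continuous_on, rule has_derivative_at_withinI, erule fder)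
       (rule has_derivative_continuous_on, rule has_derivative_at_withinI, erule Yder)
  have 1: "integrable (borel_on W) (\<lambda>y. f y * (Y' y b \<bullet> b) + (gf y \<bullet> b) * (Y y \<bullet> b))"
    "(\<integral>y. f y * (Y' y b \<bullet> b) + (gf y \<bullet> b) * (Y y \<bullet> b) \<partial>borel_on W) = 0" if b: "b \<in> Basis" for b
  proof -
    define X where "X y = (if y \<in> W then f y * (Y y \<bullet> b) else 0)" for y
    define X' where "X' y h = (if y \<in> W then f y * (Y' y h \<bullet> b) + (gf y \<bullet> h) * (Y y \<bullet> b) else 0)" for y h
    have "(X has_derivative X' y) (at y)" for y
      unfolding X_def X'_def
    proof (rule has_derivative_extend_zero[OF opn compact_imp_closed[OF K(1)] K(2)])
      fix y assume y: "y \<in> W"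
      have "((\<lambda>y. Y y \<bullet> b) has_derivative (\<lambda>h. Y' y h \<bullet> b)) (at y)"
        by (rule has_derivative_inner_left[OF Yder[OF y]])
      from has_derivative_mult[OF fder[OF y] this]
      show "((\<lambda>y. f y * (Y y \<bullet> b)) has_derivative (\<lambda>h. f y * (Y' y h \<bullet> b) + (gf y \<bullet> h) * (Y y \<bullet> b))) (at y)" .
    qed (simp add: f0)
    moreover have "continuous_on UNIV (\<lambda>y. X' y b)" unfolding X'_def
    proof (rule continuous_on_extend_zero[OF opn compact_imp_closed[OF K(1)] K(2)])
      show "continuous_on W (\<lambda>y. f y * (Y' y b \<bullet> b) + (gf y \<bullet> b) * (Y y \<bullet> b))"
        by (intro continuous_intros fc YYc gfc Yc b)
    qed (simp add: f0 gf0)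
    moreover have "X y = 0" if "y \<notin> W" for y using that by (simp add: X_def)
    ultimately have Z: "integrable lborel (\<lambda>y. X' y b)" "(\<integral>y. X' y b \<partial>lborel) = 0"
      using integral_directional_derivative_eq_0[of X X' b W] bdd by auto
    have e: "(\<lambda>y. indicator W y *\<^sub>R (f y * (Y' y b \<bullet> b) + (gf y \<bullet> b) * (Y y \<bullet> b))) = (\<lambda>y. X' y b)"
      by (auto simp: X'_def fun_eq_iff)
    show "integrable (borel_on W) (\<lambda>y. f y * (Y' y b \<bullet> b) + (gf y \<bullet> b) * (Y y \<bullet> b))"
      using Z unfolding integrable_restrict_space[OF W_sets] e by simp
    show "(\<integral>y. f y * (Y' y b \<bullet> b) + (gf y \<bullet> b) * (Y y \<bullet> b) \<partial>borel_on W) = 0"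
      using Z unfolding integral_restrict_space[OF W_sets] e by simp
  qed
  have "0 = (\<Sum>b\<in>Basis. \<integral>y. f y * (Y' y b \<bullet> b) + (gf y \<bullet> b) * (Y y \<bullet> b) \<partial>borel_on W)"
    using 1 by simp
  also have "\<dots> = (\<integral>y. (\<Sum>b\<in>Basis. f y * (Y' y b \<bullet> b) + (gf y \<bullet> b) * (Y y \<bullet> b)) \<partial>borel_on W)"
    using 1 by (subst Bochner_Integration.integral_sum) auto
  also have "\<dots> = (\<integral>y. f y * (\<Sum>b\<in>Basis. Y' y b \<bullet> b) + gf y \<bullet> Y y \<partial>borel_on W)"
    by (simp add: sum.distrib sum_distrib_left euclidean_inner[of "gf _" "Y _"])
  also have "\<dots> = (\<integral>y. f y * (\<Sum>b\<in>Basis. Y' y b \<bullet> b) \<partial>borel_on W) + (\<integral>y. gf y \<bullet> Y y \<partial>borel_on W)"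
    by (intro Bochner_Integration.integral_add integrable_compact_support_W[OF _ K])
       (auto intro!: continuous_intros fc YYc gfc Yc simp: f0 gf0)
  finally show ?thesis by simp
qed

text \<open>With a cut-off inserted, the second axial derivative of \<open>u\<close> can be replaced
  by minus the cross-section Laplacian and integrated by parts inside a compact subset of W. The
  error term contains the gradient of the cut-off paired with \<open>w\<close> times the tangential
  field \<open>snd (gu (s, y))\<close>, and tends to 0 locally uniformly in s. Uniform convergence
  of the derivatives then allows the limit.\<close>

lemma weakly_neumann_harmonicI:
  assumes C1: "C1_domain W" and u: "C1_up_to_boundary W u gu"
    and hess: "\<And>x. x \<in> UNIV \<times> W \<Longrightarrow> (gu has_derivative H x) (at x)"
    and hess_cont: "\<And>b. b \<in> Basis \<Longrightarrow> continuous_on (UNIV \<times> W) (\<lambda>x. H x b)"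
    and harmonic: "\<And>x. x \<in> UNIV \<times> W \<Longrightarrow> (\<Sum>b\<in>Basis. H x b \<bullet> b) = 0"
    and neumann: "\<And>s y. y \<in> frontier W \<Longrightarrow> tangential W y (snd (gu (s, y)))"
  shows "weakly_neumann_harmonic W u gu"
  unfolding weakly_neumann_harmonic_def
proof (intro conjI allI impI u)
  fix w gw and s0 :: real assume w: "C1_up_to_boundary W w gw"
  obtain V \<theta> D where "open V" and V: "frontier W \<subseteq> V" and cut: "boundary_cutoff W V \<theta> D"
    by (rule boundary_cutoff_exists[OF C1])
  note \<theta> = boundary_cutoffD[OF cut]
  have wc: "continuous_on (UNIV \<times> closure W) w" and gwc: "continuous_on (UNIV \<times> closure W) gw"
    and guc: "continuous_on (UNIV \<times> closure W) gu"
    and wder: "\<And>x. x \<in> UNIV \<times> W \<Longrightarrow> (w has_derivative (\<lambda>h. gw x \<bullet> h)) (at x)"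
    using w u by (auto simp: C1_up_to_boundary_def)
  have sub: "(UNIV :: real set) \<times> W \<subseteq> UNIV \<times> closure W" using closure_subset by auto
  note wc' = continuous_on_subset[OF wc sub] and gwc' = continuous_on_subset[OF gwc sub]
    and guc' = continuous_on_subset[OF guc sub]
  note sw = continuous_on_section[OF wc] continuous_on_section[OF gwc] continuous_on_section[OF guc]
    and sw' = continuous_on_section[OF wc'] continuous_on_section[OF gwc'] continuous_on_section[OF guc']
  have e1: "(1, 0) \<in> (Basis :: (real \<times> 'a) set)" and eb: "\<And>b. b \<in> Basis \<Longrightarrow> (0, b) \<in> (Basis :: (real \<times> 'a) set)"
    by (auto simp: Basis_prod_def)
  have lap: "fst (H (s, y) (1, 0)) = - (\<Sum>b\<in>Basis. snd (H (s, y) (0, b)) \<bullet> b)" if "y \<in> W" for s y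
  proof -
    have "(\<Sum>b\<in>Basis. H (s, y) b \<bullet> b) = (\<Sum>b\<in>Basis. H (s, y) (b, 0) \<bullet> (b, 0)) + (\<Sum>b\<in>Basis. H (s, y) (0, b) \<bullet> (0, b))"
      by (rule sum_Basis_prod)
    then have "(\<Sum>b\<in>Basis. H (s, y) b \<bullet> b) = fst (H (s, y) (1, 0)) + (\<Sum>b\<in>Basis. snd (H (s, y) (0, b)) \<bullet> b)"
      by (simp add: inner_prod_def)
    then show ?thesis using harmonic[of "(s, y)"] that by simp
  qed
  define J where "J k s = (\<integral>y. \<theta> k y * (w (s, y) * fst (gu (s, y))) \<partial>borel_on W)" for k s
  define J' where "J' k s = (\<integral>y. \<theta> k y * (gw (s, y) \<bullet> gu (s, y)) + w (s, y) * (D k y \<bullet> snd (gu (s, y))) \<partial>borel_on W)" for k s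
  have Jder: "(J k has_real_derivative J' k s) (at s)" for k s
  proof -
    obtain K where K: "compact K" "K \<subseteq> W" "\<And>y. y \<in> W - K \<Longrightarrow> \<theta> k y = 0" "\<And>y. y \<in> W - K \<Longrightarrow> D k y = 0"
      using cutoff_support[OF cut V] by metis
    define f' where "f' r y = \<theta> k y * (fst (gw (r, y)) * fst (gu (r, y)) + w (r, y) * fst (H (r, y) (1, 0)))" for r y
    have f'c: "continuous_on (UNIV \<times> W) (\<lambda>x. f' (fst x) (snd x))"
      unfolding f'_def prod.collapse
      by (intro continuous_intros continuous_on_compose2[OF \<theta>(3)[of UNIV]] wc' gwc' guc' hess_cont e1) auto
    \<comment> \<open>The second derivatives may blow up at the boundary; the bound exists because
      the cut-off confines the integrand to \<open>K\<close>.\<close>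
    obtain C where C: "0 \<le> C" "\<And>x. x \<in> {s - 1..s + 1} \<times> K \<Longrightarrow> norm (f' (fst x) (snd x)) \<le> C"
    proof (rule compact_continuous_bound[of "{s - 1..s + 1} \<times> K" "\<lambda>x. f' (fst x) (snd x)"])
      show "compact ({s - 1..s + 1} \<times> K)" using K by (intro compact_Times) auto
      show "continuous_on ({s - 1..s + 1} \<times> K) (\<lambda>x. f' (fst x) (snd x))"
        by (rule continuous_on_subset[OF f'c]) (use K in auto)
    qed blast
    have f'cs: "continuous_on W (f' r)" for r
      using continuous_on_section[OF f'c, of r] by simp
    have "((\<lambda>s. \<integral>y. \<theta> k y * (w (s, y) * fst (gu (s, y))) \<partial>borel_on W) has_real_derivative (\<integral>y. f' s y \<partial>borel_on W)) (at s)"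
    proof (rule has_real_derivative_integral_W[where C=C])
      fix r y assume y: "y \<in> W"
      have wd: "((\<lambda>r. w (r, y)) has_real_derivative fst (gw (r, y))) (at r)"
        by (rule has_real_derivative_section) (use wder y in auto)
      have "(gu has_derivative H (r, y)) (at (r, y))" using hess y by auto
      from has_derivative_fst[OF partial_derivatives_section(1)[OF this]]
      have "((\<lambda>r. fst (gu (r, y))) has_derivative (\<lambda>h. fst (H (r, y) (h, 0)))) (at r)" .
      moreover have "(\<lambda>h. fst (H (r, y) (h, 0))) = (\<lambda>h. fst (H (r, y) (1, 0)) * h)"
      proof
        fix h
        have "linear (H (r, y))" using hess y has_derivative_linear by (metis SigmaI UNIV_I)
        then have "H (r, y) (h *\<^sub>R (1, 0)) = h *\<^sub>R H (r, y) (1, 0)" by (rule linear_cmul)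
        then show "fst (H (r, y) (h, 0)) = fst (H (r, y) (1, 0)) * h" by simp
      qed
      ultimately have gd: "((\<lambda>r. fst (gu (r, y))) has_real_derivative fst (H (r, y) (1, 0))) (at r)"
        unfolding has_field_derivative_def by (simp only:)
      show "((\<lambda>r. \<theta> k y * (w (r, y) * fst (gu (r, y)))) has_real_derivative f' r y) (at r)"
        by (rule DERIV_cong[OF DERIV_cmult[OF DERIV_mult[OF wd gd]]]) (simp add: f'_def algebra_simps)
      assume r: "\<bar>r - s\<bar> < 1"
      show "\<bar>f' r y\<bar> \<le> C"
      proof (cases "y \<in> K")
        case True
        then show ?thesis using C(2)[of "(r, y)"] r by (auto simp: abs_less_iff)
      qed (use K(3)[of y] y C in \<open>simp add: f'_def\<close>)
    next
      show "integrable (borel_on W) (\<lambda>y. \<theta> k y * (w (r, y) * fst (gu (r, y))))" for r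
        by (intro integrable_closure_W continuous_intros \<theta>(3) sw)
    qed (rule f'cs)
    moreover have "(\<integral>y. f' s y \<partial>borel_on W) = J' k s"
    proof -
      define p where "p y = \<theta> k y * w (s, y)" for y
      define gp where "gp y = \<theta> k y *\<^sub>R snd (gw (s, y)) + w (s, y) *\<^sub>R D k y" for y
      have div: "(\<integral>y. p y * (\<Sum>b\<in>Basis. snd (H (s, y) (0, b)) \<bullet> b) \<partial>borel_on W) = - (\<integral>y. gp y \<bullet> snd (gu (s, y)) \<partial>borel_on W)"
      proof (rule integral_compactly_supported_divergence[OF K(1,2)])
        fix y assume y: "y \<in> W"
        have "((\<lambda>y. w (s, y)) has_derivative (\<lambda>h. gw (s, y) \<bullet> (0, h))) (at y)"
          by (rule partial_derivatives_section(2)) (use wder y in auto)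
        from has_derivative_mult[OF \<theta>(1)[of k y] this]
        show "(p has_derivative (\<lambda>h. gp y \<bullet> h)) (at y)" unfolding p_def[abs_def]
          by (rule has_derivative_eq_rhs) (auto simp: fun_eq_iff gp_def inner_prod_def inner_add_left algebra_simps)
        have "(gu has_derivative H (s, y)) (at (s, y))" using hess y by auto
        from has_derivative_snd[OF partial_derivatives_section(2)[OF this]]
        show "((\<lambda>y. snd (gu (s, y))) has_derivative (\<lambda>h. snd (H (s, y) (0, h)))) (at y)" .
      next
        show "continuous_on W gp" unfolding gp_def by (intro continuous_intros \<theta>(2,3) sw')
        show "continuous_on W (\<lambda>y. snd (H (s, y) (0, b)))" if "b \<in> Basis" for b
          by (intro continuous_intros continuous_on_section[OF hess_cont] eb that)
      qed (auto simp: p_def gp_def K)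
      have i1: "integrable (borel_on W) (\<lambda>y. \<theta> k y * (fst (gw (s, y)) * fst (gu (s, y))))"
        by (intro integrable_closure_W continuous_intros \<theta>(3) sw)
      have i2: "integrable (borel_on W) (\<lambda>y. p y * fst (H (s, y) (1, 0)))" unfolding p_def
        by (rule integrable_compact_support_W[OF _ K(1,2)])
           (auto intro!: continuous_intros \<theta>(3) sw' continuous_on_section[OF hess_cont] e1 simp: K)
      have i3: "integrable (borel_on W) (\<lambda>y. gp y \<bullet> snd (gu (s, y)))" unfolding gp_def
        by (intro integrable_closure_W continuous_intros \<theta>(2,3) sw)
      have "(\<integral>y. f' s y \<partial>borel_on W) = (\<integral>y. \<theta> k y * (fst (gw (s, y)) * fst (gu (s, y))) + p y * fst (H (s, y) (1, 0)) \<partial>borel_on W)"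
        by (simp add: f'_def p_def algebra_simps)
      also have "\<dots> = (\<integral>y. \<theta> k y * (fst (gw (s, y)) * fst (gu (s, y))) \<partial>borel_on W) + (\<integral>y. p y * fst (H (s, y) (1, 0)) \<partial>borel_on W)"
        by (rule Bochner_Integration.integral_add[OF i1 i2])
      also have "(\<integral>y. p y * fst (H (s, y) (1, 0)) \<partial>borel_on W) = (\<integral>y. - (p y * (\<Sum>b\<in>Basis. snd (H (s, y) (0, b)) \<bullet> b)) \<partial>borel_on W)"
        by (rule Bochner_Integration.integral_cong) (auto simp: lap space_W)
      also have "\<dots> = (\<integral>y. gp y \<bullet> snd (gu (s, y)) \<partial>borel_on W)" using div by simp
      also have "(\<integral>y. \<theta> k y * (fst (gw (s, y)) * fst (gu (s, y))) \<partial>borel_on W) + \<dots> =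
          (\<integral>y. \<theta> k y * (fst (gw (s, y)) * fst (gu (s, y))) + gp y \<bullet> snd (gu (s, y)) \<partial>borel_on W)"
        by (rule Bochner_Integration.integral_add[OF i1 i3, symmetric])
      also have "\<dots> = J' k s" unfolding J'_def
        by (rule Bochner_Integration.integral_cong) (auto simp: gp_def inner_prod_def inner_add_left algebra_simps)
      finally show ?thesis .
    qed
    ultimately show ?thesis unfolding J_def[abs_def] by simp
  qed
  define Q where "Q s = (\<integral>y. gw (s, y) \<bullet> gu (s, y) \<partial>borel_on W)" for s
  \<comment> \<open>The closed interval is compact, as the cut-off estimate demands; the open one
    carries the convergence of derivatives.\<close>
  let ?S = "{s0 - 1<..<s0 + 1}" and ?T = "{s0 - 1..s0 + 1}"
  have unif: "\<forall>\<^sub>F k in sequentially. \<forall>s\<in>?S. \<bar>J' k s - Q s\<bar> \<le> e" if e: "e > 0" for e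
  proof -
    have cT: "compact (?T \<times> closure W)" by (intro compact_Times compact_closure_W) auto
    have cg: "continuous_on (?T \<times> closure W) (\<lambda>x. gw x \<bullet> gu x)"
      by (rule continuous_on_subset[of "UNIV \<times> closure W"]) (auto intro!: continuous_intros gwc guc)
    obtain M where M: "0 \<le> M" "\<And>x. x \<in> ?T \<times> closure W \<Longrightarrow> norm (gw x \<bullet> gu x) \<le> M"
      using compact_continuous_bound[OF cT cg] by blast
    have "(\<lambda>k. \<integral>y. 1 - \<theta> k y \<partial>borel_on W) \<longlonglongrightarrow> (\<integral>y. 0 \<partial>borel_on W)"
    proof (rule dominated_convergence_W[where C=1])
      show "(\<lambda>k. 1 - \<theta> k y) \<longlonglongrightarrow> 0" if "y \<in> W" for y
        using tendsto_diff[OF tendsto_const[of 1] \<theta>(6)[OF that]] by simp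
      show "\<bar>1 - \<theta> k y\<bar> \<le> 1" for k y using \<theta>(4,5)[of k y] by simp
    qed (intro continuous_intros \<theta>(3))+
    then have "(\<lambda>k. \<integral>y. 1 - \<theta> k y \<partial>borel_on W) \<longlonglongrightarrow> 0" by simp
    then have "\<forall>\<^sub>F k in sequentially. (\<integral>y. 1 - \<theta> k y \<partial>borel_on W) < e / (2 * (M + 1))"
      by (rule order_tendstoD(2)) (use M(1) e in simp)
    moreover have "\<forall>\<^sub>F k in sequentially. \<forall>s\<in>?T. (\<integral>y. \<bar>D k y \<bullet> (\<lambda>x. w x *\<^sub>R snd (gu x)) (s, y)\<bar> \<partial>borel_on W) \<le> e / 2"
    proof (rule \<theta>(8))
      show "continuous_on (?T \<times> closure W) (\<lambda>x. w x *\<^sub>R snd (gu x))"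
        by (rule continuous_on_subset[of "UNIV \<times> closure W"]) (auto intro!: continuous_intros wc guc)
      show "tangential W y ((\<lambda>x. w x *\<^sub>R snd (gu x)) (s, y))" if "y \<in> frontier W" for s y
        using neumann[OF that, of s] by (simp add: tangential_def)
    qed (use e in auto)
    ultimately show ?thesis
    proof eventually_elim
      case (elim k)
      show ?case
      proof
        fix s assume s: "s \<in> ?S"
        have i: "integrable (borel_on W) (\<lambda>y. \<theta> k y * (gw (s, y) \<bullet> gu (s, y)) + w (s, y) * (D k y \<bullet> snd (gu (s, y))))"
          "integrable (borel_on W) (\<lambda>y. gw (s, y) \<bullet> gu (s, y))" "integrable (borel_on W) (\<lambda>y. 1 - \<theta> k y)"
          "integrable (borel_on W) (\<lambda>y. \<bar>D k y \<bullet> (w (s, y) *\<^sub>R snd (gu (s, y)))\<bar>)"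
          by (intro integrable_closure_W continuous_intros \<theta>(2,3) sw)+
        have "J' k s - Q s = (\<integral>y. (\<theta> k y * (gw (s, y) \<bullet> gu (s, y)) + w (s, y) * (D k y \<bullet> snd (gu (s, y)))) - gw (s, y) \<bullet> gu (s, y) \<partial>borel_on W)"
          unfolding J'_def Q_def using i(1,2) by simp
        also have "\<bar>\<dots>\<bar> \<le> (\<integral>y. \<bar>(\<theta> k y * (gw (s, y) \<bullet> gu (s, y)) + w (s, y) * (D k y \<bullet> snd (gu (s, y)))) - gw (s, y) \<bullet> gu (s, y)\<bar> \<partial>borel_on W)"
          by (rule integral_abs_bound)
        also have "\<dots> \<le> (\<integral>y. (1 - \<theta> k y) * M + \<bar>D k y \<bullet> (w (s, y) *\<^sub>R snd (gu (s, y)))\<bar> \<partial>borel_on W)"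
        proof (rule integral_mono_W)
          fix y assume y: "y \<in> W"
          have "\<bar>(\<theta> k y * (gw (s, y) \<bullet> gu (s, y)) + w (s, y) * (D k y \<bullet> snd (gu (s, y)))) - gw (s, y) \<bullet> gu (s, y)\<bar>
             = \<bar>D k y \<bullet> (w (s, y) *\<^sub>R snd (gu (s, y))) - (1 - \<theta> k y) * (gw (s, y) \<bullet> gu (s, y))\<bar>"
            by (simp add: algebra_simps)
          also have "\<dots> \<le> \<bar>D k y \<bullet> (w (s, y) *\<^sub>R snd (gu (s, y)))\<bar> + (1 - \<theta> k y) * \<bar>gw (s, y) \<bullet> gu (s, y)\<bar>"
            using \<theta>(5)[of k y] abs_triangle_ineq4[of "D k y \<bullet> (w (s, y) *\<^sub>R snd (gu (s, y)))" "(1 - \<theta> k y) * (gw (s, y) \<bullet> gu (s, y))"]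
            by (simp add: abs_mult)
          also have "(1 - \<theta> k y) * \<bar>gw (s, y) \<bullet> gu (s, y)\<bar> \<le> (1 - \<theta> k y) * M"
            using \<theta>(5)[of k y] M(2)[of "(s, y)"] s y closure_subset by (intro mult_left_mono) auto
          finally show "\<bar>(\<theta> k y * (gw (s, y) \<bullet> gu (s, y)) + w (s, y) * (D k y \<bullet> snd (gu (s, y)))) - gw (s, y) \<bullet> gu (s, y)\<bar>
             \<le> (1 - \<theta> k y) * M + \<bar>D k y \<bullet> (w (s, y) *\<^sub>R snd (gu (s, y)))\<bar>" by simp
        qed (intro integrable_closure_W continuous_intros \<theta>(2,3) sw)+
        also have "\<dots> = (\<integral>y. 1 - \<theta> k y \<partial>borel_on W) * M + (\<integral>y. \<bar>D k y \<bullet> (w (s, y) *\<^sub>R snd (gu (s, y)))\<bar> \<partial>borel_on W)"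
          using i(3,4) by (subst Bochner_Integration.integral_add) auto
        also have "\<dots> \<le> e / (2 * (M + 1)) * (M + 1) + e / 2"
          using elim s M e by (intro add_mono mult_mono) auto
        also have "e / (2 * (M + 1)) * (M + 1) = e / 2"
        proof -
          have "e / (2 * c) * c = e / 2" if "c > 0" for c :: real using that by simp
          then show ?thesis using M(1) by (metis add_nonneg_pos zero_less_one)
        qed
        finally show "\<bar>J' k s - Q s\<bar> \<le> e" by simp
      qed
    qed
  qed
  have lim: "(\<lambda>k. J k s) \<longlonglongrightarrow> (\<integral>y. w (s, y) * fst (gu (s, y)) \<partial>borel_on W)" for s
  proof -
    obtain C where C: "0 \<le> C" "\<And>y. y \<in> closure W \<Longrightarrow> norm (w (s, y) * fst (gu (s, y))) \<le> C"
      by (rule compact_continuous_bound[OF compact_closure_W, of "\<lambda>y. w (s, y) * fst (gu (s, y))"])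
         (intro continuous_intros sw, blast)
    show ?thesis unfolding J_def
    proof (rule dominated_convergence_W[where C=C])
      fix y assume y: "y \<in> W"
      show "\<bar>\<theta> k y * (w (s, y) * fst (gu (s, y)))\<bar> \<le> C" for k
      proof -
        have "\<bar>\<theta> k y * (w (s, y) * fst (gu (s, y)))\<bar> \<le> 1 * \<bar>w (s, y) * fst (gu (s, y))\<bar>"
          unfolding abs_mult[of "\<theta> k y"] using \<theta>(4,5)[of k y] by (intro mult_right_mono) auto
        then show ?thesis using C(2)[of y] y closure_subset by force
      qed
      show "(\<lambda>k. \<theta> k y * (w (s, y) * fst (gu (s, y)))) \<longlonglongrightarrow> w (s, y) * fst (gu (s, y))"
        using tendsto_mult[OF \<theta>(6)[OF y] tendsto_const] by simp
    qed (intro continuous_intros \<theta>(3) sw')+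
  qed
  have "\<exists>g. \<forall>s\<in>?S. (\<lambda>k. J k s) \<longlonglongrightarrow> g s \<and> (g has_derivative (\<lambda>h. Q s * h)) (at s within ?S)"
  proof (rule has_derivative_sequence[where f=J and f'="\<lambda>k s h. J' k s * h", OF _ _ _ _ lim[of s0]])
    show "(J k has_derivative (\<lambda>h. J' k s * h)) (at s within ?S)" for k s
      using Jder[of k s] by (simp add: has_field_derivative_def has_derivative_at_withinI)
    fix e :: real assume "e > 0"
    from unif[OF this] show "\<forall>\<^sub>F k in sequentially. \<forall>s\<in>?S. \<forall>h. norm (J' k s * h - Q s * h) \<le> e * norm h"
    proof eventually_elim
      case (elim k)
      then show ?case by (auto simp: abs_mult simp flip: left_diff_distrib intro!: mult_right_mono)
    qed
  qed auto
  then obtain g where g: "\<And>s. s \<in> ?S \<Longrightarrow> (\<lambda>k. J k s) \<longlonglongrightarrow> g s"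
    "\<And>s. s \<in> ?S \<Longrightarrow> (g has_derivative (\<lambda>h. Q s * h)) (at s within ?S)" by blast
  have geq: "g s = (\<integral>y. w (s, y) * fst (gu (s, y)) \<partial>borel_on W)" if "s \<in> ?S" for s
    using LIMSEQ_unique[OF g(1)[OF that] lim] .
  have "(g has_real_derivative Q s0) (at s0)"
    using g(2)[of s0] at_within_open[of s0 ?S] by (simp add: has_field_derivative_def)
  then show "((\<lambda>s. \<integral>y. w (s, y) * fst (gu (s, y)) \<partial>borel_on W) has_real_derivative
           (\<integral>y. gw (s0, y) \<bullet> gu (s0, y) \<partial>borel_on W)) (at s0)"
    unfolding Q_def by (rule has_field_derivative_transform_within_open[where S="?S"]) (use geq in auto)
qed

end

section \<open>A Liouville theorem for Neumann harmonic functions of linear growth\<close>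

lemma quadratic_not_le_linear:
  fixes p A B :: real
  assumes "p > 0" "\<And>n::nat. p * (real n * (real n - 1)) \<le> A + B * real n"
  shows False
proof -
  obtain n :: nat where n: "1 + (\<bar>A\<bar> + \<bar>B\<bar>) / p < real n" using reals_Archimedean2 by blast
  then have "(\<bar>A\<bar> + \<bar>B\<bar>) / p < real n - 1" by simp
  then have 1: "\<bar>A\<bar> + \<bar>B\<bar> < p * (real n - 1)" using assms(1) by (simp add: divide_less_eq mult.commute)
  have n1: "1 \<le> real n" using n assms(1) by (smt (verit) divide_nonneg_pos abs_ge_zero)
  have "A + B * real n \<le> \<bar>A\<bar> * real n + \<bar>B\<bar> * real n"
  proof (rule add_mono)
    show "A \<le> \<bar>A\<bar> * real n" using mult_left_mono[OF n1, of "\<bar>A\<bar>"] by simp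
    show "B * real n \<le> \<bar>B\<bar> * real n" by (intro mult_right_mono) auto
  qed
  also have "\<dots> = (\<bar>A\<bar> + \<bar>B\<bar>) * real n" by (simp add: distrib_right)
  also have "\<dots> < p * (real n - 1) * real n" using 1 n1 by (intro mult_strict_right_mono) auto
  also have "\<dots> \<le> A + B * real n" using assms(2)[of n] by (simp add: mult_ac)
  finally show False by simp
qed

text \<open>If p = \<open>e s * q\<close> were positive, the tangent at \<open>s\<close> would give
  F(s + j q) >= j p, so n such terms would sum to at least p n (n - 1) / 2. The same sum telescopes
  to a quantity that is linear in n.\<close>

lemma convex_telescoping_slope_nonpos:
  fixes F e D :: "real \<Rightarrow> real"
  assumes nonneg: "\<And>s. 0 \<le> F s" and tangent: "\<And>s t. F s + e s * (t - s) \<le> F t"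
    and tele: "\<And>s. F s = D (s + q) - D s + \<kappa>" and growth: "\<And>s. \<bar>D s\<bar> \<le> C * (1 + \<bar>s\<bar>)"
  shows "e s * q \<le> 0"
proof (rule ccontr)
  assume "\<not> ?thesis"
  then have p: "e s * q > 0" by simp
  have C: "0 \<le> C" using growth[of 0] abs_ge_zero[of "D 0"] by simp
  have sum1: "(\<Sum>j<n. F (s + real j * q)) = D (s + real n * q) - D s + real n * \<kappa>" for n
  proof (induction n)
    case (Suc n)
    have "F (s + real n * q) = D (s + real (Suc n) * q) - D (s + real n * q) + \<kappa>"
      by (subst tele) (simp add: algebra_simps)
    then show ?case using Suc by (simp add: algebra_simps)
  qed simp
  have sum2: "(e s * q / 2) * (real n * (real n - 1)) \<le> (\<Sum>j<n. F (s + real j * q))" for n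
  proof (induction n)
    case (Suc n)
    have "real n * (e s * q) \<le> F (s + real n * q)"
      using tangent[of s "s + real n * q"] nonneg[of s] by (simp add: algebra_simps)
    then show ?case using Suc by (simp add: algebra_simps)
  qed simp
  have "(e s * q / 2) * (real n * (real n - 1)) \<le> (2 * C * (1 + \<bar>s\<bar>)) + (C * \<bar>q\<bar> + \<kappa>) * real n" for n
  proof -
    have "\<bar>s + real n * q\<bar> \<le> \<bar>s\<bar> + real n * \<bar>q\<bar>" by (metis abs_mult abs_of_nat abs_triangle_ineq)
    then have "C * (1 + \<bar>s + real n * q\<bar>) \<le> C * (1 + (\<bar>s\<bar> + real n * \<bar>q\<bar>))" using C by (intro mult_left_mono) auto
    then have "\<bar>D (s + real n * q)\<bar> \<le> C * (1 + (\<bar>s\<bar> + real n * \<bar>q\<bar>))" using growth order_trans by blast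
    then show ?thesis using sum1[of n] sum2[of n] growth[of s] by (simp add: algebra_simps)
  qed
  from quadratic_not_le_linear[OF _ this] p show False by simp
qed

lemma convex_telescoping_slope_eq_0:
  fixes F e D :: "real \<Rightarrow> real"
  assumes nonneg: "\<And>s. 0 \<le> F s" and tangent: "\<And>s t. F s + e s * (t - s) \<le> F t"
    and tele: "\<And>s. F s = D (s + q) - D s + \<kappa>" and growth: "\<And>s. \<bar>D s\<bar> \<le> C * (1 + \<bar>s\<bar>)" and q: "q > 0"
  shows "e s = 0"
proof -
  have "e s * q \<le> 0" by (rule convex_telescoping_slope_nonpos[OF assms(1-4)])
  moreover have "e ((s + q) - q) * - q \<le> 0"
  \<comment> \<open>The telescoping identity read backwards: with step -q, F shifted by q and D
    replaced by -D it has the same form, which yields the opposite sign of the slope.\<close>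
  proof (rule convex_telescoping_slope_nonpos[where F="\<lambda>s. F (s - q)" and e="\<lambda>s. e (s - q)" and s="s + q" and q="- q" and D="\<lambda>s. - D s" and \<kappa>=\<kappa> and C=C])
    show "F (r - q) = - D (r + - q) - - D r + \<kappa>" for r using tele[of "r - q"] by simp
    show "F (r - q) + e (r - q) * (t - r) \<le> F (t - q)" for r t using tangent[of "r - q" "t - q"] by simp
  qed (use nonneg growth in auto)
  ultimately show ?thesis using q by (simp add: mult_le_0_iff zero_le_mult_iff)
qed

section \<open>Differences, translations and reflections\<close>

lemma C1_up_to_boundaryD:
  assumes "C1_up_to_boundary W w gw"
  shows "y \<in> W \<Longrightarrow> (w has_derivative (\<lambda>h. gw (s, y) \<bullet> h)) (at (s, y))"
    "continuous_on (UNIV \<times> closure W) w" "continuous_on (UNIV \<times> closure W) gw"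
    "continuous_on (closure W) (\<lambda>y. w (s, y))" "continuous_on (closure W) (\<lambda>y. gw (s, y))"
    "continuous_on W (\<lambda>y. w (s, y))" "continuous_on W (\<lambda>y. gw (s, y))"
proof -
  show c: "continuous_on (UNIV \<times> closure W) w" "continuous_on (UNIV \<times> closure W) gw"
    and "y \<in> W \<Longrightarrow> (w has_derivative (\<lambda>h. gw (s, y) \<bullet> h)) (at (s, y))"
    using assms by (auto simp: C1_up_to_boundary_def)
  show c': "continuous_on (closure W) (\<lambda>y. w (s, y))" "continuous_on (closure W) (\<lambda>y. gw (s, y))"
    by (rule continuous_on_section[OF c(1)], rule continuous_on_section[OF c(2)])
  show "continuous_on W (\<lambda>y. w (s, y))" "continuous_on W (\<lambda>y. gw (s, y))"
    by (rule continuous_on_subset[OF c'(1) closure_subset], rule continuous_on_subset[OF c'(2) closure_subset])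
qed

lemma C1_up_to_boundary_const: "C1_up_to_boundary W (\<lambda>x. c) (\<lambda>x. 0)"
  by (simp add: C1_up_to_boundary_def)

lemma C1_up_to_boundary_diff:
  assumes "C1_up_to_boundary W v gv" "C1_up_to_boundary W w gw"
  shows "C1_up_to_boundary W (\<lambda>x. v x - w x) (\<lambda>x. gv x - gw x)"
  unfolding C1_up_to_boundary_def
proof (intro conjI ballI)
  note v = C1_up_to_boundaryD[OF assms(1)] and w = C1_up_to_boundaryD[OF assms(2)]
  show "continuous_on (UNIV \<times> closure W) (\<lambda>x. v x - w x)" "continuous_on (UNIV \<times> closure W) (\<lambda>x. gv x - gw x)"
    by (intro continuous_intros v w)+
  fix x :: "real \<times> 'a" assume "x \<in> UNIV \<times> W"
  then have "snd x \<in> W" by auto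
  from has_derivative_diff[OF v(1)[OF this, of "fst x"] w(1)[OF this, of "fst x"]]
  show "((\<lambda>x. v x - w x) has_derivative (\<lambda>h. (gv x - gw x) \<bullet> h)) (at x)"
    by (simp add: inner_diff_left)
qed

text \<open>Covers both changes of the axial variable that are used: translations with
  \<open>\<sigma>\<close> equal to 1, and the reflection s to m - s, whose test function runs along
  an antidiagonal.\<close>

lemma C1_up_to_boundary_affine:
  assumes "C1_up_to_boundary W w gw"
  shows "C1_up_to_boundary W (\<lambda>x. w (c + \<sigma> * fst x, snd x))
    (\<lambda>x. (\<sigma> * fst (gw (c + \<sigma> * fst x, snd x)), snd (gw (c + \<sigma> * fst x, snd x))))"
  unfolding C1_up_to_boundary_def
proof (intro conjI ballI)
  note w = C1_up_to_boundaryD[OF assms]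
  fix x :: "real \<times> 'a" assume x: "x \<in> UNIV \<times> W"
  have "((\<lambda>x::real \<times> 'a. (c + \<sigma> * fst x, snd x)) has_derivative (\<lambda>h. (\<sigma> * fst h, snd h))) (at x)"
    by (auto intro!: derivative_eq_intros)
  then have "((\<lambda>x. w (c + \<sigma> * fst x, snd x)) has_derivative
      (\<lambda>h. gw (c + \<sigma> * fst x, snd x) \<bullet> (\<sigma> * fst h, snd h))) (at x)"
    by (rule has_derivative_compose[where g=w]) (use w(1) x in auto)
  then show "((\<lambda>x. w (c + \<sigma> * fst x, snd x)) has_derivative
      (\<lambda>h. (\<sigma> * fst (gw (c + \<sigma> * fst x, snd x)), snd (gw (c + \<sigma> * fst x, snd x))) \<bullet> h)) (at x)"
    by (rule has_derivative_eq_rhs) (auto simp: fun_eq_iff inner_prod_def)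
next
  note w = C1_up_to_boundaryD[OF assms]
  have m: "continuous_on (UNIV \<times> closure W) (\<lambda>x. (c + \<sigma> * fst x, snd x))"
    "(\<lambda>x. (c + \<sigma> * fst x, snd x)) ` (UNIV \<times> closure W) \<subseteq> UNIV \<times> closure W"
    by (auto intro!: continuous_intros)
  show "continuous_on (UNIV \<times> closure W) (\<lambda>x. w (c + \<sigma> * fst x, snd x))"
    by (rule continuous_on_compose2[OF w(2) m])
  have "continuous_on (UNIV \<times> closure W) (\<lambda>x. gw (c + \<sigma> * fst x, snd x))"
    by (rule continuous_on_compose2[OF w(3) m])
  then show "continuous_on (UNIV \<times> closure W)
      (\<lambda>x. (\<sigma> * fst (gw (c + \<sigma> * fst x, snd x)), snd (gw (c + \<sigma> * fst x, snd x))))"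
    by (intro continuous_intros)
qed

lemma C1_up_to_boundary_translate:
  assumes "C1_up_to_boundary W w gw"
  shows "C1_up_to_boundary W (\<lambda>x. w (c + fst x, snd x)) (\<lambda>x. gw (c + fst x, snd x))"
  using C1_up_to_boundary_affine[OF assms, of c 1] by simp

context bounded_open begin

lemma integral_eq_0_imp_eq_0_W:
  fixes f :: "'a \<Rightarrow> real"
  assumes cont: "continuous_on W f" and int: "integrable (borel_on W) f" and nonneg: "\<And>y. y \<in> W \<Longrightarrow> 0 \<le> f y"
    and zero: "integral\<^sup>L (borel_on W) f = 0" and y: "y \<in> W"
  shows "f y = 0"
proof (rule ccontr)
  assume "f y \<noteq> 0"
  then have fy: "f y > 0" using nonneg[OF y] by simp
  have "open {z\<in>W. f y / 2 < f z}"
    using continuous_open_preimage[OF cont opn, of "{f y / 2<..}"] by (simp add: vimage_def Int_def)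
  moreover have "y \<in> {z\<in>W. f y / 2 < f z}" using y fy by simp
  ultimately obtain r where r: "r > 0" "ball y r \<subseteq> {z\<in>W. f y / 2 < f z}"
    using open_contains_ball by blast
  have "0 < f y / 2 * measure lborel (ball y r)" using fy content_ball_pos[OF r(1), of y] by simp
  also have "\<dots> = (\<integral>z. f y / 2 * indicator (ball y r) z \<partial>lborel)" by simp
  also have "\<dots> \<le> (\<integral>z. indicator W z *\<^sub>R f z \<partial>lborel)"
  proof (rule integral_mono)
    show "integrable lborel (\<lambda>z. f y / 2 * indicator (ball y r) z)"
      using emeasure_bounded_finite[OF bounded_ball, of y r] by (intro integrable_mult_right) (simp add: integrable_indicator_iff)
    show "integrable lborel (\<lambda>z. indicator W z *\<^sub>R f z)"
      using int integrable_restrict_space[OF W_sets, of f] by simp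
    show "f y / 2 * indicator (ball y r) z \<le> indicator W z *\<^sub>R f z" for z
      using r nonneg[of z] by (cases "z \<in> ball y r"; cases "z \<in> W") (auto simp: less_imp_le subset_iff)
  qed
  also have "\<dots> = 0" using zero integral_restrict_space[OF W_sets, of f] by simp
  finally show False by simp
qed

lemma weakly_neumann_harmonicD:
  assumes "weakly_neumann_harmonic W u gu"
  shows "C1_up_to_boundary W u gu"
    "C1_up_to_boundary W w gw \<Longrightarrow> ((\<lambda>s. \<integral>y. w (s, y) * fst (gu (s, y)) \<partial>borel_on W) has_real_derivative
           (\<integral>y. gw (s, y) \<bullet> gu (s, y) \<partial>borel_on W)) (at s)"
  using assms unfolding weakly_neumann_harmonic_def by blast+

lemma weakly_neumann_harmonic_translate:
  assumes u: "weakly_neumann_harmonic W u gu"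
  shows "weakly_neumann_harmonic W (\<lambda>x. u (c + fst x, snd x)) (\<lambda>x. gu (c + fst x, snd x))"
  unfolding weakly_neumann_harmonic_def
proof (intro conjI allI impI C1_up_to_boundary_translate weakly_neumann_harmonicD(1)[OF u])
  fix w gw and s :: real assume "C1_up_to_boundary W w gw"
  from weakly_neumann_harmonicD(2)[OF u C1_up_to_boundary_translate[OF this, of "- c"], of "s + c"]
  have "((\<lambda>s. \<integral>y. w (s - c, y) * fst (gu (s, y)) \<partial>borel_on W) has_real_derivative
     (\<integral>y. gw (s, y) \<bullet> gu (s + c, y) \<partial>borel_on W)) (at (s + c))" by simp
  then show "((\<lambda>s. \<integral>y. w (s, y) * fst (gu (c + fst (s, y), snd (s, y))) \<partial>borel_on W) has_real_derivative
     (\<integral>y. gw (s, y) \<bullet> gu (c + fst (s, y), snd (s, y)) \<partial>borel_on W)) (at s)"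
    unfolding DERIV_shift by (simp add: add.commute)
qed

lemma weakly_neumann_harmonic_diff:
  assumes u: "weakly_neumann_harmonic W u gu" and v: "weakly_neumann_harmonic W v gv"
  shows "weakly_neumann_harmonic W (\<lambda>x. u x - v x) (\<lambda>x. gu x - gv x)"
  unfolding weakly_neumann_harmonic_def
proof (intro conjI allI impI C1_up_to_boundary_diff weakly_neumann_harmonicD(1)[OF u] weakly_neumann_harmonicD(1)[OF v])
  fix w gw and s :: real assume w: "C1_up_to_boundary W w gw"
  note c = C1_up_to_boundaryD(4,5)[OF w] C1_up_to_boundaryD(4,5)[OF weakly_neumann_harmonicD(1)[OF u]]
    C1_up_to_boundaryD(4,5)[OF weakly_neumann_harmonicD(1)[OF v]]
  have i: "integrable (borel_on W) (\<lambda>y. w (s, y) * fst (gu (s, y)))" "integrable (borel_on W) (\<lambda>y. w (s, y) * fst (gv (s, y)))"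
    "integrable (borel_on W) (\<lambda>y. gw (s, y) \<bullet> gu (s, y))" "integrable (borel_on W) (\<lambda>y. gw (s, y) \<bullet> gv (s, y))" for s
    by (intro integrable_closure_W continuous_intros c)+
  from DERIV_diff[OF weakly_neumann_harmonicD(2)[OF u w, of s] weakly_neumann_harmonicD(2)[OF v w, of s]]
  show "((\<lambda>s. \<integral>y. w (s, y) * fst (gu (s, y) - gv (s, y)) \<partial>borel_on W) has_real_derivative
     (\<integral>y. gw (s, y) \<bullet> (gu (s, y) - gv (s, y)) \<partial>borel_on W)) (at s)"
    using i by (simp add: inner_diff_right right_diff_distrib)
qed

section \<open>Cross-section products and the energy\<close>

lemma has_real_derivative_integral_mult:
  assumes v: "C1_up_to_boundary W v gv" and w: "C1_up_to_boundary W w gw"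
  shows "((\<lambda>s. \<integral>y. v (s, y) * w (s, y) \<partial>borel_on W) has_real_derivative
     (\<integral>y. v (s, y) * fst (gw (s, y)) + w (s, y) * fst (gv (s, y)) \<partial>borel_on W)) (at s)"
proof -
  have cT: "compact ({s - 1..s + 1} \<times> closure W)" by (intro compact_Times compact_closure_W) auto
  have "continuous_on (UNIV \<times> closure W) (\<lambda>x. v x * fst (gw x) + w x * fst (gv x))"
    by (intro continuous_intros C1_up_to_boundaryD(2,3)[OF v] C1_up_to_boundaryD(2,3)[OF w])
  then have "continuous_on ({s - 1..s + 1} \<times> closure W) (\<lambda>x. v x * fst (gw x) + w x * fst (gv x))"
    by (rule continuous_on_subset) auto
  then obtain C where C: "0 \<le> C" "\<And>x. x \<in> {s - 1..s + 1} \<times> closure W \<Longrightarrow> norm (v x * fst (gw x) + w x * fst (gv x)) \<le> C"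
    using compact_continuous_bound[OF cT] by blast
  show ?thesis
  proof (rule has_real_derivative_integral_W[where C=C])
    fix r y assume y: "y \<in> W"
    have "((\<lambda>r. v (r, y)) has_real_derivative fst (gv (r, y))) (at r)" "((\<lambda>r. w (r, y)) has_real_derivative fst (gw (r, y))) (at r)"
      using y by (auto intro!: has_real_derivative_section C1_up_to_boundaryD(1)[OF v] C1_up_to_boundaryD(1)[OF w])
    from DERIV_mult[OF this]
    show "((\<lambda>r. v (r, y) * w (r, y)) has_real_derivative v (r, y) * fst (gw (r, y)) + w (r, y) * fst (gv (r, y))) (at r)"
      by (simp add: algebra_simps)
    assume r: "\<bar>r - s\<bar> < 1"
    then show "\<bar>v (r, y) * fst (gw (r, y)) + w (r, y) * fst (gv (r, y))\<bar> \<le> C"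
      using C(2)[of "(r, y)"] y closure_subset by (force simp: abs_less_iff)
  next
    show "integrable (borel_on W) (\<lambda>y. v (r, y) * w (r, y))" for r
      by (intro integrable_closure_W continuous_intros C1_up_to_boundaryD(4)[OF v] C1_up_to_boundaryD(4)[OF w])
    show "continuous_on W (\<lambda>y. v (s, y) * fst (gw (s, y)) + w (s, y) * fst (gv (s, y)))"
      by (intro continuous_intros C1_up_to_boundaryD(6,7)[OF v] C1_up_to_boundaryD(6,7)[OF w])
  qed
qed

text \<open>The wave equation in characteristic form: the diagonal derivative of P, which is Q(s,t)
  + Q(t,s), is constant along antidiagonals. The points (s + r, t + r) and (r, s + t + r) lie on the
  same antidiagonal for each r, so P changes equally along both paths.\<close>

lemma integral_product_antidiagonal:
  assumes nh: "weakly_neumann_harmonic W u gu"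
  defines "P \<equiv> (\<lambda>s t. \<integral>y. u (s, y) * u (t, y) \<partial>borel_on W)"
  shows "P (s + r) (t + r) - P s t = P r (s + t + r) - P 0 (s + t)"
proof -
  note u = weakly_neumann_harmonicD(1)[OF nh]
  define Q where "Q s t = (\<integral>y. u (s, y) * fst (gu (t, y)) \<partial>borel_on W)" for s t
  have i: "integrable (borel_on W) (\<lambda>y. u (s, y) * fst (gu (t, y)))" for s t
    by (intro integrable_closure_W continuous_intros C1_up_to_boundaryD[OF u])
  have Pder: "((\<lambda>r. P (s + r) (t + r)) has_real_derivative Q (s + r) (t + r) + Q (t + r) (s + r)) (at r)" for s t r
    using has_real_derivative_integral_mult[OF C1_up_to_boundary_translate[OF u, of s] C1_up_to_boundary_translate[OF u, of t], of r] i
    by (simp add: P_def Q_def)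
  \<comment> \<open>Green's identity with the reflected function as test function gives the
    derivative Z(r) for the first summand. Z is symmetric under r to m - r, so the second summand
    contributes -Z(r).\<close>
  have anti: "Q (m - r) r + Q r (m - r) = Q m 0 + Q 0 m" for m r
  proof -
    define Z where "Z r = (\<integral>y. snd (gu (m - r, y)) \<bullet> snd (gu (r, y)) - fst (gu (m - r, y)) * fst (gu (r, y)) \<partial>borel_on W)" for r
    have Qder: "((\<lambda>r. Q (m - r) r) has_real_derivative Z r) (at r)" for r
      using weakly_neumann_harmonicD(2)[OF nh C1_up_to_boundary_affine[OF u, of m "-1"], of r]
      by (simp add: Q_def Z_def inner_prod_def algebra_simps)
    have Zsym: "Z (m - r) = Z r" for r by (simp add: Z_def inner_commute mult.commute)
    have "((\<lambda>r. Q (m - (m - r)) (m - r)) has_real_derivative Z (m - r) * (-1)) (at r)" for r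
      by (rule DERIV_chain2[OF Qder]) (auto intro!: derivative_eq_intros)
    then have Qder': "((\<lambda>r. Q r (m - r)) has_real_derivative - Z r) (at r)" for r
      by (simp add: Zsym)
    have "((\<lambda>r. Q (m - r) r + Q r (m - r)) has_real_derivative 0) (at r)" for r
      using DERIV_add[OF Qder Qder'] by simp
    then have "\<forall>r. ((\<lambda>r. Q (m - r) r + Q r (m - r)) has_real_derivative 0) (at r)" by blast
    from DERIV_isconst_all[OF this, of r 0] show ?thesis by simp
  qed
  have "((\<lambda>r. P (s + r) (t + r) - P (0 + r) (s + t + r)) has_real_derivative 0) (at r)" for r
  proof -
    let ?m = "s + t + 2 * r"
    have "Q (s + r) (t + r) + Q (t + r) (s + r) = Q (0 + r) (s + t + r) + Q (s + t + r) (0 + r)"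
      using anti[of ?m "t + r"] anti[of ?m r] by (simp add: algebra_simps)
    then show ?thesis using DERIV_diff[OF Pder[of s t r] Pder[of 0 "s + t" r]] by simp
  qed
  then have "\<forall>r. ((\<lambda>r. P (s + r) (t + r) - P (0 + r) (s + t + r)) has_real_derivative 0) (at r)" by blast
  from DERIV_isconst_all[OF this, of r 0] show ?thesis by simp
qed

text \<open>The antidiagonal identity with s = t turns the increment into products in which one
  factor is a fixed slice, at height 0 or q. That slice is bounded, so the L1 growth of the other
  factor is enough; no pointwise growth bound is required.\<close>

lemma energy_increment_linear_growth:
  assumes nh: "weakly_neumann_harmonic W u gu"
    and growth: "\<And>s. (\<integral>y. \<bar>u (s, y)\<bar> \<partial>borel_on W) \<le> C * (1 + \<bar>s\<bar>)"
  shows "\<exists>C'. \<forall>s. \<bar>(\<integral>y. u (s + q, y) * u (s + q, y) \<partial>borel_on W) - (\<integral>y. u (s, y) * u (s, y) \<partial>borel_on W)\<bar> \<le> C' * (1 + \<bar>s\<bar>)"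
proof -
  note u = weakly_neumann_harmonicD(1)[OF nh]
  define P where "P s t = (\<integral>y. u (s, y) * u (t, y) \<partial>borel_on W)" for s t
  have "0 \<le> (\<integral>y. \<bar>u (0, y)\<bar> \<partial>borel_on W)" by (rule integral_nonneg_AE) simp
  also have "\<dots> \<le> C" using growth[of 0] by simp
  finally have C: "0 \<le> C" .
  have bd: "\<exists>B\<ge>0. \<forall>t. \<bar>P h t\<bar> \<le> B * (C * (1 + \<bar>t\<bar>))" for h
  proof -
    obtain B where B: "0 \<le> B" "\<And>y. y \<in> closure W \<Longrightarrow> norm (u (h, y)) \<le> B"
      using compact_continuous_bound[OF compact_closure_W C1_up_to_boundaryD(4)[OF u]] by blast
    have "\<bar>P h t\<bar> \<le> B * (C * (1 + \<bar>t\<bar>))" for t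
    proof -
      have i: "integrable (borel_on W) (\<lambda>y. \<bar>u (h, y) * u (t, y)\<bar>)" "integrable (borel_on W) (\<lambda>y. B * \<bar>u (t, y)\<bar>)"
        by (intro integrable_closure_W continuous_intros C1_up_to_boundaryD(4)[OF u])+
      have "\<bar>P h t\<bar> \<le> (\<integral>y. \<bar>u (h, y) * u (t, y)\<bar> \<partial>borel_on W)" unfolding P_def by (rule integral_abs_bound)
      also have "\<dots> \<le> (\<integral>y. B * \<bar>u (t, y)\<bar> \<partial>borel_on W)"
        by (rule integral_mono_W[OF i]) (use B closure_subset in \<open>auto simp: abs_mult intro!: mult_right_mono\<close>)
      also have "\<dots> = B * (\<integral>y. \<bar>u (t, y)\<bar> \<partial>borel_on W)" by simp
      also have "\<dots> \<le> B * (C * (1 + \<bar>t\<bar>))" using B(1) growth by (intro mult_left_mono)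
      finally show ?thesis .
    qed
    then show ?thesis using B(1) by blast
  qed
  obtain B0 where B0: "B0 \<ge> 0" "\<And>t. \<bar>P 0 t\<bar> \<le> B0 * (C * (1 + \<bar>t\<bar>))" using bd[of 0] by blast
  obtain B1 where B1: "B1 \<ge> 0" "\<And>t. \<bar>P q t\<bar> \<le> B1 * (C * (1 + \<bar>t\<bar>))" using bd[of q] by blast
  have "\<bar>P (s + q) (s + q) - P s s\<bar> \<le> (B1 * C * (2 + \<bar>q\<bar>) + B0 * C * 2) * (1 + \<bar>s\<bar>)" for s
  proof -
    have "P (s + q) (s + q) - P s s = P q (s + s + q) - P 0 (s + s)"
      unfolding P_def by (rule integral_product_antidiagonal[OF nh])
    then have "\<bar>P (s + q) (s + q) - P s s\<bar> \<le> B1 * (C * (1 + \<bar>s + s + q\<bar>)) + B0 * (C * (1 + \<bar>s + s\<bar>))"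
      using B0(2)[of "s + s"] B1(2)[of "s + s + q"] by linarith
    also have "\<dots> \<le> B1 * (C * ((2 + \<bar>q\<bar>) * (1 + \<bar>s\<bar>))) + B0 * (C * (2 * (1 + \<bar>s\<bar>)))"
    proof (intro add_mono mult_left_mono B0 B1 C)
      have "0 \<le> \<bar>q\<bar> * \<bar>s\<bar>" by simp
      then show "1 + \<bar>s + s + q\<bar> \<le> (2 + \<bar>q\<bar>) * (1 + \<bar>s\<bar>)" unfolding distrib_left distrib_right by linarith
    qed auto
    finally show ?thesis by (simp add: algebra_simps)
  qed
  then show ?thesis unfolding P_def by blast
qed

lemma gradient_periodic:
  assumes nh: "weakly_neumann_harmonic W u gu"
    and growth: "\<And>s. (\<integral>y. \<bar>u (s, y)\<bar> \<partial>borel_on W) \<le> C * (1 + \<bar>s\<bar>)"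
    and q: "q > 0" and y: "y \<in> W"
  shows "gu (s + 2 * q, y) = gu (s, y)"
proof -
  note u = weakly_neumann_harmonicD(1)[OF nh]
  define w where "w x = u (2 * q + fst x, snd x) - u x" for x
  define gw where "gw x = gu (2 * q + fst x, snd x) - gu x" for x
  have nw: "weakly_neumann_harmonic W w gw"
    unfolding w_def[abs_def] gw_def[abs_def]
    by (intro weakly_neumann_harmonic_diff weakly_neumann_harmonic_translate nh)
  note w = weakly_neumann_harmonicD(1)[OF nw]
  define P where "P s t = (\<integral>y. u (s, y) * u (t, y) \<partial>borel_on W)" for s t
  define F where "F s = (\<integral>y. w (s, y) * w (s, y) \<partial>borel_on W)" for s
  define e where "e s = 2 * (\<integral>y. w (s, y) * fst (gw (s, y)) \<partial>borel_on W)" for s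
  define e' where "e' s = 2 * (\<integral>y. gw (s, y) \<bullet> gw (s, y) \<partial>borel_on W)" for s
  have Fder: "(F has_real_derivative e s) (at s)" for s
    using has_real_derivative_integral_mult[OF w w, of s] by (simp add: F_def[abs_def] e_def)
  have eder: "(e has_real_derivative e' s) (at s)" for s
    unfolding e_def[abs_def] e'_def by (rule DERIV_cmult[OF weakly_neumann_harmonicD(2)[OF nw w]])
  have e'0: "0 \<le> e' s" for s unfolding e'_def by (intro mult_nonneg_nonneg integral_nonneg_AE) auto
  have mono: "e s \<le> e t" if "s \<le> t" for s t
    using DERIV_nonneg_imp_nondecreasing[OF that] eder e'0 by blast
  have tangent: "F s + e s * (t - s) \<le> F t" for s t
  proof (cases s t rule: linorder_cases)
    case less
    then obtain z where z: "s < z" "z < t" "F t - F s = (t - s) * e z" using MVT2[OF less Fder] by blast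
    have "(t - s) * e s \<le> (t - s) * e z" using z mono by (intro mult_left_mono) auto
    moreover have "e s * (t - s) = (t - s) * e s" by (rule mult.commute)
    ultimately show ?thesis using z(3) by linarith
  next
    case greater
    then obtain z where z: "t < z" "z < s" "F s - F t = (s - t) * e z" using MVT2[OF greater Fder] by blast
    have "(s - t) * e z \<le> (s - t) * e s" using z mono by (intro mult_left_mono) auto
    moreover have "e s * (t - s) = - ((s - t) * e s)" by (simp add: algebra_simps)
    ultimately show ?thesis using z(3) by linarith
  qed simp
  define D where "D s = P (s + q) (s + q) - P s s" for s
  obtain C' where C': "\<And>s. \<bar>D s\<bar> \<le> C' * (1 + \<bar>s\<bar>)"
    using energy_increment_linear_growth[OF nh growth, of q] unfolding D_def P_def by blast
  have tele: "F s = D (s + q) - D s + (2 * P 0 0 - 2 * P q (- q))" for s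
  proof -
    have i: "integrable (borel_on W) (\<lambda>y. u (s, y) * u (t, y))" for s t
      by (intro integrable_closure_W continuous_intros C1_up_to_boundaryD(4)[OF u])
    have "F s = (\<integral>y. u (s + 2 * q, y) * u (s + 2 * q, y) + u (s, y) * u (s, y) - 2 * (u (s + 2 * q, y) * u (s, y)) \<partial>borel_on W)"
      unfolding F_def w_def by (simp add: algebra_simps)
    also have "\<dots> = P (s + 2 * q) (s + 2 * q) + P s s - 2 * P (s + 2 * q) s"
      unfolding P_def using i by simp
    finally have "F s = P (s + 2 * q) (s + 2 * q) + P s s - 2 * P (s + 2 * q) s" .
    \<comment> \<open>The heights s + 2q and s are symmetric about s + q, so up to a constant the
      mixed product is the energy at s + q, and F becomes a second difference of the energy. This is
      why the shift in \<open>w\<close> is 2q.\<close>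
    moreover have "P (q + (s + q)) (- q + (s + q)) - P q (- q) = P (s + q) (q + - q + (s + q)) - P 0 (q + - q)"
      unfolding P_def by (rule integral_product_antidiagonal[OF nh])
    ultimately show ?thesis by (simp add: D_def algebra_simps)
  qed
  have "0 \<le> F s" for s unfolding F_def by (intro integral_nonneg_AE) auto
  then have "e s = 0" for s
    by (rule convex_telescoping_slope_eq_0[OF _ tangent tele C' q])
  then have "(e has_real_derivative 0) (at s)" by (simp add: ext[of e "\<lambda>_. 0"])
  then have "e' s = 0" using DERIV_unique eder by blast
  then have "gw (s, y) \<bullet> gw (s, y) = 0" unfolding e'_def
    by (intro integral_eq_0_imp_eq_0_W[where f="\<lambda>y. gw (s, y) \<bullet> gw (s, y)"] y integrable_closure_W continuous_intros
        C1_up_to_boundaryD[OF w]) auto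
  then show ?thesis by (simp add: gw_def add.commute)
qed

text \<open>All periods being available, the gradient does not depend on s and its axial component
  is a constant a. The integral of u times this component then has derivative equal to the integral
  of a^2 by the explicit formula, but to that of |gu|^2 by Green's identity with test function u;
  hence the cross-section gradient vanishes.\<close>

lemma weakly_neumann_harmonic_affine:
  assumes nh: "weakly_neumann_harmonic W u gu" and conn: "connected W"
    and growth: "\<And>s. (\<integral>y. \<bar>u (s, y)\<bar> \<partial>borel_on W) \<le> C * (1 + \<bar>s\<bar>)"
  shows "\<exists>a b. \<forall>s. \<forall>y\<in>W. u (s, y) = a * s + b \<and> gu (s, y) = (a, 0)"
proof -
  note u = weakly_neumann_harmonicD(1)[OF nh]
  have g0: "gu (s, y) = gu (0, y)" if y: "y \<in> W" for s y
  proof (cases s "0 :: real" rule: linorder_cases)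
    case less
    then show ?thesis using gradient_periodic[OF nh growth _ y, of "- s / 2" s] by simp
  next
    case greater
    then show ?thesis using gradient_periodic[OF nh growth _ y, of "s / 2" 0] by simp
  qed simp
  have lin: "u (s, y) = u (0, y) + s * fst (gu (0, y))" if y: "y \<in> W" for s y
  proof -
    have "((\<lambda>r. u (r, y) - r * fst (gu (0, y))) has_real_derivative fst (gu (r, y)) - 1 * fst (gu (0, y))) (at r)" for r
      by (intro DERIV_diff has_real_derivative_section C1_up_to_boundaryD(1)[OF u y] DERIV_cmult_right DERIV_ident)
    then have "((\<lambda>r. u (r, y) - r * fst (gu (0, y))) has_real_derivative 0) (at r)" for r
      using g0[OF y, of r] by (metis diff_self mult_1)
    then have "\<forall>r. ((\<lambda>r. u (r, y) - r * fst (gu (0, y))) has_real_derivative 0) (at r)" by blast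
    from DERIV_isconst_all[OF this, of s 0] show ?thesis by simp
  qed
  have const: "f y = f z" if "\<And>y. y \<in> W \<Longrightarrow> (f has_derivative (\<lambda>h. 0)) (at y)" "y \<in> W" "z \<in> W" for f :: "'a \<Rightarrow> real" and y z
    by (rule has_derivative_zero_unique_connected[OF opn conn that])
  have sec: "((\<lambda>z. u (s, z)) has_derivative (\<lambda>h. snd (gu (0, y)) \<bullet> h)) (at y)" if "y \<in> W" for s y
    using partial_derivatives_section(2)[OF C1_up_to_boundaryD(1)[OF u that, of s]] g0[OF that, of s]
    by (simp add: inner_prod_def)
  have fst_const: "fst (gu (0, y)) = fst (gu (0, z))" if "y \<in> W" "z \<in> W" for y z
  proof -
    \<comment> \<open>This difference is the axial component of the gradient, and it is constant
      because both slices have the same cross-section gradient. No mixed second derivatives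
      enter.\<close>
    have "u (1, y) - u (0, y) = u (1, z) - u (0, z)"
    proof (rule const[OF _ that])
      fix y assume "y \<in> W"
      from has_derivative_diff[OF sec[OF this, of 1] sec[OF this, of 0]]
      show "((\<lambda>y. u (1, y) - u (0, y)) has_derivative (\<lambda>h. 0)) (at y)" by simp
    qed
    then show ?thesis using lin[of _ 1] that by simp
  qed
  show ?thesis
  proof (cases "W = {}")
    case False
    then obtain y0 where y0: "y0 \<in> W" by blast
    define a where "a = fst (gu (0, y0))"
    have fa: "fst (gu (s, y)) = a" if "y \<in> W" for s y using g0[OF that, of s] fst_const[OF that y0] by (simp add: a_def)
    have iu: "integrable (borel_on W) (\<lambda>y. u (0, y))" and ic: "\<And>c::real. integrable (borel_on W) (\<lambda>y. c)"
      by (intro integrable_closure_W continuous_intros C1_up_to_boundaryD(4)[OF u])+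
    have "(\<integral>y. u (s, y) * fst (gu (s, y)) \<partial>borel_on W) = (\<integral>y. a * u (0, y) \<partial>borel_on W) + s * (\<integral>y. a * a \<partial>borel_on W)" for s
    proof -
      have "(\<integral>y. u (s, y) * fst (gu (s, y)) \<partial>borel_on W) = (\<integral>y. a * u (0, y) + s * (a * a) \<partial>borel_on W)"
      proof (rule Bochner_Integration.integral_cong[OF refl])
        fix y assume "y \<in> space (borel_on W)"
        then have y: "y \<in> W" by (simp add: space_W)
        show "u (s, y) * fst (gu (s, y)) = a * u (0, y) + s * (a * a)"
          unfolding lin[OF y, of s] fa[OF y] by (simp add: algebra_simps)
      qed
      also have "\<dots> = (\<integral>y. a * u (0, y) \<partial>borel_on W) + s * (\<integral>y. a * a \<partial>borel_on W)"
        using iu ic by (subst Bochner_Integration.integral_add) auto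
      finally show ?thesis .
    qed
    then have "((\<lambda>s. \<integral>y. u (s, y) * fst (gu (s, y)) \<partial>borel_on W) has_real_derivative (\<integral>y. a * a \<partial>borel_on W)) (at 0)"
      by (auto intro!: derivative_eq_intros)
    then have eq: "(\<integral>y. gu (0, y) \<bullet> gu (0, y) \<partial>borel_on W) = (\<integral>y. a * a \<partial>borel_on W)"
      using DERIV_unique weakly_neumann_harmonicD(2)[OF nh u] by blast
    have ig: "integrable (borel_on W) (\<lambda>y. gu (0, y) \<bullet> gu (0, y))" "integrable (borel_on W) (\<lambda>y. snd (gu (0, y)) \<bullet> snd (gu (0, y)))"
      by (intro integrable_closure_W continuous_intros C1_up_to_boundaryD[OF u])+
    have "(\<integral>y. snd (gu (0, y)) \<bullet> snd (gu (0, y)) \<partial>borel_on W) = (\<integral>y. gu (0, y) \<bullet> gu (0, y) - a * a \<partial>borel_on W)"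
      using fa by (intro Bochner_Integration.integral_cong) (auto simp: space_W inner_prod_def)
    also have "\<dots> = 0" using ig ic eq by simp
    finally have z: "(\<integral>y. snd (gu (0, y)) \<bullet> snd (gu (0, y)) \<partial>borel_on W) = 0" .
    have "snd (gu (0, y)) \<bullet> snd (gu (0, y)) = 0" if "y \<in> W" for y
      by (rule integral_eq_0_imp_eq_0_W[OF _ ig(2) _ z that])
         (intro continuous_intros C1_up_to_boundaryD[OF u], simp)
    then have sg: "snd (gu (0, y)) = 0" if "y \<in> W" for y using that by simp
    have ub: "u (0, y) = u (0, y0)" if "y \<in> W" for y
    proof (rule const[OF _ that y0])
      show "((\<lambda>y. u (0, y)) has_derivative (\<lambda>h. 0)) (at y)" if "y \<in> W" for y
        using sec[OF that, of 0] sg[OF that] by simp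
    qed
    have "u (s, y) = a * s + u (0, y0) \<and> gu (s, y) = (a, 0)" if "y \<in> W" for s y
      using lin[OF that, of s] ub[OF that] fa[OF that, of 0] fa[OF that, of s] sg[OF that] g0[OF that, of s]
      by (simp add: prod_eq_iff)
    then show ?thesis by blast
  qed simp
qed

text \<open>The constant test function 1 shows that the flux through a cross-section is constant, so
  the integral of u is affine in s. The sign \<open>\<tau>\<close> may change with s but not within
  a slice, so integrating the bound over a slice controls the L1 norm by that affine
  function.\<close>

lemma one_sided_bound_imp_linear_growth:
  assumes nh: "weakly_neumann_harmonic W u gu"
    and bound: "\<And>s. \<exists>\<tau>. (\<tau> = 1 \<or> \<tau> = -1) \<and> (\<forall>y\<in>W. \<bar>u (s, y)\<bar> \<le> \<tau> * u (s, y) + M)"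
  shows "\<exists>C. \<forall>s. (\<integral>y. \<bar>u (s, y)\<bar> \<partial>borel_on W) \<le> C * (1 + \<bar>s\<bar>)"
proof -
  note u = weakly_neumann_harmonicD(1)[OF nh]
  define A where "A s = (\<integral>y. u (s, y) \<partial>borel_on W)" for s
  define B where "B s = (\<integral>y. fst (gu (s, y)) \<partial>borel_on W)" for s
  have one: "C1_up_to_boundary W (\<lambda>x. 1) (\<lambda>x. 0)" by (rule C1_up_to_boundary_const)
  have Ader: "(A has_real_derivative B s) (at s)" for s
    using has_real_derivative_integral_mult[OF u one, of s] by (simp add: A_def[abs_def] B_def)
  have "(B has_real_derivative 0) (at s)" for s
    using weakly_neumann_harmonicD(2)[OF nh one, of s] by (simp add: B_def[abs_def])
  then have "\<forall>s. (B has_real_derivative 0) (at s)" by blast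
  then have B: "B s = B 0" for s by (rule DERIV_isconst_all)
  have "((\<lambda>s. A s - s * B 0) has_real_derivative B s - 1 * B 0) (at s)" for s
    by (intro DERIV_diff Ader DERIV_cmult_right DERIV_ident)
  then have "((\<lambda>s. A s - s * B 0) has_real_derivative 0) (at s)" for s
    using B[of s] by (metis diff_self mult_1)
  then have "\<forall>s. ((\<lambda>s. A s - s * B 0) has_real_derivative 0) (at s)" by blast
  then have A: "A s - s * B 0 = A 0 - 0 * B 0" for s by (rule DERIV_isconst_all)
  define m where "m = (\<integral>y. M \<partial>borel_on W)"
  have "(\<integral>y. \<bar>u (s, y)\<bar> \<partial>borel_on W) \<le> (\<bar>A 0\<bar> + \<bar>B 0\<bar> + \<bar>m\<bar>) * (1 + \<bar>s\<bar>)" for s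
  proof -
    obtain \<tau> where \<tau>: "\<tau> = 1 \<or> \<tau> = -1" "\<And>y. y \<in> W \<Longrightarrow> \<bar>u (s, y)\<bar> \<le> \<tau> * u (s, y) + M" using bound by blast
    have i: "integrable (borel_on W) (\<lambda>y. \<bar>u (s, y)\<bar>)" "integrable (borel_on W) (\<lambda>y. \<tau> * u (s, y) + M)"
      "integrable (borel_on W) (\<lambda>y. \<tau> * u (s, y))" "integrable (borel_on W) (\<lambda>y. M)"
      by (intro integrable_closure_W continuous_intros C1_up_to_boundaryD(4)[OF u])+
    have "(\<integral>y. \<bar>u (s, y)\<bar> \<partial>borel_on W) \<le> (\<integral>y. \<tau> * u (s, y) + M \<partial>borel_on W)"
      by (rule integral_mono_W[OF i(1,2) \<tau>(2)])
    also have "\<dots> = \<tau> * A s + m" unfolding A_def m_def using i(3,4) by (subst Bochner_Integration.integral_add) auto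
    also have "\<dots> \<le> \<bar>A s\<bar> + \<bar>m\<bar>" using \<tau>(1) by auto
    also have "\<dots> \<le> \<bar>A 0\<bar> + \<bar>s\<bar> * \<bar>B 0\<bar> + \<bar>m\<bar>"
      using A[of s] abs_triangle_ineq[of "A 0" "s * B 0"] by (simp add: abs_mult)
    also have "\<dots> \<le> (\<bar>A 0\<bar> + \<bar>B 0\<bar> + \<bar>m\<bar>) * (1 + \<bar>s\<bar>)"
      using mult_nonneg_nonneg[of "\<bar>A 0\<bar>" "\<bar>s\<bar>"] mult_nonneg_nonneg[of "\<bar>m\<bar>" "\<bar>s\<bar>"] by (simp add: algebra_simps)
    finally show ?thesis .
  qed
  then show ?thesis by blast
qed

end

text \<open>The orbit lemma is applied to \<open>\<psi>\<close> and to its negative. They cannot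
  choose the same end, since both would tend to minus infinity there. So one half of the cylinder
  carries an upper bound and the other a lower bound, and every height s lies in one of
  them.\<close>

lemma no_critical_points_imp_one_sided_bounds:
  fixes W :: "'a::euclidean_space set" and \<psi> :: "real \<times> 'a \<Rightarrow> real"
  assumes W: "C1_domain W" "bounded W" "connected W" "W \<noteq> {}"
    and u: "C1_up_to_boundary W \<psi> G"
    and neumann: "\<And>x nu. outward_unit_normal (UNIV \<times> W) x nu \<Longrightarrow> G x \<bullet> nu = 0"
    and c: "c > 0" "\<And>x. x \<in> UNIV \<times> closure W \<Longrightarrow> c \<le> norm (G x)"
  shows "\<exists>M. \<forall>s. \<exists>\<tau>. (\<tau> = 1 \<or> \<tau> = -1) \<and> (\<forall>y\<in>W. \<bar>\<psi> (s, y)\<bar> \<le> \<tau> * \<psi> (s, y) + M)"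
proof -
  let ?S = "(UNIV :: real set) \<times> closure W"
  have cl: "closure ((UNIV :: real set) \<times> W) = ?S" by (simp add: closure_Times)
  have ps: "continuous_on ?S \<psi>" "continuous_on ?S G" "\<And>x. x \<in> UNIV \<times> W \<Longrightarrow> (\<psi> has_derivative (\<lambda>h. G x \<bullet> h)) (at x)"
    using u by (auto simp: C1_up_to_boundary_def)
  have K: "compact (closure W)" "connected (closure W)" using W by (auto intro: connected_imp_connected_closure)
  have half: "\<exists>M. (\<forall>x\<in>?S. fst x \<le> 0 \<longrightarrow> f x \<le> M + c / 2 * fst x) \<or> (\<forall>x\<in>?S. 0 \<le> fst x \<longrightarrow> f x \<le> M - c / 2 * fst x)"
    if f: "continuous_on ?S f" "continuous_on ?S g" "\<And>x. x \<in> UNIV \<times> W \<Longrightarrow> (f has_derivative (\<lambda>h. g x \<bullet> h)) (at x)"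
      "\<And>x nu. outward_unit_normal (UNIV \<times> W) x nu \<Longrightarrow> g x \<bullet> nu = 0" "\<And>x. x \<in> ?S \<Longrightarrow> c \<le> norm (g x)" for f g
  proof -
    show ?thesis
    proof (rule ascending_step_map[of "UNIV \<times> W" f g c, unfolded cl, OF C1_domain_UNIV_Times[OF W(1)] f(1,3,2,4) c(1) f(5)])
      fix \<Phi>
      assume \<Phi>: "\<And>x. x \<in> ?S \<Longrightarrow> \<Phi> x \<in> ?S" "continuous_on ?S \<Phi>"
        "\<And>x. x \<in> ?S \<Longrightarrow> f x + c / 2 * dist x (\<Phi> x) \<le> f (\<Phi> x)"
        "\<And>x. x \<in> ?S \<Longrightarrow> 0 < dist x (\<Phi> x)" "\<And>x. x \<in> ?S \<Longrightarrow> dist x (\<Phi> x) \<le> 1"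
      show ?thesis
        by (rule ascending_orbits_one_sided_bound[OF K refl \<Phi>(1,2) f(1) _ \<Phi>(3,4,5)]) (use c in auto)
    qed
  qed
  obtain M1 where M1: "(\<forall>x\<in>?S. fst x \<le> 0 \<longrightarrow> \<psi> x \<le> M1 + c / 2 * fst x) \<or> (\<forall>x\<in>?S. 0 \<le> fst x \<longrightarrow> \<psi> x \<le> M1 - c / 2 * fst x)"
    using half[OF ps neumann c(2)] by blast
  have "\<exists>M. (\<forall>x\<in>?S. fst x \<le> 0 \<longrightarrow> - \<psi> x \<le> M + c / 2 * fst x) \<or> (\<forall>x\<in>?S. 0 \<le> fst x \<longrightarrow> - \<psi> x \<le> M - c / 2 * fst x)"
  proof (rule half[of "\<lambda>x. - \<psi> x" "\<lambda>x. - G x"])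
    show "((\<lambda>x. - \<psi> x) has_derivative (\<lambda>h. - G x \<bullet> h)) (at x)" if "x \<in> UNIV \<times> W" for x
      using has_derivative_minus[OF ps(3)[OF that]] by simp
  qed (use ps neumann c in \<open>auto intro!: continuous_intros\<close>)
  then obtain M2 where M2: "(\<forall>x\<in>?S. fst x \<le> 0 \<longrightarrow> - \<psi> x \<le> M2 + c / 2 * fst x) \<or> (\<forall>x\<in>?S. 0 \<le> fst x \<longrightarrow> - \<psi> x \<le> M2 - c / 2 * fst x)"
    by blast
  \<comment> \<open>So far out that the two upper bounds, for \<open>\<psi>\<close> and for its
    negative, would have a negative sum.\<close>
  define t where "t = 2 * (\<bar>M1\<bar> + \<bar>M2\<bar> + 1) / c"
  have t: "t > 0" "c / 2 * t = \<bar>M1\<bar> + \<bar>M2\<bar> + 1" using c by (auto simp: t_def)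
  obtain y0 where y0: "y0 \<in> closure W" using W(4) closure_subset by blast
  have not_both_left: "\<not> ((\<forall>x\<in>?S. fst x \<le> 0 \<longrightarrow> \<psi> x \<le> M1 + c / 2 * fst x) \<and> (\<forall>x\<in>?S. fst x \<le> 0 \<longrightarrow> - \<psi> x \<le> M2 + c / 2 * fst x))"
  proof
    assume *: "(\<forall>x\<in>?S. fst x \<le> 0 \<longrightarrow> \<psi> x \<le> M1 + c / 2 * fst x) \<and> (\<forall>x\<in>?S. fst x \<le> 0 \<longrightarrow> - \<psi> x \<le> M2 + c / 2 * fst x)"
    have "\<psi> (- t, y0) \<le> M1 + c / 2 * - t" "- \<psi> (- t, y0) \<le> M2 + c / 2 * - t"
      using *[THEN conjunct1, rule_format, of "(- t, y0)"] *[THEN conjunct2, rule_format, of "(- t, y0)"] y0 t(1) by auto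
    then show False using t(2) unfolding mult_minus_right by linarith
  qed
  have not_both_right: "\<not> ((\<forall>x\<in>?S. 0 \<le> fst x \<longrightarrow> \<psi> x \<le> M1 - c / 2 * fst x) \<and> (\<forall>x\<in>?S. 0 \<le> fst x \<longrightarrow> - \<psi> x \<le> M2 - c / 2 * fst x))"
  proof
    assume *: "(\<forall>x\<in>?S. 0 \<le> fst x \<longrightarrow> \<psi> x \<le> M1 - c / 2 * fst x) \<and> (\<forall>x\<in>?S. 0 \<le> fst x \<longrightarrow> - \<psi> x \<le> M2 - c / 2 * fst x)"
    have "\<psi> (t, y0) \<le> M1 - c / 2 * t" "- \<psi> (t, y0) \<le> M2 - c / 2 * t"
      using *[THEN conjunct1, rule_format, of "(t, y0)"] *[THEN conjunct2, rule_format, of "(t, y0)"] y0 t(1) by auto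
    then show False using t(2) unfolding mult_minus_right by linarith
  qed
  \<comment> \<open>If a number x is at most K with K >= 0, then |x| <= -x + 2 K; hence the factor
    2.\<close>
  define M where "M = 2 * (\<bar>M1\<bar> + \<bar>M2\<bar>)"
  have up: "\<bar>\<psi> x\<bar> \<le> -1 * \<psi> x + M" if "\<psi> x \<le> \<bar>M1\<bar>" for x using that by (auto simp: M_def abs_if)
  have down: "\<bar>\<psi> x\<bar> \<le> 1 * \<psi> x + M" if "- \<psi> x \<le> \<bar>M2\<bar>" for x using that by (auto simp: M_def abs_if)
  have neg: "M1 + c / 2 * s \<le> \<bar>M1\<bar>" "M2 + c / 2 * s \<le> \<bar>M2\<bar>" if "s \<le> 0" for s
    using mult_nonneg_nonpos[of "c / 2" s] c that by linarith+
  have pos: "M1 - c / 2 * s \<le> \<bar>M1\<bar>" "M2 - c / 2 * s \<le> \<bar>M2\<bar>" if "0 \<le> s" for s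
    using mult_nonneg_nonneg[of "c / 2" s] c that by linarith+
  have WS: "(s, y) \<in> ?S" if "y \<in> W" for s y using that closure_subset by auto
  have "\<exists>\<tau>. (\<tau> = 1 \<or> \<tau> = -1) \<and> (\<forall>y\<in>W. \<bar>\<psi> (s, y)\<bar> \<le> \<tau> * \<psi> (s, y) + M)" for s
  proof -
    consider "(\<forall>x\<in>?S. fst x \<le> 0 \<longrightarrow> \<psi> x \<le> M1 + c / 2 * fst x) \<and> (\<forall>x\<in>?S. 0 \<le> fst x \<longrightarrow> - \<psi> x \<le> M2 - c / 2 * fst x)"
      | "(\<forall>x\<in>?S. 0 \<le> fst x \<longrightarrow> \<psi> x \<le> M1 - c / 2 * fst x) \<and> (\<forall>x\<in>?S. fst x \<le> 0 \<longrightarrow> - \<psi> x \<le> M2 + c / 2 * fst x)"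
      using M1 M2 not_both_left not_both_right by argo
    then show ?thesis
    proof cases
      case 1
      show ?thesis
      proof (cases "s \<le> 0")
        case True
        have "\<psi> (s, y) \<le> \<bar>M1\<bar>" if "y \<in> W" for y
          using 1[THEN conjunct1, rule_format, OF WS[OF that, of s]] True neg(1)[OF True] by simp
        then show ?thesis using up by blast
      next
        case False
        have "- \<psi> (s, y) \<le> \<bar>M2\<bar>" if "y \<in> W" for y
          using 1[THEN conjunct2, rule_format, OF WS[OF that, of s]] False pos(2)[of s] by simp
        then show ?thesis using down by blast
      qed
    next
      case 2
      show ?thesis
      proof (cases "s \<le> 0")
        case True
        have "- \<psi> (s, y) \<le> \<bar>M2\<bar>" if "y \<in> W" for y
          using 2[THEN conjunct2, rule_format, OF WS[OF that, of s]] True neg(2)[OF True] by simp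
        then show ?thesis using down by blast
      next
        case False
        have "\<psi> (s, y) \<le> \<bar>M1\<bar>" if "y \<in> W" for y
          using 2[THEN conjunct1, rule_format, OF WS[OF that, of s]] False pos(1)[of s] by simp
        then show ?thesis using up by blast
      qed
    qed
  qed
  then show ?thesis by blast
qed

theorem theorem1p3:
  fixes \<omega> :: "(real ^ 'n) set"
    and \<Omega> :: "(real \<times> (real ^ 'n)) set"
    and \<psi> :: "real \<times> (real ^ 'n) \<Rightarrow> real"
    and G :: "real \<times> (real ^ 'n) \<Rightarrow> real \<times> (real ^ 'n)"
    and H :: "real \<times> (real ^ 'n) \<Rightarrow> real \<times> (real ^ 'n) \<Rightarrow> real \<times> (real ^ 'n)"
  assumes omega_open: "open \<omega>"
    and omega_bounded: "bounded \<omega>"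
    and omega_connected: "connected \<omega>"
    and omega_C1: "C1_domain \<omega>"
    and Omega_eq: "\<Omega> = UNIV \<times> \<omega>"
    and psi_cont: "continuous_on (closure \<Omega>) \<psi>"
    and grad: "\<forall>x\<in>\<Omega>. (\<psi> has_derivative (\<lambda>h. G x \<bullet> h)) (at x)"
    and grad_cont: "continuous_on (closure \<Omega>) G"
    and hess: "\<forall>x\<in>\<Omega>. (G has_derivative H x) (at x)"
    and hess_cont: "\<forall>b\<in>Basis. continuous_on \<Omega> (\<lambda>x. H x b)"
    and harmonic: "\<forall>x\<in>\<Omega>. (\<Sum>b\<in>Basis. H x b \<bullet> b) = 0"
    and neumann: "\<forall>x\<in>frontier \<Omega>. \<forall>nu. outward_unit_normal \<Omega> x nu \<longrightarrow> G x \<bullet> nu = 0"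
    and grad_bdd_below: "\<exists>c>0. \<forall>x\<in>closure \<Omega>. c \<le> norm (G x)"
  shows "\<exists>a b. a \<noteq> 0 \<and> (\<forall>x\<in>closure \<Omega>. \<psi> x = a * fst x + b)"
proof (cases "\<omega> = {}")
  case True
  then have "closure \<Omega> = {}" by (simp add: Omega_eq)
  then show ?thesis by (intro exI[of _ 1]) auto
next
  case False
  then obtain y0 where y0: "y0 \<in> \<omega>" by blast
  interpret bounded_open \<omega> by standard (fact omega_open omega_bounded)+
  have cl: "closure \<Omega> = UNIV \<times> closure \<omega>" by (simp add: Omega_eq closure_Times)
  have nrm: "G x \<bullet> nu = 0" if "outward_unit_normal \<Omega> x nu" for x nu
    using neumann that unfolding outward_unit_normal_def by blast
  have u: "C1_up_to_boundary \<omega> \<psi> G"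
    using grad psi_cont grad_cont unfolding C1_up_to_boundary_def cl unfolding Omega_eq by blast
  have nh: "weakly_neumann_harmonic \<omega> \<psi> G"
  proof (rule weakly_neumann_harmonicI[OF omega_C1 u])
    show "tangential \<omega> y (snd (G (s, y)))" for s y
      unfolding tangential_def
    proof (intro allI impI)
      fix nu assume "outward_unit_normal \<omega> y nu"
      then have "outward_unit_normal \<Omega> (s, y) (0, nu)"
        unfolding Omega_eq by (rule outward_unit_normal_UNIV_Times)
      then show "snd (G (s, y)) \<bullet> nu = 0" using nrm by (fastforce simp: inner_prod_def)
    qed
  qed (use hess hess_cont harmonic in \<open>auto simp: Omega_eq\<close>)
  obtain c where c: "c > 0" "\<And>x. x \<in> UNIV \<times> closure \<omega> \<Longrightarrow> c \<le> norm (G x)"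
    using grad_bdd_below cl by auto
  obtain M where "\<And>s. \<exists>\<tau>. (\<tau> = 1 \<or> \<tau> = -1) \<and> (\<forall>y\<in>\<omega>. \<bar>\<psi> (s, y)\<bar> \<le> \<tau> * \<psi> (s, y) + M)"
    using no_critical_points_imp_one_sided_bounds[OF omega_C1 omega_bounded omega_connected False u nrm[unfolded Omega_eq] c]
    by blast
  then obtain C where "\<And>s. (\<integral>y. \<bar>\<psi> (s, y)\<bar> \<partial>borel_on \<omega>) \<le> C * (1 + \<bar>s\<bar>)"
    using one_sided_bound_imp_linear_growth[OF nh] by blast
  then obtain a b where ab: "\<And>s y. y \<in> \<omega> \<Longrightarrow> \<psi> (s, y) = a * s + b \<and> G (s, y) = (a, 0)"
    using weakly_neumann_harmonic_affine[OF nh omega_connected] by blast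
  have "c \<le> norm (G (0, y0))" using c(2)[of "(0, y0)"] y0 closure_subset by auto
  then have "a \<noteq> 0" using ab[OF y0, of 0] c(1) by (auto simp: norm_Pair)
  moreover have "\<psi> x - a * fst x = b" if "x \<in> closure \<Omega>" for x
  proof (rule continuous_constant_on_closure[OF _ _ that])
    show "continuous_on (closure \<Omega>) (\<lambda>x. \<psi> x - a * fst x)" by (intro continuous_intros psi_cont)
    show "\<psi> x - a * fst x = b" if "x \<in> \<Omega>" for x using ab[of "snd x" "fst x"] that by (auto simp: Omega_eq)
  qed
  ultimately show ?thesis by (intro exI[of _ a] exI[of _ b]) (auto simp: algebra_simps)
qed

end
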